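(* Let $G$ be a connected Lie group of real dimension $2n$ equipped with a left invariant Riemannian metric $g$ and a left invariant (integrable) complex structure $J$ compatible with $g$. Assume that for some real number $s\neq 0,2$ the $s$-Gauduchon connection $\nabla^s$ of the Hermitian manifold $(G,J,g)$ is flat. If $G$ admits a tangent frame consisting of left invariant vector fields that are parallel with respect to $\nabla^s$, then $g$ is K\"ahler. Moreover, $G$ is abelian.
   Context: On a Hermitian manifold $(M,J,g)$, a Hermitian connection is an affine connection $\nabla$ with $\nabla J=0$ and $\nabla g=0$; the torsion is $T(x,y)=\nabla_xy-\nabla_yx-[x,y]$. The Chern connection $\nabla^c$ is the unique Hermitian connection whose torsion has no $(1,1)$-component, i.e. $T(x,\overline{y})=0$ for $x,y$ of type $(1,0)$. The Bismut connection $\nabla^b$ is the unique Hermitian connection whose torsion is totally skew-symmetric, i.e. $g(T(x,y),z)$ is a $3$-form. For $s\in\mathbb{R}$ the $s$-Gauduchon connection is $\nabla^s=(1-\frac{s}{2})\nabla^c+\frac{s}{2}\nabla^b$. Flat means that the curvature tensor vanishes identically. Compatible means $g(Jx,Jy)=g(x,y)$. $g$ is K\"ahler if the $2$-form $\omega(x,y)=g(Jx,y)$ is closed (equivalently, the Chern torsion vanishes). *)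

theory Defs
  imports "HOL-Analysis.Analysis" "HOL-Library.Function_Algebras"
begin

text \<open>
  Real-valued functions, tangent vectors (derivations) and vector fields are all function types;
  the pointwise vector space structure on them is completed here, so that the library notions
  of span and independence apply.
\<close>

instantiation "fun" :: (type, real_vector) real_vector
begin

definition scaleR_fun :: "real \<Rightarrow> ('a \<Rightarrow> 'b) \<Rightarrow> 'a \<Rightarrow> 'b"
  where "scaleR_fun c f = (\<lambda>x. c *\<^sub>R f x)"

instance
  by standard (auto simp: scaleR_fun_def fun_eq_iff scaleR_add_right scaleR_add_left)

end


section \<open>Smooth manifolds\<close>

text \<open>On open subsets of a Euclidean space \<open>k_smooth_on k\<close> is the class of $C^k$ maps.\<close>

primrec k_smooth_on :: "nat \<Rightarrow> 'a::real_normed_vector set \<Rightarrow> ('a \<Rightarrow> 'b::real_normed_vector) \<Rightarrow> bool"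
  where
    "k_smooth_on 0 S f \<longleftrightarrow> continuous_on S f"
  | "k_smooth_on (Suc k) S f \<longleftrightarrow>
       (\<forall>x\<in>S. f differentiable (at x)) \<and>
       (\<forall>v. k_smooth_on k S (\<lambda>x. frechet_derivative f (at x) v))"

definition smooth_on :: "'a::real_normed_vector set \<Rightarrow> ('a \<Rightarrow> 'b::real_normed_vector) \<Rightarrow> bool"
  where "smooth_on S f \<longleftrightarrow> (\<forall>k. k_smooth_on k S f)"

type_synonym ('m, 'e) chart = "'m set \<times> ('m \<Rightarrow> 'e)"
type_synonym ('m, 'e) atlas = "('m, 'e) chart set"

definition is_chart :: "('m::topological_space, 'e::euclidean_space) chart \<Rightarrow> bool"
  where "is_chart c \<longleftrightarrow> (case c of (U, \<phi>) \<Rightarrow>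
    open U \<and> open (\<phi> ` U) \<and> homeomorphism U (\<phi> ` U) \<phi> (inv_into U \<phi>))"

text \<open>
  The manifold is the whole type \<open>'m\<close>; the Hausdorff and countability axioms are sort constraints.
  The atlas need not be maximal.
\<close>

definition smooth_manifold ::
    "('m::{t2_space,second_countable_topology}, 'e::euclidean_space) atlas \<Rightarrow> bool"
  where "smooth_manifold A \<longleftrightarrow>
    (\<forall>c\<in>A. is_chart c) \<and>
    (\<Union>(U, \<phi>)\<in>A. U) = UNIV \<and>
    (\<forall>(U, \<phi>)\<in>A. \<forall>(V, \<psi>)\<in>A. smooth_on (\<phi> ` (U \<inter> V)) (\<lambda>x. \<psi> (inv_into U \<phi> x)))"

definition smooth_map ::
    "('m::topological_space, 'e::euclidean_space) atlas \<Rightarrow>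
     ('k::topological_space, 'd::euclidean_space) atlas \<Rightarrow> ('m \<Rightarrow> 'k) \<Rightarrow> bool"
  where "smooth_map A B F \<longleftrightarrow>
    continuous_on UNIV F \<and>
    (\<forall>(U, \<phi>)\<in>A. \<forall>(V, \<psi>)\<in>B.
       smooth_on (\<phi> ` (U \<inter> F -` V)) (\<lambda>x. \<psi> (F (inv_into U \<phi> x))))"

definition smooth_fun :: "('m::topological_space, 'e::euclidean_space) atlas \<Rightarrow> ('m \<Rightarrow> real) \<Rightarrow> bool"
  where "smooth_fun A f \<longleftrightarrow>
    (\<forall>(U, \<phi>)\<in>A. smooth_on (\<phi> ` U) (\<lambda>x. f (inv_into U \<phi> x)))"

definition product_atlas ::
    "('m, 'e) atlas \<Rightarrow> ('k, 'd) atlas \<Rightarrow> ('m \<times> 'k, 'e \<times> 'd) atlas"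
  where "product_atlas A B =
    {(U \<times> V, map_prod \<phi> \<psi>) | U \<phi> V \<psi>. (U, \<phi>) \<in> A \<and> (V, \<psi>) \<in> B}"


section \<open>Tangent vectors and vector fields\<close>

type_synonym 'm tangent_vector = "('m \<Rightarrow> real) \<Rightarrow> real"
type_synonym 'm vector_field = "'m \<Rightarrow> 'm tangent_vector"

text \<open>
  Tangent vectors at \<open>p\<close> are the derivations at \<open>p\<close> of the algebra of smooth functions. They are
  set to zero on non-smooth arguments, so that equal derivations are equal as HOL functions.
\<close>

definition tangent_space ::
    "('m::topological_space, 'e::euclidean_space) atlas \<Rightarrow> 'm \<Rightarrow> 'm tangent_vector set"
  where "tangent_space A p = {v.
    (\<forall>f h. smooth_fun A f \<longrightarrow> smooth_fun A h \<longrightarrow>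
       v (f + h) = v f + v h \<and> v (f * h) = f p * v h + h p * v f) \<and>
    (\<forall>c f. smooth_fun A f \<longrightarrow> v (c *\<^sub>R f) = c * v f) \<and>
    (\<forall>f. \<not> smooth_fun A f \<longrightarrow> v f = 0)}"

definition vf_apply :: "'m vector_field \<Rightarrow> ('m \<Rightarrow> real) \<Rightarrow> 'm \<Rightarrow> real"
  where "vf_apply X f = (\<lambda>p. X p f)"

definition vector_fields ::
    "('m::topological_space, 'e::euclidean_space) atlas \<Rightarrow> 'm vector_field set"
  where "vector_fields A = {X.
    (\<forall>p. X p \<in> tangent_space A p) \<and>
    (\<forall>f. smooth_fun A f \<longrightarrow> smooth_fun A (vf_apply X f))}"

definition fun_scale :: "('m \<Rightarrow> real) \<Rightarrow> 'm vector_field \<Rightarrow> 'm vector_field"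
  where "fun_scale f X = (\<lambda>p. f p *\<^sub>R X p)"

definition lie_bracket :: "'m vector_field \<Rightarrow> 'm vector_field \<Rightarrow> 'm vector_field"
  where "lie_bracket X Y = (\<lambda>p f. X p (vf_apply Y f) - Y p (vf_apply X f))"

definition tangent_frame ::
    "('m::topological_space, 'e::euclidean_space) atlas \<Rightarrow> nat \<Rightarrow> (nat \<Rightarrow> 'm vector_field) \<Rightarrow> bool"
  where "tangent_frame A m e \<longleftrightarrow>
    (\<forall>i<m. e i \<in> vector_fields A) \<and>
    (\<forall>p. inj_on (\<lambda>i. e i p) {..<m} \<and>
         independent ((\<lambda>i. e i p) ` {..<m}) \<and>
         span ((\<lambda>i. e i p) ` {..<m}) = tangent_space A p)"


section \<open>Hermitian structures\<close>

definition riemannian_metric ::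
    "('m::topological_space, 'e::euclidean_space) atlas \<Rightarrow>
     ('m \<Rightarrow> 'm tangent_vector \<Rightarrow> 'm tangent_vector \<Rightarrow> real) \<Rightarrow> bool"
  where "riemannian_metric A g \<longleftrightarrow>
    (\<forall>p. \<forall>u\<in>tangent_space A p. \<forall>v\<in>tangent_space A p.
       g p u v = g p v u \<and>
       (\<forall>w\<in>tangent_space A p. g p (u + v) w = g p u w + g p v w) \<and>
       (\<forall>c. g p (c *\<^sub>R u) v = c * g p u v) \<and>
       (u \<noteq> 0 \<longrightarrow> g p u u > 0)) \<and>
    (\<forall>X\<in>vector_fields A. \<forall>Y\<in>vector_fields A. smooth_fun A (\<lambda>p. g p (X p) (Y p)))"

definition metric_vf ::
    "('m \<Rightarrow> 'm tangent_vector \<Rightarrow> 'm tangent_vector \<Rightarrow> real) \<Rightarrow>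
     'm vector_field \<Rightarrow> 'm vector_field \<Rightarrow> 'm \<Rightarrow> real"
  where "metric_vf g X Y = (\<lambda>p. g p (X p) (Y p))"

definition endo_vf :: "('m \<Rightarrow> 'm tangent_vector \<Rightarrow> 'm tangent_vector) \<Rightarrow>
     'm vector_field \<Rightarrow> 'm vector_field"
  where "endo_vf J X = (\<lambda>p. J p (X p))"

definition almost_complex_structure ::
    "('m::topological_space, 'e::euclidean_space) atlas \<Rightarrow>
     ('m \<Rightarrow> 'm tangent_vector \<Rightarrow> 'm tangent_vector) \<Rightarrow> bool"
  where "almost_complex_structure A J \<longleftrightarrow>
    (\<forall>p. \<forall>u\<in>tangent_space A p.
       J p u \<in> tangent_space A p \<and>
       (\<forall>v\<in>tangent_space A p. J p (u + v) = J p u + J p v) \<and>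
       (\<forall>c. J p (c *\<^sub>R u) = c *\<^sub>R J p u) \<and>
       J p (J p u) = - u) \<and>
    (\<forall>X\<in>vector_fields A. endo_vf J X \<in> vector_fields A)"

definition nijenhuis :: "('m \<Rightarrow> 'm tangent_vector \<Rightarrow> 'm tangent_vector) \<Rightarrow>
     'm vector_field \<Rightarrow> 'm vector_field \<Rightarrow> 'm vector_field"
  where "nijenhuis J X Y =
    lie_bracket (endo_vf J X) (endo_vf J Y)
    - endo_vf J (lie_bracket (endo_vf J X) Y)
    - endo_vf J (lie_bracket X (endo_vf J Y))
    - lie_bracket X Y"

definition complex_structure ::
    "('m::topological_space, 'e::euclidean_space) atlas \<Rightarrow>
     ('m \<Rightarrow> 'm tangent_vector \<Rightarrow> 'm tangent_vector) \<Rightarrow> bool"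
  where "complex_structure A J \<longleftrightarrow>
    almost_complex_structure A J \<and>
    (\<forall>X\<in>vector_fields A. \<forall>Y\<in>vector_fields A. nijenhuis J X Y = 0)"

definition compatible ::
    "('m::topological_space, 'e::euclidean_space) atlas \<Rightarrow>
     ('m \<Rightarrow> 'm tangent_vector \<Rightarrow> 'm tangent_vector) \<Rightarrow>
     ('m \<Rightarrow> 'm tangent_vector \<Rightarrow> 'm tangent_vector \<Rightarrow> real) \<Rightarrow> bool"
  where "compatible A J g \<longleftrightarrow>
    (\<forall>p. \<forall>u\<in>tangent_space A p. \<forall>v\<in>tangent_space A p. g p (J p u) (J p v) = g p u v)"

definition kaehler_form ::
    "('m \<Rightarrow> 'm tangent_vector \<Rightarrow> 'm tangent_vector) \<Rightarrow>
     ('m \<Rightarrow> 'm tangent_vector \<Rightarrow> 'm tangent_vector \<Rightarrow> real) \<Rightarrow>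
     'm vector_field \<Rightarrow> 'm vector_field \<Rightarrow> 'm \<Rightarrow> real"
  where "kaehler_form J g X Y = metric_vf g (endo_vf J X) Y"

text \<open>The invariant (Cartan) formula for the exterior derivative of a 2-form.\<close>

definition exterior_derivative2 ::
    "('m vector_field \<Rightarrow> 'm vector_field \<Rightarrow> 'm \<Rightarrow> real) \<Rightarrow>
     'm vector_field \<Rightarrow> 'm vector_field \<Rightarrow> 'm vector_field \<Rightarrow> 'm \<Rightarrow> real"
  where "exterior_derivative2 \<omega> X Y Z =
    vf_apply X (\<omega> Y Z) - vf_apply Y (\<omega> X Z) + vf_apply Z (\<omega> X Y)
    - \<omega> (lie_bracket X Y) Z + \<omega> (lie_bracket X Z) Y - \<omega> (lie_bracket Y Z) X"

definition kaehler ::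
    "('m::topological_space, 'e::euclidean_space) atlas \<Rightarrow>
     ('m \<Rightarrow> 'm tangent_vector \<Rightarrow> 'm tangent_vector) \<Rightarrow>
     ('m \<Rightarrow> 'm tangent_vector \<Rightarrow> 'm tangent_vector \<Rightarrow> real) \<Rightarrow> bool"
  where "kaehler A J g \<longleftrightarrow>
    (\<forall>X\<in>vector_fields A. \<forall>Y\<in>vector_fields A. \<forall>Z\<in>vector_fields A.
       exterior_derivative2 (kaehler_form J g) X Y Z = 0)"


section \<open>Connections\<close>

text \<open>
  A connection is written \<open>nab X Y\<close> for $\nabla_X Y$; its values outside the smooth vector fields
  are irrelevant.
\<close>

type_synonym 'm connection = "'m vector_field \<Rightarrow> 'm vector_field \<Rightarrow> 'm vector_field"

definition affine_connection ::
    "('m::topological_space, 'e::euclidean_space) atlas \<Rightarrow> 'm connection \<Rightarrow> bool"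
  where "affine_connection A nab \<longleftrightarrow>
    (\<forall>X\<in>vector_fields A. \<forall>Y\<in>vector_fields A.
       nab X Y \<in> vector_fields A \<and>
       (\<forall>Z\<in>vector_fields A.
          nab (X + Y) Z = nab X Z + nab Y Z \<and>
          nab X (Y + Z) = nab X Y + nab X Z) \<and>
       (\<forall>f. smooth_fun A f \<longrightarrow>
          nab (fun_scale f X) Y = fun_scale f (nab X Y) \<and>
          nab X (fun_scale f Y) = fun_scale (vf_apply X f) Y + fun_scale f (nab X Y)))"

definition torsion :: "'m connection \<Rightarrow> 'm vector_field \<Rightarrow> 'm vector_field \<Rightarrow> 'm vector_field"
  where "torsion nab X Y = nab X Y - nab Y X - lie_bracket X Y"

definition curvature ::
    "'m connection \<Rightarrow> 'm vector_field \<Rightarrow> 'm vector_field \<Rightarrow> 'm vector_field \<Rightarrow> 'm vector_field"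
  where "curvature nab X Y Z =
    nab X (nab Y Z) - nab Y (nab X Z) - nab (lie_bracket X Y) Z"

definition flat_connection ::
    "('m::topological_space, 'e::euclidean_space) atlas \<Rightarrow> 'm connection \<Rightarrow> bool"
  where "flat_connection A nab \<longleftrightarrow>
    (\<forall>X\<in>vector_fields A. \<forall>Y\<in>vector_fields A. \<forall>Z\<in>vector_fields A. curvature nab X Y Z = 0)"

definition parallel_field ::
    "('m::topological_space, 'e::euclidean_space) atlas \<Rightarrow> 'm connection \<Rightarrow> 'm vector_field \<Rightarrow> bool"
  where "parallel_field A nab Y \<longleftrightarrow> (\<forall>X\<in>vector_fields A. nab X Y = 0)"

definition hermitian_connection ::
    "('m::topological_space, 'e::euclidean_space) atlas \<Rightarrow>
     ('m \<Rightarrow> 'm tangent_vector \<Rightarrow> 'm tangent_vector) \<Rightarrow>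
     ('m \<Rightarrow> 'm tangent_vector \<Rightarrow> 'm tangent_vector \<Rightarrow> real) \<Rightarrow> 'm connection \<Rightarrow> bool"
  where "hermitian_connection A J g nab \<longleftrightarrow>
    affine_connection A nab \<and>
    (\<forall>X\<in>vector_fields A. \<forall>Y\<in>vector_fields A. nab X (endo_vf J Y) = endo_vf J (nab X Y)) \<and>
    (\<forall>X\<in>vector_fields A. \<forall>Y\<in>vector_fields A. \<forall>Z\<in>vector_fields A.
       vf_apply X (metric_vf g Y Z) = metric_vf g (nab X Y) Z + metric_vf g Y (nab X Z))"

text \<open>
  A complex vector field $X_1 + i X_2$ is the pair \<open>(X\<^sub>1, X\<^sub>2)\<close> of its real and imaginary parts.
  It has type $(1,0)$ when $J X_1 + i J X_2 = i (X_1 + i X_2)$.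
\<close>

definition type10_fields ::
    "('m::topological_space, 'e::euclidean_space) atlas \<Rightarrow>
     ('m \<Rightarrow> 'm tangent_vector \<Rightarrow> 'm tangent_vector) \<Rightarrow> ('m vector_field \<times> 'm vector_field) set"
  where "type10_fields A J = {(X1, X2).
    X1 \<in> vector_fields A \<and> X2 \<in> vector_fields A \<and> (endo_vf J X1, endo_vf J X2) = (- X2, X1)}"

definition cnj_field :: "'m vector_field \<times> 'm vector_field \<Rightarrow> 'm vector_field \<times> 'm vector_field"
  where "cnj_field Z = (fst Z, - snd Z)"

text \<open>The complex bilinear extension of a real bilinear operation on vector fields.\<close>

definition complex_bilinear_ext ::
    "('m vector_field \<Rightarrow> 'm vector_field \<Rightarrow> 'm vector_field) \<Rightarrow>
     'm vector_field \<times> 'm vector_field \<Rightarrow> 'm vector_field \<times> 'm vector_field \<Rightarrow>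
     'm vector_field \<times> 'm vector_field"
  where "complex_bilinear_ext T Z W =
    (T (fst Z) (fst W) - T (snd Z) (snd W), T (fst Z) (snd W) + T (snd Z) (fst W))"

definition chern_connection ::
    "('m::topological_space, 'e::euclidean_space) atlas \<Rightarrow>
     ('m \<Rightarrow> 'm tangent_vector \<Rightarrow> 'm tangent_vector) \<Rightarrow>
     ('m \<Rightarrow> 'm tangent_vector \<Rightarrow> 'm tangent_vector \<Rightarrow> real) \<Rightarrow> 'm connection \<Rightarrow> bool"
  where "chern_connection A J g nab \<longleftrightarrow>
    hermitian_connection A J g nab \<and>
    (\<forall>Z\<in>type10_fields A J. \<forall>W\<in>type10_fields A J.
       complex_bilinear_ext (torsion nab) Z (cnj_field W) = 0)"

text \<open>
  A 3-form is an alternating $C^\infty$-trilinear map on vector fields; linearity in the last two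
  arguments follows from the first by skew-symmetry.
\<close>

definition three_form ::
    "('m::topological_space, 'e::euclidean_space) atlas \<Rightarrow>
     ('m vector_field \<Rightarrow> 'm vector_field \<Rightarrow> 'm vector_field \<Rightarrow> 'm \<Rightarrow> real) \<Rightarrow> bool"
  where "three_form A \<tau> \<longleftrightarrow>
    (\<forall>X\<in>vector_fields A. \<forall>Y\<in>vector_fields A. \<forall>Z\<in>vector_fields A.
       smooth_fun A (\<tau> X Y Z) \<and>
       \<tau> Y X Z = - \<tau> X Y Z \<and>
       \<tau> X Z Y = - \<tau> X Y Z \<and>
       (\<forall>W\<in>vector_fields A. \<tau> (X + W) Y Z = \<tau> X Y Z + \<tau> W Y Z) \<and>
       (\<forall>f. smooth_fun A f \<longrightarrow> \<tau> (fun_scale f X) Y Z = f * \<tau> X Y Z))"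

definition bismut_connection ::
    "('m::topological_space, 'e::euclidean_space) atlas \<Rightarrow>
     ('m \<Rightarrow> 'm tangent_vector \<Rightarrow> 'm tangent_vector) \<Rightarrow>
     ('m \<Rightarrow> 'm tangent_vector \<Rightarrow> 'm tangent_vector \<Rightarrow> real) \<Rightarrow> 'm connection \<Rightarrow> bool"
  where "bismut_connection A J g nab \<longleftrightarrow>
    hermitian_connection A J g nab \<and>
    three_form A (\<lambda>X Y Z. metric_vf g (torsion nab X Y) Z)"

text \<open>
  On a Hermitian manifold the Chern and the Bismut connection exist and are unique (as operators on
  smooth vector fields), so the existential quantifier below only names them.
\<close>

definition gauduchon_connection ::
    "('m::topological_space, 'e::euclidean_space) atlas \<Rightarrow>
     ('m \<Rightarrow> 'm tangent_vector \<Rightarrow> 'm tangent_vector) \<Rightarrow>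
     ('m \<Rightarrow> 'm tangent_vector \<Rightarrow> 'm tangent_vector \<Rightarrow> real) \<Rightarrow> real \<Rightarrow> 'm connection \<Rightarrow> bool"
  where "gauduchon_connection A J g s nab \<longleftrightarrow>
    (\<exists>nabc nabb. chern_connection A J g nabc \<and> bismut_connection A J g nabb \<and>
       (\<forall>X\<in>vector_fields A. \<forall>Y\<in>vector_fields A.
          nab X Y = (1 - s / 2) *\<^sub>R nabc X Y + (s / 2) *\<^sub>R nabb X Y))"


section \<open>Lie groups\<close>

text \<open>
  The group law is written additively, via the class \<^class>\<open>group_add\<close>, which does not assume
  commutativity.
\<close>

definition lie_group ::
    "('g::{group_add,t2_space,second_countable_topology}, 'e::euclidean_space) atlas \<Rightarrow> bool"
  where "lie_group A \<longleftrightarrow>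
    smooth_manifold A \<and>
    smooth_map (product_atlas A A) A (\<lambda>(x, y). x + y) \<and>
    smooth_map A A (\<lambda>x. - x)"

text \<open>The differential of the left translation by \<open>a\<close>.\<close>

definition left_push :: "'g::group_add \<Rightarrow> 'g tangent_vector \<Rightarrow> 'g tangent_vector"
  where "left_push a v = (\<lambda>f. v (\<lambda>x. f (a + x)))"

definition left_invariant_field :: "'g::group_add vector_field \<Rightarrow> bool"
  where "left_invariant_field X \<longleftrightarrow> (\<forall>a p. X (a + p) = left_push a (X p))"

definition left_invariant_metric ::
    "('g::{group_add,topological_space}, 'e::euclidean_space) atlas \<Rightarrow>
     ('g \<Rightarrow> 'g tangent_vector \<Rightarrow> 'g tangent_vector \<Rightarrow> real) \<Rightarrow> bool"
  where "left_invariant_metric A g \<longleftrightarrow>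
    (\<forall>a p. \<forall>u\<in>tangent_space A p. \<forall>v\<in>tangent_space A p.
       g (a + p) (left_push a u) (left_push a v) = g p u v)"

definition left_invariant_endo ::
    "('g::{group_add,topological_space}, 'e::euclidean_space) atlas \<Rightarrow>
     ('g \<Rightarrow> 'g tangent_vector \<Rightarrow> 'g tangent_vector) \<Rightarrow> bool"
  where "left_invariant_endo A J \<longleftrightarrow>
    (\<forall>a p. \<forall>u\<in>tangent_space A p. J (a + p) (left_push a u) = left_push a (J p u))"

end

(* On left invariant fields the flat connection vanishes, so with t = s/2 the Chern connection C and the
   Bismut connection B satisfy (1 - t) C + t B = 0. The difference B - C is determined by the Chern torsion
   T, hence so are C = -t (B - C) and the Lie bracket, which combines T and its adjoint. Splitting the Jacobi
   identity by complex types yields first T(T(x,y),z) = 0 and then T = 0, where t <> 0, 1 is used. So the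
   bracket vanishes on left invariant fields, and the Chern connection is torsion free, which gives Kaehler.

   For the group, right invariant fields commute with left invariant ones. As the left invariant frame
   commutes, the coefficients of a right invariant field in it are constant, so the two kinds of fields
   agree. Then f(a + y - a - y) has zero derivative in y for every smooth f, and smooth functions separate
   points. *)
theory Submission
  imports Defs "HOL-Real_Asymp.Real_Asymp"
begin

section \<open>Smooth functions on Euclidean spaces\<close>

text \<open>The algebra runs at each point \<open>p\<close> separately: on left invariant fields the
  two connections are read off at \<open>p\<close> as operations \<open>C\<close> and
  \<open>B\<close> on the model space \<open>'e\<close>, while the inner product \<open>Q\<close>,
  the structure \<open>j\<close> and the bracket \<open>br\<close> are the same at all points. The
  conditions on the connections become identities between these operations.

  The types separate because \<open>T\<close> is complex bilinear, while its
  \<open>Q\<close>-adjoint \<open>P\<close> is antilinear in the first argument. With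
  \<open>C = t (T - P)\<close> the bracket is (2 t - 1) T(x,y) - t P(x,y) + t P(y,x). Positivity of
  \<open>Q\<close> finally kills the values of \<open>T\<close>, which are central for
  \<open>T\<close> by then.

  On the group, words are differentiated one occurrence of the variable at a time. This rests on
  three rules for functions of two points: smooth dependence on a parameter, a sum rule on the
  diagonal, and symmetry of mixed derivatives. They are proved in coordinates, so abstract
  derivations have to be matched with coordinate vectors; the frame supplies the dimension bound for
  that.\<close>

lemma k_smooth_on_cong:
  assumes "open S" and "\<And>x. x \<in> S \<Longrightarrow> f x = g x" and "k_smooth_on k S f"
  shows "k_smooth_on k S g"
  using assms(2,3)
proof (induction k arbitrary: f g)
  case 0
  then show ?case using continuous_on_cong[of S S f g] by simp
next
  case (Suc k)
  have g: "(g has_derivative frechet_derivative f (at x)) (at x)" if "x \<in> S" for x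
  proof -
    have "(f has_derivative frechet_derivative f (at x)) (at x)"
      using Suc.prems(2) that frechet_derivative_works by auto
    then show ?thesis
      by (rule has_derivative_transform_within_open[OF _ assms(1) that Suc.prems(1)])
  qed
  have eq: "frechet_derivative g (at x) = frechet_derivative f (at x)" if "x \<in> S" for x
    using frechet_derivative_at[OF g[OF that]] by simp
  have "k_smooth_on k S (\<lambda>x. frechet_derivative g (at x) v)" for v
    by (rule Suc.IH[of "\<lambda>x. frechet_derivative f (at x) v"]) (use Suc.prems(2) eq in auto)
  then show ?case using g by (auto simp: differentiable_def)
qed

text \<open>Any family \<open>f'\<close> of derivatives will do, so the closure rules below can
  compute derivatives instead of unfolding \<open>frechet_derivative\<close>.\<close>

lemma k_smooth_on_SucI:
  assumes "open S" and d: "\<And>x. x \<in> S \<Longrightarrow> (f has_derivative f' x) (at x)"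
    and "\<And>v. k_smooth_on k S (\<lambda>x. f' x v)"
  shows "k_smooth_on (Suc k) S f"
proof -
  have "k_smooth_on k S (\<lambda>x. frechet_derivative f (at x) v)" for v
    by (rule k_smooth_on_cong[OF assms(1) _ assms(3)[of v]])
       (use frechet_derivative_at[OF d] in auto)
  then show ?thesis using d by (auto simp: differentiable_def)
qed

lemma k_smooth_on_SucE:
  assumes "k_smooth_on (Suc k) S f"
  obtains f' where "\<And>x. x \<in> S \<Longrightarrow> (f has_derivative f' x) (at x)"
    and "\<And>v. k_smooth_on k S (\<lambda>x. f' x v)"
  using assms frechet_derivative_works that[of "\<lambda>x. frechet_derivative f (at x)"] by auto

lemma k_smooth_on_SucD:
  "k_smooth_on (Suc k) S f \<Longrightarrow> k_smooth_on k S f"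
proof (induction k arbitrary: f)
  case 0
  then show ?case
    by (auto intro!: continuous_at_imp_continuous_on differentiable_imp_continuous_within)
next
  case (Suc k)
  then show ?case using k_smooth_on.simps(2) by blast
qed

lemma k_smooth_on_subset:
  "k_smooth_on k S f \<Longrightarrow> T \<subseteq> S \<Longrightarrow> k_smooth_on k T f"
  by (induction k arbitrary: f) (auto intro: continuous_on_subset)

text \<open>Derivatives are taken \<open>at x\<close> and not within \<open>S\<close>, so each
  condition concerns only a neighbourhood of the point.\<close>

lemma k_smooth_on_locally:
  assumes "\<And>x. x \<in> S \<Longrightarrow> \<exists>U. open U \<and> x \<in> U \<and> k_smooth_on k U f"
  shows "k_smooth_on k S f"
  using assms
proof (induction k arbitrary: f)
  case 0
  then show ?case
    by (metis continuous_at_imp_continuous_on continuous_on_eq_continuous_at k_smooth_on.simps(1))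
next
  case (Suc k)
  have "k_smooth_on k S (\<lambda>x. frechet_derivative f (at x) v)" for v
    by (rule Suc.IH) (use Suc.prems in fastforce)
  moreover have "f differentiable (at x)" if "x \<in> S" for x
    using Suc.prems[OF that] by auto
  ultimately show ?case by simp
qed

lemma k_smooth_on_const: "open S \<Longrightarrow> k_smooth_on k S (\<lambda>x. c)"
proof (induction k arbitrary: c)
  case (Suc k)
  show ?case by (rule k_smooth_on_SucI[OF Suc.prems, where f' = "\<lambda>x v. 0"]) (use Suc in auto)
qed auto

lemma k_smooth_on_linear:
  assumes "open S" "bounded_linear L"
  shows "k_smooth_on k S L"
proof (cases k)
  case 0
  then show ?thesis using assms by (simp add: linear_continuous_on)
next
  case (Suc m)
  show ?thesis unfolding Suc
    by (rule k_smooth_on_SucI[OF assms(1), where f' = "\<lambda>x. L"])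
       (use assms in \<open>auto intro: bounded_linear_imp_has_derivative k_smooth_on_const\<close>)
qed

lemma k_smooth_on_compose_linear:
  assumes "open S" "bounded_linear L" "k_smooth_on k S f"
  shows "k_smooth_on k S (\<lambda>x. L (f x))"
  using assms(3)
proof (induction k arbitrary: f)
  case 0
  then show ?case using bounded_linear.continuous_on[OF assms(2)] by simp
next
  case (Suc k)
  obtain f' where f': "\<And>x. x \<in> S \<Longrightarrow> (f has_derivative f' x) (at x)"
    "\<And>v. k_smooth_on k S (\<lambda>x. f' x v)" using k_smooth_on_SucE[OF Suc.prems] by blast
  show ?case
    by (rule k_smooth_on_SucI[OF assms(1), where f' = "\<lambda>x v. L (f' x v)"])
       (use f' Suc.IH in \<open>auto intro: bounded_linear.has_derivative[OF assms(2)]\<close>)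
qed

lemma k_smooth_on_add:
  assumes "open S" "k_smooth_on k S f" "k_smooth_on k S g"
  shows "k_smooth_on k S (\<lambda>x. f x + g x)"
  using assms(2,3)
proof (induction k arbitrary: f g)
  case 0
  then show ?case by (simp add: continuous_on_add)
next
  case (Suc k)
  obtain f' where f': "\<And>x. x \<in> S \<Longrightarrow> (f has_derivative f' x) (at x)"
    "\<And>v. k_smooth_on k S (\<lambda>x. f' x v)" using k_smooth_on_SucE[OF Suc.prems(1)] by blast
  obtain g' where g': "\<And>x. x \<in> S \<Longrightarrow> (g has_derivative g' x) (at x)"
    "\<And>v. k_smooth_on k S (\<lambda>x. g' x v)" using k_smooth_on_SucE[OF Suc.prems(2)] by blast
  show ?case
    by (rule k_smooth_on_SucI[OF assms(1), where f' = "\<lambda>x v. f' x v + g' x v"])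
       (use f' g' Suc.IH in \<open>auto intro: has_derivative_add\<close>)
qed

text \<open>The Leibniz rule needs \<open>f\<close> and \<open>g\<close> themselves at order
  \<open>k\<close>, besides their derivatives. One statement covers products, scalar multiples and
  inner products.\<close>

lemma k_smooth_on_bilinear:
  assumes "open S" "bounded_bilinear B" "k_smooth_on k S f" "k_smooth_on k S g"
  shows "k_smooth_on k S (\<lambda>x. B (f x) (g x))"
  using assms(3,4)
proof (induction k arbitrary: f g)
  case 0
  then show ?case using bounded_bilinear.continuous_on[OF assms(2)] by simp
next
  case (Suc k)
  obtain f' where f': "\<And>x. x \<in> S \<Longrightarrow> (f has_derivative f' x) (at x)"
    "\<And>v. k_smooth_on k S (\<lambda>x. f' x v)" using k_smooth_on_SucE[OF Suc.prems(1)] by blast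
  obtain g' where g': "\<And>x. x \<in> S \<Longrightarrow> (g has_derivative g' x) (at x)"
    "\<And>v. k_smooth_on k S (\<lambda>x. g' x v)" using k_smooth_on_SucE[OF Suc.prems(2)] by blast
  show ?case
    by (rule k_smooth_on_SucI[OF assms(1), where f' = "\<lambda>x v. B (f x) (g' x v) + B (f' x v) (g x)"])
       (use f' g' Suc.IH k_smooth_on_SucD[OF Suc.prems(1)] k_smooth_on_SucD[OF Suc.prems(2)] in
         \<open>auto intro!: bounded_bilinear.FDERIV[OF assms(2)] k_smooth_on_add[OF assms(1)]\<close>)
qed

lemma k_smooth_on_sum:
  assumes "open S" "finite I" "\<And>i. i \<in> I \<Longrightarrow> k_smooth_on k S (f i)"
  shows "k_smooth_on k S (\<lambda>x. \<Sum>i\<in>I. f i x)"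
  using assms(2,3)
  by (induction I rule: finite_induct)
     (auto intro: k_smooth_on_const[OF assms(1)] k_smooth_on_add[OF assms(1)])

lemma k_smooth_on_Pair:
  assumes "open S" "k_smooth_on k S f" "k_smooth_on k S g"
  shows "k_smooth_on k S (\<lambda>x. (f x, g x))"
proof -
  have "bounded_linear (\<lambda>u :: 'b. (u, 0 :: 'c))" "bounded_linear (\<lambda>u :: 'c. (0 :: 'b, u))"
    by (auto intro: bounded_linear_Pair bounded_linear_ident bounded_linear_zero)
  from k_smooth_on_add[OF assms(1) k_smooth_on_compose_linear[OF assms(1) this(1) assms(2)]
      k_smooth_on_compose_linear[OF assms(1) this(2) assms(3)]]
  show ?thesis by simp
qed

lemma k_smooth_on_compose:
  fixes f :: "'a::real_normed_vector \<Rightarrow> 'b::euclidean_space"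
  assumes "open S" "k_smooth_on k T g" "k_smooth_on k S f" "f ` S \<subseteq> T"
  shows "k_smooth_on k S (\<lambda>x. g (f x))"
  using assms(2,3)
proof (induction k arbitrary: g)
  case 0
  then show ?case using assms(4) by (auto intro: continuous_on_compose2)
next
  case (Suc k)
  obtain f' where f': "\<And>x. x \<in> S \<Longrightarrow> (f has_derivative f' x) (at x)"
    "\<And>v. k_smooth_on k S (\<lambda>x. f' x v)" using k_smooth_on_SucE[OF Suc.prems(2)] by blast
  obtain g' where g': "\<And>x. x \<in> T \<Longrightarrow> (g has_derivative g' x) (at x)"
    "\<And>v. k_smooth_on k T (\<lambda>x. g' x v)" using k_smooth_on_SucE[OF Suc.prems(1)] by blast
  have fk: "k_smooth_on k S f" by (rule k_smooth_on_SucD[OF Suc.prems(2)])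
  \<comment> \<open>In the chain rule the direction \<open>f' x v\<close> varies with
    \<open>x\<close>, whereas the induction hypothesis is about fixed directions. Expanding it in
    the basis moves the variation into scalar coefficients.\<close>
  define h where "h x v = (\<Sum>b\<in>Basis. (f' x v \<bullet> b) *\<^sub>R g' (f x) b)" for x v
  have h: "g' (f x) (f' x v) = h x v" if "x \<in> S" for x v
  proof -
    have l: "linear (g' (f x))"
      using g'(1)[of "f x"] that assms(4) has_derivative_linear by blast
    have "g' (f x) (\<Sum>b\<in>Basis. (f' x v \<bullet> b) *\<^sub>R b) = h x v"
      unfolding h_def by (simp add: linear_sum[OF l] linear_scale[OF l])
    then show ?thesis by (simp add: euclidean_representation)
  qed
  show ?case
  proof (rule k_smooth_on_SucI[OF assms(1), where f' = h])
    fix x assume x: "x \<in> S"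
    have "((\<lambda>x. g (f x)) has_derivative (\<lambda>v. g' (f x) (f' x v))) (at x)"
      using has_derivative_compose[OF f'(1)[OF x] g'(1)[of "f x"]] x assms(4) by auto
    also have "(\<lambda>v. g' (f x) (f' x v)) = h x" using h[OF x] by auto
    finally show "((\<lambda>x. g (f x)) has_derivative h x) (at x)" .
  next
    fix v
    show "k_smooth_on k S (\<lambda>x. h x v)" unfolding h_def
      by (intro k_smooth_on_sum[OF assms(1)] k_smooth_on_bilinear[OF assms(1) bounded_bilinear_scaleR]
          k_smooth_on_compose_linear[OF assms(1) bounded_linear_inner_left] f'(2) Suc.IH g'(2) fk) auto
  qed
qed

lemma smooth_on_cong:
  "open S \<Longrightarrow> (\<And>x. x \<in> S \<Longrightarrow> f x = g x) \<Longrightarrow> smooth_on S f \<Longrightarrow> smooth_on S g"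
  unfolding smooth_on_def using k_smooth_on_cong by metis

lemma smooth_on_subset: "smooth_on S f \<Longrightarrow> T \<subseteq> S \<Longrightarrow> smooth_on T f"
  unfolding smooth_on_def using k_smooth_on_subset by metis

lemma smooth_on_locally:
  "(\<And>x. x \<in> S \<Longrightarrow> \<exists>U. open U \<and> x \<in> U \<and> smooth_on U f) \<Longrightarrow> smooth_on S f"
  unfolding smooth_on_def by (intro allI k_smooth_on_locally) blast

lemma smooth_on_const: "open S \<Longrightarrow> smooth_on S (\<lambda>x. c)"
  unfolding smooth_on_def using k_smooth_on_const by metis

lemma smooth_on_linear: "open S \<Longrightarrow> bounded_linear L \<Longrightarrow> smooth_on S L"
  unfolding smooth_on_def using k_smooth_on_linear by metis

lemma smooth_on_add: "open S \<Longrightarrow> smooth_on S f \<Longrightarrow> smooth_on S g \<Longrightarrow> smooth_on S (\<lambda>x. f x + g x)"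
  unfolding smooth_on_def using k_smooth_on_add by metis

lemma smooth_on_bilinear: "open S \<Longrightarrow> bounded_bilinear B \<Longrightarrow> smooth_on S f \<Longrightarrow> smooth_on S g \<Longrightarrow>
    smooth_on S (\<lambda>x. B (f x) (g x))"
  unfolding smooth_on_def using k_smooth_on_bilinear by metis

lemma smooth_on_mult: "open S \<Longrightarrow> smooth_on S f \<Longrightarrow> smooth_on S g \<Longrightarrow>
    smooth_on S (\<lambda>x. f x * g x :: 'a::real_normed_algebra)"
  by (rule smooth_on_bilinear[OF _ bounded_bilinear_mult])

lemma smooth_on_Pair: "open S \<Longrightarrow> smooth_on S f \<Longrightarrow> smooth_on S g \<Longrightarrow> smooth_on S (\<lambda>x. (f x, g x))"
  unfolding smooth_on_def using k_smooth_on_Pair by metis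

lemma smooth_on_compose:
  fixes f :: "'a::real_normed_vector \<Rightarrow> 'b::euclidean_space"
  assumes "open S" "smooth_on T g" "smooth_on S f" "f ` S \<subseteq> T"
  shows "smooth_on S (\<lambda>x. g (f x))"
  using assms k_smooth_on_compose unfolding smooth_on_def by metis

lemma smooth_on_differentiable: "smooth_on S f \<Longrightarrow> x \<in> S \<Longrightarrow> f differentiable (at x)"
  unfolding smooth_on_def using k_smooth_on.simps(2) by metis

lemma smooth_on_frechet_derivative: "smooth_on S f \<Longrightarrow> smooth_on S (\<lambda>x. frechet_derivative f (at x) v)"
  unfolding smooth_on_def using k_smooth_on.simps(2) by metis

lemma smooth_on_continuous_on: "smooth_on S f \<Longrightarrow> continuous_on S f"
  unfolding smooth_on_def using k_smooth_on.simps(1) by metis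

section \<open>Smooth bump functions\<close>

text \<open>This family is closed under differentiation, up to linear combinations.\<close>

definition flat_exp :: "nat \<Rightarrow> real \<Rightarrow> real"
  where "flat_exp n x = (if x > 0 then exp (- 1 / x) / x ^ n else 0)"

lemma flat_exp_has_derivative:
  "(flat_exp n has_real_derivative flat_exp (n + 2) x - n * flat_exp (n + 1) x) (at x)"
proof (cases x "0 :: real" rule: linorder_cases)
  case less
  have "((\<lambda>x. 0) has_real_derivative 0) (at x)" by simp
  then have "(flat_exp n has_real_derivative 0) (at x)"
    by (rule has_field_derivative_transform_within_open[where S = "{..<0}"])
       (use less in \<open>auto simp: flat_exp_def\<close>)
  then show ?thesis using less by (simp add: flat_exp_def)
next
  case greater
  have "((\<lambda>x. exp (- 1 / x) / x ^ n) has_real_derivative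
      exp (- 1 / x) / x ^ (n + 2) - n * (exp (- 1 / x) / x ^ (n + 1))) (at x)"
    using greater
    apply (auto intro!: derivative_eq_intros simp: field_simps power2_eq_square)
    apply (cases n; simp add: field_simps)
    done
  then have "(flat_exp n has_real_derivative
      exp (- 1 / x) / x ^ (n + 2) - n * (exp (- 1 / x) / x ^ (n + 1))) (at x)"
    by (rule has_field_derivative_transform_within_open[where S = "{0<..}"])
       (use greater in \<open>auto simp: flat_exp_def\<close>)
  then show ?thesis using greater by (simp add: flat_exp_def)
next
  case equal
  \<comment> \<open>At 0 the difference quotient is \<open>flat_exp n h / h\<close>: from the right
    the exponential beats every power, from the left the quotient is 0.\<close>
  have "((\<lambda>h. exp (- 1 / h) / h ^ n / h) \<longlongrightarrow> 0) (at_right (0::real))" by real_asymp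
  then have r: "((\<lambda>h. flat_exp n h / h) \<longlongrightarrow> 0) (at_right (0::real))"
    by (rule Lim_transform_eventually) (auto simp: flat_exp_def eventually_at_right_less eventually_at intro: exI[of _ 1])
  have "((\<lambda>h. flat_exp n h / h) \<longlongrightarrow> 0) (at_left (0::real))"
    by (rule Lim_transform_eventually[OF tendsto_const])
       (auto simp: flat_exp_def eventually_at intro: exI[of _ 1])
  with r have "((\<lambda>h. flat_exp n h / h) \<longlongrightarrow> 0) (at (0::real))"
    by (simp add: filterlim_split_at)
  then show ?thesis unfolding equal by (simp add: has_field_derivative_iff flat_exp_def)
qed

lemma smooth_on_flat_exp: "smooth_on UNIV (flat_exp n)"
proof -
  have "k_smooth_on k UNIV (flat_exp n)" for k
  proof (induction k arbitrary: n)
    case 0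
    then show ?case
      using flat_exp_has_derivative by (auto intro!: continuous_at_imp_continuous_on DERIV_isCont)
  next
    case (Suc k)
    show ?case
    proof (rule k_smooth_on_SucI[OF open_UNIV,
          where f' = "\<lambda>x v. flat_exp (n + 2) x * v + (- real n * flat_exp (n + 1) x) * v"])
      show "(flat_exp n has_derivative (\<lambda>v. flat_exp (n + 2) x * v + (- real n * flat_exp (n + 1) x) * v)) (at x)" for x
        by (rule has_derivative_eq_rhs[OF flat_exp_has_derivative[of n x, unfolded has_field_derivative_def]])
           (simp add: fun_eq_iff algebra_simps)
      show "k_smooth_on k UNIV (\<lambda>x. flat_exp (n + 2) x * v + (- real n * flat_exp (n + 1) x) * v)" for v
        by (intro k_smooth_on_add k_smooth_on_bilinear[OF _ bounded_bilinear_mult] k_smooth_on_const Suc.IH open_UNIV)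
    qed
  qed
  then show ?thesis by (simp add: smooth_on_def)
qed

text \<open>The centre of the bump is moved off \<open>x\<close>, so that the derivative at \<open>x\<close> in direction \<open>v\<close>
  does not vanish.\<close>

lemma bump_function_exists:
  fixes x v :: "'a::euclidean_space"
  assumes "open S" "x \<in> S"
  obtains f :: "'a \<Rightarrow> real" and K where "smooth_on UNIV f" "compact K" "K \<subseteq> S"
    "\<And>y. y \<notin> K \<Longrightarrow> f y = 0" "f x \<noteq> 0" "v \<noteq> 0 \<Longrightarrow> frechet_derivative f (at x) v \<noteq> 0"
proof -
  obtain r where r: "r > 0" "cball x r \<subseteq> S" using open_contains_cball assms by metis
  \<comment> \<open>The shift by r / 4 keeps \<open>x\<close> inside the ball of radius r / 2 about
    \<open>c\<close>, and that ball within distance 3 r / 4 of \<open>x\<close>.\<close>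
  define c where "c = (if v = 0 then x else x + (r / (4 * norm v)) *\<^sub>R v)"
  have dc: "dist x c \<le> r / 4" using r(1) by (simp add: c_def dist_norm)
  \<comment> \<open>\<open>q\<close> is positive exactly on the open ball of radius r / 2 about
    \<open>c\<close>. It is spelled with sums and products so that the smoothness rules apply
    directly.\<close>
  define q where "q y = (r / 2)\<^sup>2 + (- 1) * ((y + - c) \<bullet> (y + - c))" for y
  have q: "q y = (r / 2)\<^sup>2 - (dist y c)\<^sup>2" for y
    by (simp add: q_def dist_norm power2_norm_eq_inner)
  define f where "f y = flat_exp 0 (q y)" for y
  have qs: "smooth_on UNIV q" unfolding q_def
    by (intro smooth_on_add smooth_on_mult smooth_on_bilinear[OF _ bounded_bilinear_inner] smooth_on_const
        smooth_on_linear[OF _ bounded_linear_ident] open_UNIV)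
  show thesis
  proof
    show "smooth_on UNIV f" unfolding f_def
      by (rule smooth_on_compose[OF open_UNIV smooth_on_flat_exp qs]) simp
    show "compact (cball c (r / 2))" by simp
    show "cball c (r / 2) \<subseteq> S"
    proof
      fix y assume "y \<in> cball c (r / 2)"
      then have "dist x y \<le> r / 4 + r / 2" using dc dist_triangle[of x y c] by simp
      then show "y \<in> S" using r by (intro set_mp[OF r(2)]) simp
    qed
    show "f y = 0" if "y \<notin> cball c (r / 2)" for y
    proof -
      have "(r / 2)\<^sup>2 \<le> (dist y c)\<^sup>2" using that r(1) by (intro power_mono) (auto simp: dist_commute)
      then show ?thesis by (simp add: f_def q flat_exp_def)
    qed
    have "(dist x c)\<^sup>2 \<le> (r / 4)\<^sup>2" using dc by (intro power_mono) auto
    also have "\<dots> < (r / 2)\<^sup>2" using r(1) by (simp add: power2_eq_square)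
    finally have qx: "q x > 0" by (simp add: q)
    then show "f x \<noteq> 0" by (simp add: f_def flat_exp_def)
    assume v: "v \<noteq> 0"
    have "(q has_derivative (\<lambda>h. - 2 * ((x - c) \<bullet> h))) (at x)"
      unfolding q_def by (auto intro!: derivative_eq_intros simp: inner_commute)
    from DERIV_compose_FDERIV[OF flat_exp_has_derivative[of 0] this]
    have "(f has_derivative (\<lambda>h. - 2 * ((x - c) \<bullet> h) * flat_exp (Suc (Suc 0)) (q x))) (at x)"
      unfolding f_def by simp
    then have "frechet_derivative f (at x) v = - 2 * ((x - c) \<bullet> v) * flat_exp (Suc (Suc 0)) (q x)"
      using frechet_derivative_at by metis
    moreover have "(x - c) \<bullet> v \<noteq> 0" using v r(1) by (simp add: c_def)
    moreover have "flat_exp (Suc (Suc 0)) (q x) \<noteq> 0" using qx by (simp add: flat_exp_def)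
    ultimately show "frechet_derivative f (at x) v \<noteq> 0" by simp
  qed
qed

section \<open>Symmetry of second derivatives\<close>

text \<open>The mean value theorem is used in direction \<open>a\<close> on the difference along
  \<open>b\<close>, then in direction \<open>b\<close> on the derivative along \<open>a\<close>. The
  second difference is symmetric in \<open>a\<close> and \<open>b\<close>, and the hull confines
  \<open>y\<close> to a small set around \<open>x\<close>.\<close>

lemma mixed_difference_mean_value:
  fixes f :: "'a::real_normed_vector \<Rightarrow> real"
  assumes S: "open S" "convex S" and f: "k_smooth_on 2 S f" and h: "h > 0"
    and cor: "x \<in> S" "x + h *\<^sub>R a \<in> S" "x + h *\<^sub>R b \<in> S" "x + h *\<^sub>R a + h *\<^sub>R b \<in> S"
  obtains y where "y \<in> convex hull {x, x + h *\<^sub>R a, x + h *\<^sub>R b, x + h *\<^sub>R a + h *\<^sub>R b}"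
    "f (x + h *\<^sub>R a + h *\<^sub>R b) - f (x + h *\<^sub>R a) - f (x + h *\<^sub>R b) + f x
      = h\<^sup>2 * frechet_derivative (\<lambda>z. frechet_derivative f (at z) a) (at y) b"
proof -
  define C where "C = convex hull {x, x + h *\<^sub>R a, x + h *\<^sub>R b, x + h *\<^sub>R a + h *\<^sub>R b}"
  have CS: "C \<subseteq> S" unfolding C_def using cor S(2) by (intro hull_minimal) auto
  \<comment> \<open>Interpolate along \<open>a\<close> on the two sides of the parallelogram, then
    along \<open>b\<close> between the points found.\<close>
  have inC: "x + s *\<^sub>R a + t *\<^sub>R b \<in> C" if "0 \<le> s" "s \<le> h" "0 \<le> t" "t \<le> h" for s t
  proof -
    have c: "convex C" by (simp add: C_def convex_convex_hull)
    have m: "x \<in> C" "x + h *\<^sub>R a \<in> C" "x + h *\<^sub>R b \<in> C" "x + h *\<^sub>R a + h *\<^sub>R b \<in> C"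
      unfolding C_def by (auto intro: hull_inc)
    have "(1 - s / h) *\<^sub>R x + (s / h) *\<^sub>R (x + h *\<^sub>R a) \<in> C"
      by (rule convexD_alt[OF c m(1,2)]) (use that h in auto)
    then have 1: "x + s *\<^sub>R a \<in> C" using h by (simp add: algebra_simps)
    have "(1 - s / h) *\<^sub>R (x + h *\<^sub>R b) + (s / h) *\<^sub>R (x + h *\<^sub>R a + h *\<^sub>R b) \<in> C"
      by (rule convexD_alt[OF c m(3,4)]) (use that h in auto)
    then have 2: "x + s *\<^sub>R a + h *\<^sub>R b \<in> C" using h by (simp add: algebra_simps)
    have "(1 - t / h) *\<^sub>R (x + s *\<^sub>R a) + (t / h) *\<^sub>R (x + s *\<^sub>R a + h *\<^sub>R b) \<in> C"
      by (rule convexD_alt[OF c 1 2]) (use that h in auto)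
    then show ?thesis using h by (simp add: algebra_simps)
  qed
  let ?Df = "\<lambda>z. frechet_derivative f (at z)"
  have d1: "(f has_derivative ?Df z) (at z)" if "z \<in> C" for z
    using f that CS frechet_derivative_works by (auto simp: numeral_2_eq_2)
  have d2: "((\<lambda>z. ?Df z a) has_derivative frechet_derivative (\<lambda>z. ?Df z a) (at z)) (at z)" if "z \<in> C" for z
    unfolding frechet_derivative_works[symmetric] using f that CS by (auto simp: numeral_2_eq_2)
  define \<phi> where "\<phi> s = f (x + s *\<^sub>R a + h *\<^sub>R b) - f (x + s *\<^sub>R a)" for s
  have D: "((\<lambda>s. f (x + s *\<^sub>R a + t *\<^sub>R b)) has_real_derivative ?Df (x + s *\<^sub>R a + t *\<^sub>R b) a) (at s)"
    if "0 \<le> s" "s \<le> h" "0 \<le> t" "t \<le> h" for s t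
  proof -
    have "((\<lambda>s. x + s *\<^sub>R a + t *\<^sub>R b) has_derivative (\<lambda>u. u *\<^sub>R a)) (at s)"
      by (auto intro!: derivative_eq_intros)
    from has_derivative_compose[OF this d1[OF inC[OF that]]]
    have "((\<lambda>s. f (x + s *\<^sub>R a + t *\<^sub>R b)) has_derivative (\<lambda>u. ?Df (x + s *\<^sub>R a + t *\<^sub>R b) (u *\<^sub>R a))) (at s)" .
    moreover have "?Df (x + s *\<^sub>R a + t *\<^sub>R b) (u *\<^sub>R a) = ?Df (x + s *\<^sub>R a + t *\<^sub>R b) a * u" for u
      using linear_scale[OF has_derivative_linear[OF d1[OF inC[OF that]]]] by simp
    ultimately show ?thesis by (simp add: has_field_derivative_def)
  qed
  have "\<exists>s. 0 < s \<and> s < h \<and> \<phi> h - \<phi> 0 = (h - 0) * (?Df (x + s *\<^sub>R a + h *\<^sub>R b) a - ?Df (x + s *\<^sub>R a) a)"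
    unfolding \<phi>_def
    by (rule MVT2[OF h]) (use D[of _ h] D[of _ 0] h in \<open>auto intro!: DERIV_diff\<close>)
  then obtain s where s: "0 < s" "s < h"
    "\<phi> h - \<phi> 0 = h * (?Df (x + s *\<^sub>R a + h *\<^sub>R b) a - ?Df (x + s *\<^sub>R a) a)" by auto
  have D2: "((\<lambda>t. ?Df (x + s *\<^sub>R a + t *\<^sub>R b) a) has_real_derivative
      frechet_derivative (\<lambda>z. ?Df z a) (at (x + s *\<^sub>R a + t *\<^sub>R b)) b) (at t)"
    if "0 \<le> t" "t \<le> h" for t
  proof -
    have i: "x + s *\<^sub>R a + t *\<^sub>R b \<in> C" using inC s that by auto
    have "((\<lambda>t. x + s *\<^sub>R a + t *\<^sub>R b) has_derivative (\<lambda>u. u *\<^sub>R b)) (at t)"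
      by (auto intro!: derivative_eq_intros)
    from has_derivative_compose[OF this d2[OF i]]
    have "((\<lambda>t. ?Df (x + s *\<^sub>R a + t *\<^sub>R b) a) has_derivative
      (\<lambda>u. frechet_derivative (\<lambda>z. ?Df z a) (at (x + s *\<^sub>R a + t *\<^sub>R b)) (u *\<^sub>R b))) (at t)" .
    moreover have "frechet_derivative (\<lambda>z. ?Df z a) (at (x + s *\<^sub>R a + t *\<^sub>R b)) (u *\<^sub>R b) =
      frechet_derivative (\<lambda>z. ?Df z a) (at (x + s *\<^sub>R a + t *\<^sub>R b)) b * u" for u
      using linear_scale[OF has_derivative_linear[OF d2[OF i]]] by simp
    ultimately show ?thesis by (simp add: has_field_derivative_def)
  qed
  have "\<exists>t. 0 < t \<and> t < h \<and> ?Df (x + s *\<^sub>R a + h *\<^sub>R b) a - ?Df (x + s *\<^sub>R a + 0 *\<^sub>R b) a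
    = (h - 0) * frechet_derivative (\<lambda>z. ?Df z a) (at (x + s *\<^sub>R a + t *\<^sub>R b)) b"
    by (rule MVT2[OF h]) (use D2 in auto)
  then obtain t where t: "0 < t" "t < h" "?Df (x + s *\<^sub>R a + h *\<^sub>R b) a - ?Df (x + s *\<^sub>R a) a
    = h * frechet_derivative (\<lambda>z. ?Df z a) (at (x + s *\<^sub>R a + t *\<^sub>R b)) b" by auto
  show thesis
  proof (rule that)
    show "x + s *\<^sub>R a + t *\<^sub>R b \<in> convex hull {x, x + h *\<^sub>R a, x + h *\<^sub>R b, x + h *\<^sub>R a + h *\<^sub>R b}"
      using inC[of s t] s t unfolding C_def by auto
    show "f (x + h *\<^sub>R a + h *\<^sub>R b) - f (x + h *\<^sub>R a) - f (x + h *\<^sub>R b) + f x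
      = h\<^sup>2 * frechet_derivative (\<lambda>z. ?Df z a) (at (x + s *\<^sub>R a + t *\<^sub>R b)) b"
      using s(3) unfolding t(3) \<phi>_def by (simp add: power2_eq_square)
  qed
qed

text \<open>Swapping \<open>a\<close> and \<open>b\<close> leaves the second difference unchanged,
  so there are points \<open>y\<close> and \<open>z\<close> arbitrarily close to \<open>x\<close>
  with \<open>g a b y = g b a z\<close>. Continuity carries the equality to
  \<open>x\<close>.\<close>

lemma k_smooth_on_mixed_derivatives:
  fixes f :: "'a::real_normed_vector \<Rightarrow> real"
  assumes "open S" "k_smooth_on 2 S f" "x \<in> S"
  shows "frechet_derivative (\<lambda>z. frechet_derivative f (at z) a) (at x) b
    = frechet_derivative (\<lambda>z. frechet_derivative f (at z) b) (at x) a"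
proof -
  define g where "g a b z = frechet_derivative (\<lambda>z. frechet_derivative f (at z) a) (at z) b" for a b z
  have cont: "isCont (g a b) x" for a b
    using assms unfolding g_def by (auto simp: numeral_2_eq_2 continuous_on_eq_continuous_at)
  have le: "dist (g a b x) (g b a x) \<le> e" if e: "e > 0" for e
  proof -
    obtain d1 where d1: "d1 > 0" "\<And>y. dist y x < d1 \<Longrightarrow> dist (g a b y) (g a b x) < e / 2"
      using cont[of a b] e unfolding continuous_at_eps_delta by (meson half_gt_zero)
    obtain d2 where d2: "d2 > 0" "\<And>y. dist y x < d2 \<Longrightarrow> dist (g b a y) (g b a x) < e / 2"
      using cont[of b a] e unfolding continuous_at_eps_delta by (meson half_gt_zero)
    obtain d3 where d3: "d3 > 0" "ball x d3 \<subseteq> S" using assms open_contains_ball by metis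
    define d where "d = min d1 (min d2 d3)"
    have d: "d > 0" using d1 d2 d3 by (simp add: d_def)
    \<comment> \<open>The two sides of the parallelogram together have length at most d / 2; the
      summand 1 covers \<open>a = b = 0\<close>.\<close>
    define h where "h = d / (2 * (norm a + norm b + 1))"
    have n: "norm a + norm b + 1 > 0" using norm_ge_zero[of a] norm_ge_zero[of b] by linarith
    have h: "h > 0" using d n by (simp add: h_def)
    have hn: "h * norm a + h * norm b < d"
    proof -
      have "h * norm a + h * norm b \<le> h * (norm a + norm b + 1)" using h by (simp add: algebra_simps)
      also have "\<dots> = d / 2" using n by (simp add: h_def field_simps)
      finally show ?thesis using d by simp
    qed
    have ha: "h * norm a \<ge> 0" "h * norm b \<ge> 0" using h by auto
    have "norm (h *\<^sub>R a + h *\<^sub>R b) \<le> h * norm a + h * norm b"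
      using norm_triangle_ineq[of "h *\<^sub>R a" "h *\<^sub>R b"] h by simp
    moreover have "norm (h *\<^sub>R a) = h * norm a" "norm (h *\<^sub>R b) = h * norm b" using h by auto
    ultimately have "norm (h *\<^sub>R a + h *\<^sub>R b) < d" "norm (h *\<^sub>R a) < d" "norm (h *\<^sub>R b) < d"
      using hn ha by linarith+
    then have cor: "x \<in> ball x d" "x + h *\<^sub>R a \<in> ball x d" "x + h *\<^sub>R b \<in> ball x d"
      "x + h *\<^sub>R a + h *\<^sub>R b \<in> ball x d"
      using d norm_minus_cancel[of "h *\<^sub>R a + h *\<^sub>R b"] by (auto simp: dist_norm add.assoc simp del: norm_scaleR)
    have sm: "k_smooth_on 2 (ball x d) f"
      by (rule k_smooth_on_subset[OF assms(2)]) (use d3 d_def in auto)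
    obtain y where y: "y \<in> convex hull {x, x + h *\<^sub>R a, x + h *\<^sub>R b, x + h *\<^sub>R a + h *\<^sub>R b}"
      "f (x + h *\<^sub>R a + h *\<^sub>R b) - f (x + h *\<^sub>R a) - f (x + h *\<^sub>R b) + f x = h\<^sup>2 * g a b y"
      using mixed_difference_mean_value[OF open_ball convex_ball sm h cor] unfolding g_def by metis
    have cor': "x + h *\<^sub>R b + h *\<^sub>R a \<in> ball x d" using cor(4) by (simp add: algebra_simps)
    obtain z where z: "z \<in> convex hull {x, x + h *\<^sub>R b, x + h *\<^sub>R a, x + h *\<^sub>R b + h *\<^sub>R a}"
      "f (x + h *\<^sub>R b + h *\<^sub>R a) - f (x + h *\<^sub>R b) - f (x + h *\<^sub>R a) + f x = h\<^sup>2 * g b a z"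
      using mixed_difference_mean_value[OF open_ball convex_ball sm h cor(1,3,2) cor'] unfolding g_def by metis
    have "h\<^sup>2 * g a b y = h\<^sup>2 * g b a z" using y(2) z(2) by (simp add: algebra_simps)
    then have eq: "g a b y = g b a z" using h by simp
    have "convex hull {x, x + h *\<^sub>R a, x + h *\<^sub>R b, x + h *\<^sub>R a + h *\<^sub>R b} \<subseteq> ball x d"
      using cor by (intro hull_minimal) auto
    then have yd: "dist y x < d" using y(1) by (auto simp: dist_commute)
    have "convex hull {x, x + h *\<^sub>R b, x + h *\<^sub>R a, x + h *\<^sub>R b + h *\<^sub>R a} \<subseteq> ball x d"
      using cor cor' by (intro hull_minimal) auto
    then have zd: "dist z x < d" using z(1) by (auto simp: dist_commute)
    have "dist (g a b y) (g a b x) < e / 2" "dist (g b a z) (g b a x) < e / 2"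
      using d1(2)[of y] d2(2)[of z] yd zd by (auto simp: d_def)
    then show ?thesis unfolding eq dist_real_def by linarith
  qed
  have "dist (g a b x) (g b a x) \<le> 0" by (rule field_le_epsilon) (use le in simp)
  then show ?thesis by (simp add: g_def)
qed


section \<open>Smooth maps of manifolds\<close>

lemma is_chartD:
  assumes "is_chart (U, \<phi>)"
  shows "open U" "open (\<phi> ` U)" "continuous_on U \<phi>" "continuous_on (\<phi> ` U) (inv_into U \<phi>)"
    "inj_on \<phi> U"
    "\<And>p. p \<in> U \<Longrightarrow> inv_into U \<phi> (\<phi> p) = p"
    "\<And>x. x \<in> \<phi> ` U \<Longrightarrow> \<phi> (inv_into U \<phi> x) = x"
    "\<And>x. x \<in> \<phi> ` U \<Longrightarrow> inv_into U \<phi> x \<in> U"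
proof -
  have h: "homeomorphism U (\<phi> ` U) \<phi> (inv_into U \<phi>)" and o: "open U" "open (\<phi> ` U)"
    using assms by (auto simp: is_chart_def)
  show "open U" "open (\<phi> ` U)" by fact+
  show "continuous_on U \<phi>" "continuous_on (\<phi> ` U) (inv_into U \<phi>)"
    using h by (auto simp: homeomorphism_def)
  show i: "inv_into U \<phi> (\<phi> p) = p" if "p \<in> U" for p using h that by (auto simp: homeomorphism_def)
  show "inj_on \<phi> U" using i by (metis inj_onI)
  show "\<phi> (inv_into U \<phi> x) = x" "inv_into U \<phi> x \<in> U" if "x \<in> \<phi> ` U" for x
    using that by (auto simp: f_inv_into_f inv_into_into)
qed

lemma is_chart_open_image:
  assumes "is_chart (U, \<phi>)" "open W"
  shows "open (\<phi> ` (U \<inter> W))"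
proof -
  note c = is_chartD[OF assms(1)]
  have "\<phi> ` (U \<inter> W) = \<phi> ` U \<inter> inv_into U \<phi> -` W"
    using c(6-8) by (force simp: image_iff)
  then show ?thesis
    using continuous_open_preimage[OF c(4) c(2) assms(2)] by (simp add: vimage_def Int_def)
qed

lemma smooth_manifold_chart:
  assumes "smooth_manifold A"
  obtains U \<phi> where "(U, \<phi>) \<in> A" "p \<in> U"
  using assms unfolding smooth_manifold_def by (metis (mono_tags, lifting) UNIV_I UN_E case_prod_unfold prod.collapse)

lemma smooth_manifold_is_chart: "smooth_manifold A \<Longrightarrow> c \<in> A \<Longrightarrow> is_chart c"
  by (auto simp: smooth_manifold_def)

lemma smooth_map_on_charts:
  assumes "smooth_map A B F" "(U, \<phi>) \<in> A" "(V, \<psi>) \<in> B"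
  shows "smooth_on (\<phi> ` (U \<inter> F -` V)) (\<lambda>x. \<psi> (F (inv_into U \<phi> x)))"
  using assms by (fastforce simp: smooth_map_def)

lemma smooth_map_continuous: "smooth_map A B F \<Longrightarrow> continuous_on UNIV F"
  by (simp add: smooth_map_def)

lemma smooth_mapI:
  assumes "continuous_on UNIV F"
    and "\<And>U \<phi> V \<psi>. (U, \<phi>) \<in> A \<Longrightarrow> (V, \<psi>) \<in> B \<Longrightarrow>
       smooth_on (\<phi> ` (U \<inter> F -` V)) (\<lambda>x. \<psi> (F (inv_into U \<phi> x)))"
  shows "smooth_map A B F"
  using assms by (auto simp: smooth_map_def)

text \<open>A chart of \<open>B\<close> around \<open>F p\<close> is inserted between the two given
  charts. It depends on \<open>p\<close>, so the argument is local.\<close>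

lemma smooth_map_compose:
  fixes A :: "('a::{t2_space,second_countable_topology}, 'e::euclidean_space) atlas"
    and B :: "('b::{t2_space,second_countable_topology}, 'f::euclidean_space) atlas"
    and C :: "('c::{t2_space,second_countable_topology}, 'd::euclidean_space) atlas"
  assumes A: "smooth_manifold A" and B: "smooth_manifold B" and C: "smooth_manifold C"
    and F: "smooth_map A B F" and H: "smooth_map B C H"
  shows "smooth_map A C (\<lambda>x. H (F x))"
proof (rule smooth_mapI)
  show "continuous_on UNIV (\<lambda>x. H (F x))"
    using continuous_on_compose2[OF smooth_map_continuous[OF H] smooth_map_continuous[OF F]] by auto
  fix U \<phi> W \<theta> assume U: "(U, \<phi>) \<in> A" and W: "(W, \<theta>) \<in> C"
  note cU = is_chartD[OF smooth_manifold_is_chart[OF A U]]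
  show "smooth_on (\<phi> ` (U \<inter> (\<lambda>x. H (F x)) -` W)) (\<lambda>x. \<theta> (H (F (inv_into U \<phi> x))))"
  proof (rule smooth_on_locally)
    fix x assume "x \<in> \<phi> ` (U \<inter> (\<lambda>x. H (F x)) -` W)"
    then obtain p where p: "p \<in> U" "H (F p) \<in> W" "x = \<phi> p" by auto
    obtain V \<psi> where V: "(V, \<psi>) \<in> B" "F p \<in> V" using smooth_manifold_chart[OF B] by metis
    note cV = is_chartD[OF smooth_manifold_is_chart[OF B V(1)]]
    have "open W" using is_chartD(1)[OF smooth_manifold_is_chart[OF C W]] .
    then have "open (F -` (V \<inter> H -` W))"
      using cV(1) smooth_map_continuous[OF F] smooth_map_continuous[OF H]
      by (intro open_vimage open_Int) (auto)
    then have o: "open (\<phi> ` (U \<inter> F -` (V \<inter> H -` W)))" (is "open ?N")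
      by (rule is_chart_open_image[OF smooth_manifold_is_chart[OF A U]])
    have 1: "smooth_on ?N (\<lambda>x. \<psi> (F (inv_into U \<phi> x)))"
      by (rule smooth_on_subset[OF smooth_map_on_charts[OF F U V(1)]]) auto
    have "smooth_on ?N (\<lambda>x. \<theta> (H (inv_into V \<psi> (\<psi> (F (inv_into U \<phi> x))))))"
      by (rule smooth_on_compose[OF o smooth_map_on_charts[OF H V(1) W] 1]) (use cU(6) in auto)
    then have "smooth_on ?N (\<lambda>x. \<theta> (H (F (inv_into U \<phi> x))))"
      by (rule smooth_on_cong[OF o, rotated]) (use cU(6) cV(6) in auto)
    then show "\<exists>N. open N \<and> x \<in> N \<and> smooth_on N (\<lambda>x. \<theta> (H (F (inv_into U \<phi> x))))"
      using o p V(2) by blast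
  qed
qed

lemma smooth_map_ident: "smooth_manifold A \<Longrightarrow> smooth_map A A (\<lambda>x. x)"
  by (rule smooth_mapI) (auto simp: smooth_manifold_def vimage_def continuous_on_id)

lemma smooth_map_const:
  assumes "smooth_manifold A" shows "smooth_map A B (\<lambda>x. c)"
proof (rule smooth_mapI)
  fix U \<phi> V \<psi> assume "(U, \<phi>) \<in> A" "(V, \<psi>) \<in> B"
  then have "open (\<phi> ` (U \<inter> (\<lambda>x. c) -` V))"
    by (intro is_chart_open_image smooth_manifold_is_chart[OF assms]) (auto simp: vimage_const)
  then show "smooth_on (\<phi> ` (U \<inter> (\<lambda>x. c) -` V)) (\<lambda>x. \<psi> c)" by (rule smooth_on_const)
qed auto

lemma smooth_map_Pair:
  assumes A: "smooth_manifold A" and B: "smooth_manifold B" and C: "smooth_manifold C"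
    and F: "smooth_map A B F" and H: "smooth_map A C H"
  shows "smooth_map A (product_atlas B C) (\<lambda>x. (F x, H x))"
proof (rule smooth_mapI)
  show "continuous_on UNIV (\<lambda>x. (F x, H x))"
    using F H by (intro continuous_on_Pair smooth_map_continuous)
  fix U \<phi> V \<psi> assume U: "(U, \<phi>) \<in> A" and "(V, \<psi>) \<in> product_atlas B C"
  then obtain V1 \<psi>1 V2 \<psi>2 where V: "V = V1 \<times> V2" "\<psi> = map_prod \<psi>1 \<psi>2" "(V1, \<psi>1) \<in> B" "(V2, \<psi>2) \<in> C"
    by (auto simp: product_atlas_def)
  have "open (F -` V1)" "open (H -` V2)"
    using is_chartD(1)[OF smooth_manifold_is_chart[OF B V(3)]] is_chartD(1)[OF smooth_manifold_is_chart[OF C V(4)]]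
      smooth_map_continuous[OF F] smooth_map_continuous[OF H] by (auto intro!: open_vimage)
  then have o: "open (\<phi> ` (U \<inter> (F -` V1 \<inter> H -` V2)))"
    by (intro is_chart_open_image smooth_manifold_is_chart[OF A U]) auto
  have "smooth_on (\<phi> ` (U \<inter> (F -` V1 \<inter> H -` V2)))
      (\<lambda>x. (\<psi>1 (F (inv_into U \<phi> x)), \<psi>2 (H (inv_into U \<phi> x))))"
    by (intro smooth_on_Pair[OF o] smooth_on_subset[OF smooth_map_on_charts[OF F U V(3)]]
        smooth_on_subset[OF smooth_map_on_charts[OF H U V(4)]]) auto
  moreover have "(\<lambda>x. (F x, H x)) -` V = F -` V1 \<inter> H -` V2" by (auto simp: V)
  ultimately show "smooth_on (\<phi> ` (U \<inter> (\<lambda>x. (F x, H x)) -` V)) (\<lambda>x. \<psi> (F (inv_into U \<phi> x), H (inv_into U \<phi> x)))"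
    by (simp add: V)
qed

lemma inv_into_map_prod:
  assumes "is_chart (U, \<phi>)" "is_chart (V, \<psi>)" "x \<in> \<phi> ` U" "y \<in> \<psi> ` V"
  shows "inv_into (U \<times> V) (map_prod \<phi> \<psi>) (x, y) = (inv_into U \<phi> x, inv_into V \<psi> y)"
proof -
  have "inj_on (map_prod \<phi> \<psi>) (U \<times> V)"
    by (intro map_prod_inj_on is_chartD assms)
  moreover have "(x, y) = map_prod \<phi> \<psi> (inv_into U \<phi> x, inv_into V \<psi> y)"
    using is_chartD(7)[OF assms(1) assms(3)] is_chartD(7)[OF assms(2) assms(4)] by simp
  moreover have "(inv_into U \<phi> x, inv_into V \<psi> y) \<in> U \<times> V"
    using is_chartD(8)[OF assms(1) assms(3)] is_chartD(8)[OF assms(2) assms(4)] by simp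
  ultimately show ?thesis by (metis inv_into_f_f)
qed

lemma is_chart_map_prod:
  assumes U: "is_chart (U, \<phi>)" and V: "is_chart (V, \<psi>)"
  shows "is_chart (U \<times> V, map_prod \<phi> \<psi>)"
proof -
  note cU = is_chartD[OF U] and cV = is_chartD[OF V]
  have im: "map_prod \<phi> \<psi> ` (U \<times> V) = \<phi> ` U \<times> \<psi> ` V" by (auto simp: map_prod_def)
  have "continuous_on (U \<times> V) (\<lambda>z. (\<phi> (fst z), \<psi> (snd z)))"
    by (intro continuous_on_Pair continuous_on_compose2[OF cU(3)] continuous_on_compose2[OF cV(3)]
        continuous_on_fst continuous_on_snd continuous_on_id) auto
  moreover have "map_prod \<phi> \<psi> = (\<lambda>z. (\<phi> (fst z), \<psi> (snd z)))" by (auto simp: fun_eq_iff)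
  ultimately have c1: "continuous_on (U \<times> V) (map_prod \<phi> \<psi>)" by simp
  have "continuous_on (\<phi> ` U \<times> \<psi> ` V) (\<lambda>z. (inv_into U \<phi> (fst z), inv_into V \<psi> (snd z)))"
    by (intro continuous_on_Pair continuous_on_compose2[OF cU(4)] continuous_on_compose2[OF cV(4)]
        continuous_on_fst continuous_on_snd continuous_on_id) auto
  then have c2: "continuous_on (\<phi> ` U \<times> \<psi> ` V) (inv_into (U \<times> V) (map_prod \<phi> \<psi>))"
    by (rule continuous_on_eq) (auto simp: inv_into_map_prod[OF U V])
  have inj: "inj_on (map_prod \<phi> \<psi>) (U \<times> V)" by (intro map_prod_inj_on cU cV)
  have "homeomorphism (U \<times> V) (\<phi> ` U \<times> \<psi> ` V) (map_prod \<phi> \<psi>) (inv_into (U \<times> V) (map_prod \<phi> \<psi>))"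
  proof (intro homeomorphismI c1 c2)
    show "map_prod \<phi> \<psi> ` (U \<times> V) \<subseteq> \<phi> ` U \<times> \<psi> ` V" using im by simp
    show "inv_into (U \<times> V) (map_prod \<phi> \<psi>) ` (\<phi> ` U \<times> \<psi> ` V) \<subseteq> U \<times> V"
      unfolding im[symmetric] by (rule image_subsetI) (rule inv_into_into)
    show "inv_into (U \<times> V) (map_prod \<phi> \<psi>) (map_prod \<phi> \<psi> x) = x" if "x \<in> U \<times> V" for x
      using inv_into_f_f[OF inj that] .
    show "map_prod \<phi> \<psi> (inv_into (U \<times> V) (map_prod \<phi> \<psi>) y) = y" if "y \<in> \<phi> ` U \<times> \<psi> ` V" for y
      using that unfolding im[symmetric] by (rule f_inv_into_f)
  qed
  then show ?thesis using cU cV im by (auto simp: is_chart_def intro: open_Times)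
qed

lemma smooth_manifold_product:
  assumes A: "smooth_manifold A" and B: "smooth_manifold B"
  shows "smooth_manifold (product_atlas A B)"
  unfolding smooth_manifold_def
proof (intro conjI)
  show "\<forall>c\<in>product_atlas A B. is_chart c"
    using smooth_manifold_is_chart[OF A] smooth_manifold_is_chart[OF B]
    by (auto simp: product_atlas_def intro: is_chart_map_prod)
  have "\<exists>c\<in>product_atlas A B. z \<in> fst c" for z
  proof -
    obtain U \<phi> where "(U, \<phi>) \<in> A" "fst z \<in> U" using smooth_manifold_chart[OF A] by metis
    moreover obtain V \<psi> where "(V, \<psi>) \<in> B" "snd z \<in> V" using smooth_manifold_chart[OF B] by metis
    ultimately have "(U \<times> V, map_prod \<phi> \<psi>) \<in> product_atlas A B" "z \<in> U \<times> V"
      by (auto simp: product_atlas_def mem_Times_iff)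
    then show ?thesis by force
  qed
  then show "(\<Union>(U, \<phi>)\<in>product_atlas A B. U) = UNIV" by (auto simp: case_prod_unfold)
  show "\<forall>(U, \<phi>)\<in>product_atlas A B. \<forall>(V, \<psi>)\<in>product_atlas A B.
      smooth_on (\<phi> ` (U \<inter> V)) (\<lambda>x. \<psi> (inv_into U \<phi> x))"
  proof (clarsimp simp: product_atlas_def)
    fix U \<phi> V \<psi> U' \<phi>' V' \<psi>'
    assume U: "(U, \<phi>) \<in> A" and V: "(V, \<psi>) \<in> B" and U': "(U', \<phi>') \<in> A" and V': "(V', \<psi>') \<in> B"
    note cU = smooth_manifold_is_chart[OF A U] and cV = smooth_manifold_is_chart[OF B V]
    have o: "open (\<phi> ` (U \<inter> U'))" "open (\<psi> ` (V \<inter> V'))"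
      using is_chartD(1) smooth_manifold_is_chart[OF A U'] smooth_manifold_is_chart[OF B V']
      by (auto intro: is_chart_open_image cU cV)
    then have o2: "open (\<phi> ` (U \<inter> U') \<times> \<psi> ` (V \<inter> V'))" by (rule open_Times)
    have eq: "map_prod \<phi> \<psi> ` (U \<times> V \<inter> U' \<times> V') = \<phi> ` (U \<inter> U') \<times> \<psi> ` (V \<inter> V')"
      by (auto simp: map_prod_def)
    have "smooth_on (\<phi> ` (U \<inter> U') \<times> \<psi> ` (V \<inter> V')) (\<lambda>z. \<phi>' (inv_into U \<phi> (fst z)))"
      using smooth_map_on_charts[OF smooth_map_ident[OF A] U U']
      by (intro smooth_on_compose[OF o2, where f = fst and g = "\<lambda>z. \<phi>' (inv_into U \<phi> z)" and T = "\<phi> ` (U \<inter> U')"]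
          smooth_on_linear[OF o2 bounded_linear_fst]) (auto simp: vimage_def)
    moreover have "smooth_on (\<phi> ` (U \<inter> U') \<times> \<psi> ` (V \<inter> V')) (\<lambda>z. \<psi>' (inv_into V \<psi> (snd z)))"
      using smooth_map_on_charts[OF smooth_map_ident[OF B] V V']
      by (intro smooth_on_compose[OF o2, where f = snd and g = "\<lambda>z. \<psi>' (inv_into V \<psi> z)" and T = "\<psi> ` (V \<inter> V')"]
          smooth_on_linear[OF o2 bounded_linear_snd]) (auto simp: vimage_def)
    ultimately have "smooth_on (\<phi> ` (U \<inter> U') \<times> \<psi> ` (V \<inter> V'))
        (\<lambda>z. (\<phi>' (inv_into U \<phi> (fst z)), \<psi>' (inv_into V \<psi> (snd z))))"
      by (rule smooth_on_Pair[OF o2])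
    then have "smooth_on (\<phi> ` (U \<inter> U') \<times> \<psi> ` (V \<inter> V'))
        (\<lambda>z. map_prod \<phi>' \<psi>' (inv_into (U \<times> V) (map_prod \<phi> \<psi>) z))"
      by (rule smooth_on_cong[OF o2, rotated]) (auto simp: inv_into_map_prod[OF cU cV])
    then show "smooth_on (map_prod \<phi> \<psi> ` (U \<times> V \<inter> U' \<times> V'))
        (\<lambda>z. map_prod \<phi>' \<psi>' (inv_into (U \<times> V) (map_prod \<phi> \<psi>) z))"
      unfolding eq .
  qed
qed

lemma smooth_map_fst:
  assumes A: "smooth_manifold A" and B: "smooth_manifold B"
  shows "smooth_map (product_atlas A B) A fst"
proof (rule smooth_mapI)
  show "continuous_on UNIV fst" by (intro continuous_intros)
  fix W \<theta> U' \<phi>' assume "(W, \<theta>) \<in> product_atlas A B" and U': "(U', \<phi>') \<in> A"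
  then obtain U \<phi> V \<psi> where W: "W = U \<times> V" "\<theta> = map_prod \<phi> \<psi>" and U: "(U, \<phi>) \<in> A" and V: "(V, \<psi>) \<in> B"
    by (auto simp: product_atlas_def)
  note cU = smooth_manifold_is_chart[OF A U] and cV = smooth_manifold_is_chart[OF B V]
  have o: "open (\<phi> ` (U \<inter> U') \<times> \<psi> ` V)"
    using is_chartD(1)[OF smooth_manifold_is_chart[OF A U']] is_chartD(2)[OF cV]
    by (intro open_Times is_chart_open_image cU)
  have eq: "\<theta> ` (W \<inter> fst -` U') = \<phi> ` (U \<inter> U') \<times> \<psi> ` V" by (auto simp: W map_prod_def)
  have "smooth_on (\<phi> ` (U \<inter> U') \<times> \<psi> ` V) (\<lambda>z. \<phi>' (inv_into U \<phi> (fst z)))"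
    using smooth_map_on_charts[OF smooth_map_ident[OF A] U U']
    by (intro smooth_on_compose[OF o, where f = fst and g = "\<lambda>z. \<phi>' (inv_into U \<phi> z)" and T = "\<phi> ` (U \<inter> U')"]
        smooth_on_linear[OF o bounded_linear_fst]) (auto simp: vimage_def)
  then have "smooth_on (\<phi> ` (U \<inter> U') \<times> \<psi> ` V) (\<lambda>z. \<phi>' (fst (inv_into W \<theta> z)))"
    by (rule smooth_on_cong[OF o, rotated]) (auto simp: W inv_into_map_prod[OF cU cV])
  then show "smooth_on (\<theta> ` (W \<inter> fst -` U')) (\<lambda>z. \<phi>' (fst (inv_into W \<theta> z)))" unfolding eq .
qed

lemma smooth_map_snd:
  assumes A: "smooth_manifold A" and B: "smooth_manifold B"
  shows "smooth_map (product_atlas A B) B snd"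
proof (rule smooth_mapI)
  show "continuous_on UNIV snd" by (intro continuous_intros)
  fix W \<theta> V' \<psi>' assume "(W, \<theta>) \<in> product_atlas A B" and V': "(V', \<psi>') \<in> B"
  then obtain U \<phi> V \<psi> where W: "W = U \<times> V" "\<theta> = map_prod \<phi> \<psi>" and U: "(U, \<phi>) \<in> A" and V: "(V, \<psi>) \<in> B"
    by (auto simp: product_atlas_def)
  note cU = smooth_manifold_is_chart[OF A U] and cV = smooth_manifold_is_chart[OF B V]
  have o: "open (\<phi> ` U \<times> \<psi> ` (V \<inter> V'))"
    using is_chartD(1)[OF smooth_manifold_is_chart[OF B V']] is_chartD(2)[OF cU]
    by (intro open_Times is_chart_open_image cV)
  have eq: "\<theta> ` (W \<inter> snd -` V') = \<phi> ` U \<times> \<psi> ` (V \<inter> V')" by (auto simp: W map_prod_def)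
  have "smooth_on (\<phi> ` U \<times> \<psi> ` (V \<inter> V')) (\<lambda>z. \<psi>' (inv_into V \<psi> (snd z)))"
    using smooth_map_on_charts[OF smooth_map_ident[OF B] V V']
    by (intro smooth_on_compose[OF o, where f = snd and g = "\<lambda>z. \<psi>' (inv_into V \<psi> z)" and T = "\<psi> ` (V \<inter> V')"]
        smooth_on_linear[OF o bounded_linear_snd]) (auto simp: vimage_def)
  then have "smooth_on (\<phi> ` U \<times> \<psi> ` (V \<inter> V')) (\<lambda>z. \<psi>' (snd (inv_into W \<theta> z)))"
    by (rule smooth_on_cong[OF o, rotated]) (auto simp: W inv_into_map_prod[OF cU cV])
  then show "smooth_on (\<theta> ` (W \<inter> snd -` V')) (\<lambda>z. \<psi>' (snd (inv_into W \<theta> z)))" unfolding eq .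
qed

text \<open>Smooth functions are smooth maps into \<open>\<real>\<close> with this atlas.\<close>

definition euclidean_atlas :: "('e::euclidean_space, 'e) atlas"
  where "euclidean_atlas = {(UNIV, \<lambda>x. x)}"

lemma inv_into_ident: "inv_into UNIV (\<lambda>x. x) = (\<lambda>x. x)"
  by (simp add: inv_into_def)

lemma smooth_manifold_euclidean: "smooth_manifold euclidean_atlas"
  by (auto simp: smooth_manifold_def euclidean_atlas_def is_chart_def inv_into_ident
      intro: smooth_on_linear bounded_linear_ident homeomorphism_ident[unfolded id_def])

text \<open>Only \<open>smooth_map\<close> mentions continuity. For a smooth function it is
  recovered by composing the coordinate expression with the chart.\<close>

lemma smooth_fun_iff_smooth_map:
  assumes A: "smooth_manifold A"
  shows "smooth_fun A f \<longleftrightarrow> smooth_map A euclidean_atlas f"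
proof
  assume f: "smooth_fun A f"
  have "continuous (at p) f" for p
  proof -
    obtain U \<phi> where U: "(U, \<phi>) \<in> A" "p \<in> U" using smooth_manifold_chart[OF A] by metis
    note c = is_chartD[OF smooth_manifold_is_chart[OF A U(1)]]
    have "smooth_on (\<phi> ` U) (\<lambda>x. f (inv_into U \<phi> x))" using f U(1) by (auto simp: smooth_fun_def)
    then have "continuous_on U (\<lambda>x. f (inv_into U \<phi> (\<phi> x)))"
      using smooth_on_continuous_on continuous_on_compose2[OF _ c(3)] by blast
    then have "continuous_on U f" by (rule continuous_on_eq) (use c(6) in auto)
    then show ?thesis using c(1) U(2) continuous_on_eq_continuous_at by blast
  qed
  then show "smooth_map A euclidean_atlas f"
    using f by (auto simp: smooth_map_def smooth_fun_def euclidean_atlas_def intro: continuous_at_imp_continuous_on)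
next
  assume "smooth_map A euclidean_atlas f"
  then show "smooth_fun A f" by (auto simp: smooth_map_def smooth_fun_def euclidean_atlas_def)
qed

lemma smooth_fun_compose:
  assumes "smooth_manifold A" "smooth_manifold B" "smooth_fun B f" "smooth_map A B F"
  shows "smooth_fun A (\<lambda>x. f (F x))"
  using assms smooth_map_compose[OF assms(1,2) smooth_manifold_euclidean assms(4)]
  by (simp add: smooth_fun_iff_smooth_map)

lemma smooth_fun_on_chart:
  "smooth_fun A f \<Longrightarrow> (U, \<phi>) \<in> A \<Longrightarrow> smooth_on (\<phi> ` U) (\<lambda>x. f (inv_into U \<phi> x))"
  by (auto simp: smooth_fun_def)

lemma smooth_fun_const: "smooth_manifold A \<Longrightarrow> smooth_fun A (\<lambda>x. c)"
  by (simp add: smooth_fun_iff_smooth_map smooth_map_const)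

lemma smooth_fun_add:
  assumes "smooth_manifold A" "smooth_fun A f" "smooth_fun A h" shows "smooth_fun A (\<lambda>x. f x + h x)"
  using assms is_chartD(2)[OF smooth_manifold_is_chart[OF assms(1)]]
  by (fastforce simp: smooth_fun_def intro!: smooth_on_add)

lemma smooth_fun_mult:
  assumes "smooth_manifold A" "smooth_fun A f" "smooth_fun A h" shows "smooth_fun A (\<lambda>x. f x * h x)"
  using assms is_chartD(2)[OF smooth_manifold_is_chart[OF assms(1)]]
  by (fastforce simp: smooth_fun_def intro!: smooth_on_mult)

lemma smooth_fun_diff:
  assumes "smooth_manifold A" "smooth_fun A f" "smooth_fun A h" shows "smooth_fun A (\<lambda>x. f x - h x)"
  using smooth_fun_add[OF assms(1,2) smooth_fun_mult[OF assms(1) smooth_fun_const[OF assms(1), of "-1"] assms(3)]]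
  by simp

lemma smooth_fun_sum:
  assumes "smooth_manifold A" "finite I" "\<And>i. i \<in> I \<Longrightarrow> smooth_fun A (f i)"
  shows "smooth_fun A (\<lambda>x. \<Sum>i\<in>I. f i x)"
  using assms(2,3)
  by (induction I rule: finite_induct) (auto intro: smooth_fun_const smooth_fun_add assms(1))

text \<open>A bump in coordinates is extended by 0. It vanishes off a compact set \<open>L\<close>
  inside \<open>U\<close>, and \<open>L\<close> is closed because the space is Hausdorff, so
  \<open>U\<close> and the complement of \<open>L\<close> form an open cover on which smoothness is
  checked. The support clause serves to separate points, the derivative clause to separate
  coordinate vectors.\<close>

lemma chart_bump_function_exists:
  fixes A :: "('m::{t2_space,second_countable_topology}, 'e::euclidean_space) atlas"
  assumes A: "smooth_manifold A" and U: "(U, \<phi>) \<in> A" "p \<in> U" "p \<in> W" "open W"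
  obtains f where "smooth_fun A f" "f p \<noteq> 0" "\<And>q. q \<notin> W \<Longrightarrow> f q = 0"
    "v \<noteq> 0 \<Longrightarrow> frechet_derivative (\<lambda>x. f (inv_into U \<phi> x)) (at (\<phi> p)) v \<noteq> 0"
proof -
  note ch = smooth_manifold_is_chart[OF A U(1)]
  note c = is_chartD[OF ch]
  have o: "open (\<phi> ` (U \<inter> W))" by (rule is_chart_open_image[OF ch U(4)])
  obtain \<rho> K where \<rho>: "smooth_on UNIV \<rho>" "compact K" "K \<subseteq> \<phi> ` (U \<inter> W)" "\<And>y. y \<notin> K \<Longrightarrow> \<rho> y = (0::real)"
    "\<rho> (\<phi> p) \<noteq> 0" "v \<noteq> 0 \<Longrightarrow> frechet_derivative \<rho> (at (\<phi> p)) v \<noteq> 0"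
    using bump_function_exists[OF o, of "\<phi> p" v] U by blast
  define L where "L = inv_into U \<phi> ` K"
  have "compact L" unfolding L_def
    by (rule compact_continuous_image[OF continuous_on_subset[OF c(4)] \<rho>(2)]) (use \<rho>(3) in auto)
  then have Lc: "closed L" by (rule compact_imp_closed)
  have LU: "L \<subseteq> U \<inter> W" unfolding L_def using \<rho>(3) c(6) by auto
  define f where "f q = (if q \<in> U then \<rho> (\<phi> q) else 0)" for q
  have f0: "f q = 0" if "q \<notin> L" for q
  proof (cases "q \<in> U")
    case True
    then have "\<phi> q \<notin> K" using that c(6) by (force simp: L_def)
    then show ?thesis by (simp add: f_def \<rho>(4))
  qed (simp add: f_def)
  have fU: "smooth_on (\<psi> ` (V \<inter> U)) (\<lambda>x. f (inv_into V \<psi> x))" if V: "(V, \<psi>) \<in> A" for V \<psi>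
  proof -
    note chV = smooth_manifold_is_chart[OF A V]
    have oV: "open (\<psi> ` (V \<inter> U))" by (rule is_chart_open_image[OF chV c(1)])
    have "smooth_on (\<psi> ` (V \<inter> U)) (\<lambda>x. \<rho> (\<phi> (inv_into V \<psi> x)))"
      using smooth_map_on_charts[OF smooth_map_ident[OF A] V U(1)]
      by (intro smooth_on_compose[OF oV \<rho>(1)]) (auto simp: vimage_def)
    then show ?thesis
      by (rule smooth_on_cong[OF oV, rotated]) (use is_chartD(6)[OF chV] in \<open>auto simp: f_def\<close>)
  qed
  show thesis
  proof
    show "smooth_fun A f" unfolding smooth_fun_def
    proof clarify
      fix V \<psi> assume V: "(V, \<psi>) \<in> A"
      note chV = smooth_manifold_is_chart[OF A V]
      have oV: "open (\<psi> ` (V \<inter> - L))" using is_chart_open_image[OF chV] Lc by auto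
      have "smooth_on (\<psi> ` (V \<inter> - L)) (\<lambda>x. f (inv_into V \<psi> x))"
        by (rule smooth_on_cong[OF oV _ smooth_on_const[OF oV, of 0]])
           (use is_chartD(6)[OF chV] f0 in auto)
      moreover have "\<psi> ` V \<subseteq> \<psi> ` (V \<inter> - L) \<union> \<psi> ` (V \<inter> U)" using LU by auto
      ultimately show "smooth_on (\<psi> ` V) (\<lambda>x. f (inv_into V \<psi> x))"
        using fU[OF V] oV is_chart_open_image[OF chV c(1)] by (intro smooth_on_locally) blast
    qed
    show "f p \<noteq> 0" using \<rho>(5) U by (simp add: f_def)
    show "f q = 0" if "q \<notin> W" for q using f0 LU that by auto
    assume "v \<noteq> 0"
    have "(\<rho> has_derivative frechet_derivative \<rho> (at (\<phi> p))) (at (\<phi> p))"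
      using smooth_on_differentiable[OF \<rho>(1)] frechet_derivative_works by blast
    then have "((\<lambda>x. f (inv_into U \<phi> x)) has_derivative frechet_derivative \<rho> (at (\<phi> p))) (at (\<phi> p))"
      by (rule has_derivative_transform_within_open[OF _ c(2)]) (use U c(6) in \<open>auto simp: f_def\<close>)
    then show "frechet_derivative (\<lambda>x. f (inv_into U \<phi> x)) (at (\<phi> p)) v \<noteq> 0"
      using \<rho>(6)[OF \<open>v \<noteq> 0\<close>] frechet_derivative_at by metis
  qed
qed


section \<open>Tangent vectors and vector fields\<close>

lemma tangent_spaceD:
  assumes "v \<in> tangent_space A p"
  shows "smooth_fun A f \<Longrightarrow> smooth_fun A h \<Longrightarrow> v (\<lambda>x. f x + h x) = v f + v h"
    "smooth_fun A f \<Longrightarrow> smooth_fun A h \<Longrightarrow> v (\<lambda>x. f x * h x) = f p * v h + h p * v f"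
    "smooth_fun A f \<Longrightarrow> v (\<lambda>x. c * f x) = c * v f"
    "\<not> smooth_fun A f \<Longrightarrow> v f = 0"
  using assms by (auto simp: tangent_space_def plus_fun_def times_fun_def scaleR_fun_def)

lemma tangent_spaceI:
  assumes "\<And>f h. smooth_fun A f \<Longrightarrow> smooth_fun A h \<Longrightarrow> v (\<lambda>x. f x + h x) = v f + v h"
    "\<And>f h. smooth_fun A f \<Longrightarrow> smooth_fun A h \<Longrightarrow> v (\<lambda>x. f x * h x) = f p * v h + h p * v f"
    "\<And>c f. smooth_fun A f \<Longrightarrow> v (\<lambda>x. c * f x) = c * v f"
    "\<And>f. \<not> smooth_fun A f \<Longrightarrow> v f = 0"
  shows "v \<in> tangent_space A p"
  using assms by (auto simp: tangent_space_def plus_fun_def times_fun_def scaleR_fun_def)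

lemma subspace_tangent_space: "subspace (tangent_space A p)"
  by (rule subspaceI)
     (auto simp: tangent_space_def zero_fun_def plus_fun_def scaleR_fun_def algebra_simps)

text \<open>The Leibniz rule for 1 = 1 * 1 gives v(1) = v(1) + v(1).\<close>

lemma tangent_vector_const:
  assumes "smooth_manifold A" "v \<in> tangent_space A p"
  shows "v (\<lambda>x. c) = 0"
proof -
  have "v (\<lambda>x. 1 * 1) = 1 * v (\<lambda>x. 1) + 1 * v (\<lambda>x. 1)"
    by (rule tangent_spaceD(2)[OF assms(2)]) (rule smooth_fun_const[OF assms(1)])+
  then have "v (\<lambda>x. 1) = 0" by simp
  moreover have "v (\<lambda>x. c * 1) = c * v (\<lambda>x. 1)"
    by (rule tangent_spaceD(3)[OF assms(2)]) (rule smooth_fun_const[OF assms(1)])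
  ultimately show ?thesis by simp
qed

lemma tangent_vector_diff:
  assumes "smooth_manifold A" "v \<in> tangent_space A p" "smooth_fun A f" "smooth_fun A h"
  shows "v (\<lambda>x. f x - h x) = v f - v h"
proof -
  have s: "smooth_fun A (\<lambda>x. -1 * h x)"
    by (rule smooth_fun_mult[OF assms(1) smooth_fun_const[OF assms(1)] assms(4)])
  have "v (\<lambda>x. f x + -1 * h x) = v f + -1 * v h"
    unfolding tangent_spaceD(1)[OF assms(2,3) s] tangent_spaceD(3)[OF assms(2,4)] ..
  then show ?thesis by simp
qed

lemma tangent_vector_sum:
  assumes "smooth_manifold A" "v \<in> tangent_space A p" "finite I" "\<And>i. i \<in> I \<Longrightarrow> smooth_fun A (f i)"
  shows "v (\<lambda>x. \<Sum>i\<in>I. f i x) = (\<Sum>i\<in>I. v (f i))"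
  using assms(3,4)
proof (induction I rule: finite_induct)
  case empty
  show ?case using tangent_vector_const[OF assms(1,2)] by simp
next
  case (insert i I)
  then show ?case
    using tangent_spaceD(1)[OF assms(2), of "f i" "\<lambda>x. \<Sum>i\<in>I. f i x"] smooth_fun_sum[OF assms(1), of I f]
    by simp
qed

text \<open>The directional derivative along \<open>w\<close> in the coordinates of
  \<open>c\<close>. The default 0 is the one that \<open>tangent_space\<close> prescribes on
  nonsmooth functions.\<close>

definition chart_vector ::
    "('m::topological_space, 'e::euclidean_space) atlas \<Rightarrow> ('m, 'e) chart \<Rightarrow> 'm \<Rightarrow> 'e \<Rightarrow> 'm tangent_vector"
  where "chart_vector A c p w = (\<lambda>f. if smooth_fun A f
    then frechet_derivative (\<lambda>x. f (inv_into (fst c) (snd c) x)) (at (snd c p)) w else 0)"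

context
  fixes A :: "('m::{t2_space,second_countable_topology}, 'e::euclidean_space) atlas" and U \<phi> p
  assumes A: "smooth_manifold A" and U: "(U, \<phi>) \<in> A" "p \<in> U"
begin

lemma smooth_fun_chart_derivative:
  assumes "smooth_fun A f"
  shows "((\<lambda>x. f (inv_into U \<phi> x)) has_derivative (\<lambda>w. chart_vector A (U, \<phi>) p w f)) (at (\<phi> p))"
  using smooth_on_differentiable[OF smooth_fun_on_chart[OF assms U(1)], of "\<phi> p"] U(2) assms
  by (auto simp: chart_vector_def frechet_derivative_works[symmetric])

lemma linear_chart_vector: "linear (chart_vector A (U, \<phi>) p)"
proof (rule linearI)
  note l = has_derivative_linear[OF smooth_fun_chart_derivative]
  show "chart_vector A (U, \<phi>) p (a + b) = chart_vector A (U, \<phi>) p a + chart_vector A (U, \<phi>) p b" for a b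
  proof (rule ext)
    fix f show "chart_vector A (U, \<phi>) p (a + b) f = (chart_vector A (U, \<phi>) p a + chart_vector A (U, \<phi>) p b) f"
      using linear_add[OF l] by (cases "smooth_fun A f") (auto simp: chart_vector_def)
  qed
  show "chart_vector A (U, \<phi>) p (r *\<^sub>R a) = r *\<^sub>R chart_vector A (U, \<phi>) p a" for a r
  proof (rule ext)
    fix f show "chart_vector A (U, \<phi>) p (r *\<^sub>R a) f = (r *\<^sub>R chart_vector A (U, \<phi>) p a) f"
      using linear_scale[OF l] by (cases "smooth_fun A f") (auto simp: chart_vector_def scaleR_fun_def)
  qed
qed

lemma chart_vector_in_tangent_space: "chart_vector A (U, \<phi>) p w \<in> tangent_space A p"
proof (rule tangent_spaceI)
  note c = is_chartD[OF smooth_manifold_is_chart[OF A U(1)]]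
  note d = smooth_fun_chart_derivative
  fix f h assume f: "smooth_fun A f" and h: "smooth_fun A h"
  show "chart_vector A (U, \<phi>) p w (\<lambda>x. f x + h x) = chart_vector A (U, \<phi>) p w f + chart_vector A (U, \<phi>) p w h"
    by (rule fun_cong[OF has_derivative_unique[OF d[OF smooth_fun_add[OF A f h]] has_derivative_add[OF d[OF f] d[OF h]]]])
  show "chart_vector A (U, \<phi>) p w (\<lambda>x. f x * h x) =
      f p * chart_vector A (U, \<phi>) p w h + h p * chart_vector A (U, \<phi>) p w f"
    using fun_cong[OF has_derivative_unique[OF d[OF smooth_fun_mult[OF A f h]] has_derivative_mult[OF d[OF f] d[OF h]]], of w]
    by (simp add: c(6) U(2) mult.commute)
next
  note d = smooth_fun_chart_derivative
  fix f k assume f: "smooth_fun A f"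
  show "chart_vector A (U, \<phi>) p w (\<lambda>x. k * f x) = k * chart_vector A (U, \<phi>) p w f"
    by (rule fun_cong[OF has_derivative_unique[OF
      d[OF smooth_fun_mult[OF A smooth_fun_const[OF A] f]] has_derivative_mult_right[OF d[OF f]]]])
qed (simp add: chart_vector_def)

text \<open>Detected by a bump function with nonzero derivative along \<open>w\<close>. With
  linearity this makes \<open>chart_vector\<close> injective, which bounds the dimension of the
  tangent space from below.\<close>

lemma chart_vector_nonzero: "w \<noteq> 0 \<Longrightarrow> chart_vector A (U, \<phi>) p w \<noteq> 0"
proof -
  assume w: "w \<noteq> 0"
  obtain f where "smooth_fun A f" "frechet_derivative (\<lambda>x. f (inv_into U \<phi> x)) (at (\<phi> p)) w \<noteq> 0"
    using chart_bump_function_exists[OF A U UNIV_I open_UNIV] w by metis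
  then have "chart_vector A (U, \<phi>) p w f \<noteq> 0" by (simp add: chart_vector_def)
  then show ?thesis by (metis zero_fun_apply)
qed

lemma inj_chart_vector: "inj (chart_vector A (U, \<phi>) p)"
  using chart_vector_nonzero linear_injective_0[OF linear_chart_vector] by blast

text \<open>Without a bound on the dimension this would require Hadamard's lemma.\<close>

lemma tangent_vector_is_chart_vector:
  assumes B: "finite B" "card B \<le> DIM('e)" "tangent_space A p \<subseteq> span B" and v: "v \<in> tangent_space A p"
  obtains w where "v = chart_vector A (U, \<phi>) p w"
proof -
  let ?c = "chart_vector A (U, \<phi>) p"
  have i: "independent (?c ` Basis)"
    by (rule linear_independent_injective_image[OF linear_chart_vector independent_Basis])
       (rule inj_on_subset[OF inj_chart_vector], simp)
  have card: "card (?c ` Basis) = DIM('e)"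
    by (rule card_image) (rule inj_on_subset[OF inj_chart_vector], simp)
  \<comment> \<open>Otherwise \<open>v\<close> and the coordinate vectors would be
    \<open>Suc DIM('e)\<close> independent vectors in the span of at most \<open>DIM('e)\<close>
    vectors.\<close>
  have "v \<in> span (?c ` Basis)"
  proof (rule ccontr)
    assume n: "v \<notin> span (?c ` Basis)"
    then have "independent (insert v (?c ` Basis))" using i independent_insertI by blast
    moreover have "insert v (?c ` Basis) \<subseteq> span B"
      using v B(3) chart_vector_in_tangent_space by auto
    ultimately have "card (insert v (?c ` Basis)) \<le> card B"
      using independent_span_bound[OF B(1)] by blast
    moreover have "v \<notin> ?c ` Basis" using n span_base[of v "?c ` Basis"] by argo
    ultimately have "Suc DIM('e) \<le> DIM('e)" using card B(2) by simp
    then show False by simp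
  qed
  also have "span (?c ` Basis) = range ?c"
    by (simp add: linear_span_image[OF linear_chart_vector])
  finally show thesis using that by blast
qed

end

text \<open>Coordinate vectors are tangent vectors, so the coordinate expression of \<open>u\<close>
  has zero derivative on a ball. Hence \<open>u\<close> is locally constant, and connectedness does
  the rest.\<close>

lemma smooth_fun_constant:
  fixes A :: "('m::{t2_space,second_countable_topology}, 'e::euclidean_space) atlas"
  assumes A: "smooth_manifold A" and conn: "connected (UNIV :: 'm set)" and u: "smooth_fun A u"
    and zero: "\<And>p v. v \<in> tangent_space A p \<Longrightarrow> v u = 0"
  shows "u p = u q"
proof (rule connected_local_const[OF conn UNIV_I UNIV_I], rule ballI)
  fix p
  obtain U \<phi> where U: "(U, \<phi>) \<in> A" "p \<in> U" using smooth_manifold_chart[OF A] by metis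
  note ch = smooth_manifold_is_chart[OF A U(1)]
  note c = is_chartD[OF ch]
  obtain r where r: "r > 0" "ball (\<phi> p) r \<subseteq> \<phi> ` U" using c(2) U(2) open_contains_ball by blast
  have "((\<lambda>x. u (inv_into U \<phi> x)) has_derivative (\<lambda>h. 0)) (at x within ball (\<phi> p) r)" if x: "x \<in> ball (\<phi> p) r" for x
  proof -
    obtain y where y: "y \<in> U" "x = \<phi> y" using x r(2) by blast
    have "(\<lambda>w. chart_vector A (U, \<phi>) y w u) = (\<lambda>w. 0)"
      using zero chart_vector_in_tangent_space[OF A U(1) y(1)] by blast
    then show ?thesis using smooth_fun_chart_derivative[OF A U(1) y(1) u] y(2)
      by (metis has_derivative_at_withinI)
  qed
  then have const: "u (inv_into U \<phi> x) = u (inv_into U \<phi> (\<phi> p))" if "x \<in> ball (\<phi> p) r" for x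
    using has_derivative_zero_unique[OF convex_ball, of "\<phi> p" r "\<lambda>x. u (inv_into U \<phi> x)" x "\<phi> p"] that r(1) by auto
  have "open (U \<inter> \<phi> -` ball (\<phi> p) r)"
    by (rule continuous_open_preimage[OF c(3,1) open_ball])
  then have "eventually (\<lambda>x. x \<in> U \<inter> \<phi> -` ball (\<phi> p) r) (at p within UNIV)"
    by (rule eventually_at_in_open') (use U r in auto)
  then show "eventually (\<lambda>b. u p = u b) (at p within UNIV)"
    by (rule eventually_mono) (use const c(6) U(2) in force)
qed

section \<open>Differentiation of functions of two points\<close>

lemma frechet_derivative_partial:
  assumes "F differentiable (at (s, t))"
  shows "frechet_derivative (\<lambda>s. F (s, t)) (at s) a = frechet_derivative F (at (s, t)) (a, 0)"
    "frechet_derivative (\<lambda>t. F (s, t)) (at t) b = frechet_derivative F (at (s, t)) (0, b)"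
proof -
  have F: "(F has_derivative frechet_derivative F (at (s, t))) (at (s, t))"
    using assms frechet_derivative_works by blast
  have "((\<lambda>s. (s, t)) has_derivative (\<lambda>a. (a, 0))) (at s)" by (auto intro!: derivative_eq_intros)
  from frechet_derivative_at[OF has_derivative_compose[OF this F], symmetric]
  show "frechet_derivative (\<lambda>s. F (s, t)) (at s) a = frechet_derivative F (at (s, t)) (a, 0)" by simp
  have "((\<lambda>t. (s, t)) has_derivative (\<lambda>b. (0, b))) (at t)" by (auto intro!: derivative_eq_intros)
  from frechet_derivative_at[OF has_derivative_compose[OF this F], symmetric]
  show "frechet_derivative (\<lambda>t. F (s, t)) (at t) b = frechet_derivative F (at (s, t)) (0, b)" by simp
qed

lemma frechet_derivative_diagonal:
  assumes "F differentiable (at (s, s))"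
  shows "frechet_derivative (\<lambda>s. F (s, s)) (at s) a =
    frechet_derivative F (at (s, s)) (a, 0) + frechet_derivative F (at (s, s)) (0, a)"
proof -
  have F: "(F has_derivative frechet_derivative F (at (s, s))) (at (s, s))"
    using assms frechet_derivative_works by blast
  have "((\<lambda>s. (s, s)) has_derivative (\<lambda>a. (a, a))) (at s)" by (auto intro!: derivative_eq_intros)
  from frechet_derivative_at[OF has_derivative_compose[OF this F], symmetric]
  have "frechet_derivative (\<lambda>s. F (s, s)) (at s) a = frechet_derivative F (at (s, s)) (a, a)" by simp
  also have "(a, a) = (a, 0) + (0, a)" by simp
  also have "frechet_derivative F (at (s, s)) ((a, 0) + (0, a)) =
    frechet_derivative F (at (s, s)) (a, 0) + frechet_derivative F (at (s, s)) (0, a)"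
    by (rule linear_add[OF has_derivative_linear[OF F]])
  finally show ?thesis .
qed

context
  fixes A :: "('m::{t2_space,second_countable_topology}, 'e::euclidean_space) atlas"
    and F :: "'m \<times> 'm \<Rightarrow> real"
  assumes A: "smooth_manifold A" and F: "smooth_fun (product_atlas A A) F"
begin

lemma smooth_fun_slices:
  "smooth_fun A (\<lambda>x. F (x, p))" "smooth_fun A (\<lambda>x. F (p, x))" "smooth_fun A (\<lambda>x. F (x, x))"
  "smooth_fun (product_atlas A A) (\<lambda>z. F (snd z, fst z))"
  by (intro smooth_fun_compose[OF _ smooth_manifold_product[OF A A] F] smooth_map_Pair
      smooth_map_ident smooth_map_const smooth_map_fst smooth_map_snd A smooth_manifold_product)+

lemma smooth_on_product_chart:
  assumes "(U, \<phi>) \<in> A" "(V, \<psi>) \<in> A"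
  shows "smooth_on (\<phi> ` U \<times> \<psi> ` V) (\<lambda>z. F (inv_into U \<phi> (fst z), inv_into V \<psi> (snd z)))"
proof -
  note cU = smooth_manifold_is_chart[OF A assms(1)] and cV = smooth_manifold_is_chart[OF A assms(2)]
  have "(U \<times> V, map_prod \<phi> \<psi>) \<in> product_atlas A A" using assms by (auto simp: product_atlas_def)
  from smooth_fun_on_chart[OF F this]
  have "smooth_on (\<phi> ` U \<times> \<psi> ` V) (\<lambda>z. F (inv_into (U \<times> V) (map_prod \<phi> \<psi>) z))"
    by (rule smooth_on_subset) (auto simp: map_prod_def image_iff)
  then show ?thesis
    by (rule smooth_on_cong[rotated 2]) (auto simp: inv_into_map_prod[OF cU cV]
        intro: open_Times is_chartD(2)[OF cU] is_chartD(2)[OF cV])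
qed

text \<open>The derivative in the first variable is the total derivative of the coordinate
  expression \<open>H\<close> along \<open>(a, 0)\<close>. This is smooth in both variables, and it
  is then restricted to the slice through \<open>\<phi> q\<close>.\<close>

lemma smooth_fun_partial_chart_vector:
  assumes U: "(U, \<phi>) \<in> A" "q \<in> U"
  shows "smooth_fun A (\<lambda>y. chart_vector A (U, \<phi>) q a (\<lambda>x. F (x, y)))"
  unfolding smooth_fun_def
proof clarify
  fix V \<psi> assume V: "(V, \<psi>) \<in> A"
  define H where "H z = F (inv_into U \<phi> (fst z), inv_into V \<psi> (snd z))" for z
  have H: "smooth_on (\<phi> ` U \<times> \<psi> ` V) H" unfolding H_def by (rule smooth_on_product_chart[OF U(1) V])
  note oV = is_chartD(2)[OF smooth_manifold_is_chart[OF A V]]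
  have pair: "smooth_on (\<psi> ` V) (\<lambda>t. (\<phi> q, t))"
    by (intro smooth_on_Pair[OF oV] smooth_on_const[OF oV] smooth_on_linear[OF oV bounded_linear_ident])
  have "smooth_on (\<psi> ` V) (\<lambda>t. frechet_derivative H (at (\<phi> q, t)) (a, 0))"
    by (rule smooth_on_compose[OF oV smooth_on_frechet_derivative[OF H] pair]) (use U(2) in auto)
  moreover have "frechet_derivative H (at (\<phi> q, t)) (a, 0) =
      chart_vector A (U, \<phi>) q a (\<lambda>x. F (x, inv_into V \<psi> t))" if "t \<in> \<psi> ` V" for t
  proof -
    have "H differentiable (at (\<phi> q, t))" by (rule smooth_on_differentiable[OF H]) (use U that in auto)
    from frechet_derivative_partial(1)[OF this, of a] show ?thesis
      by (simp add: chart_vector_def smooth_fun_slices(1) H_def)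
  qed
  ultimately show "smooth_on (\<psi> ` V) (\<lambda>t. chart_vector A (U, \<phi>) q a (\<lambda>x. F (x, inv_into V \<psi> t)))"
    by (rule smooth_on_cong[OF oV, rotated])
qed

text \<open>The chain rule along the diagonal, in the form used for group words that contain the
  variable twice.\<close>

lemma chart_vector_diagonal:
  assumes U: "(U, \<phi>) \<in> A" "q \<in> U"
  shows "chart_vector A (U, \<phi>) q a (\<lambda>x. F (x, x)) =
    chart_vector A (U, \<phi>) q a (\<lambda>x. F (x, q)) + chart_vector A (U, \<phi>) q a (\<lambda>x. F (q, x))"
proof -
  define H where "H z = F (inv_into U \<phi> (fst z), inv_into U \<phi> (snd z))" for z
  have H: "smooth_on (\<phi> ` U \<times> \<phi> ` U) H" unfolding H_def by (rule smooth_on_product_chart[OF U(1) U(1)])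
  have d: "H differentiable (at (\<phi> q, \<phi> q))" by (rule smooth_on_differentiable[OF H]) (use U in auto)
  have q: "inv_into U \<phi> (\<phi> q) = q" using is_chartD(6)[OF smooth_manifold_is_chart[OF A U(1)] U(2)] .
  from frechet_derivative_diagonal[OF d, of a]
  show ?thesis unfolding frechet_derivative_partial[OF d, symmetric]
    by (simp add: chart_vector_def smooth_fun_slices H_def q)
qed

end

text \<open>On the whole chart image, which is open, the inner derivative equals a partial
  derivative of \<open>H\<close>; so it may be replaced under the outer derivative, and the symmetry
  of second derivatives of \<open>H\<close> applies.\<close>

lemma chart_vector_mixed:
  fixes A :: "('m::{t2_space,second_countable_topology}, 'e::euclidean_space) atlas"
  assumes A: "smooth_manifold A" and F: "smooth_fun (product_atlas A A) F" and U: "(U, \<phi>) \<in> A" "q \<in> U"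
  shows "chart_vector A (U, \<phi>) q a (\<lambda>x. chart_vector A (U, \<phi>) q b (\<lambda>y. F (x, y))) =
    chart_vector A (U, \<phi>) q b (\<lambda>y. chart_vector A (U, \<phi>) q a (\<lambda>x. F (x, y)))"
proof -
  define H where "H z = F (inv_into U \<phi> (fst z), inv_into U \<phi> (snd z))" for z
  note c = is_chartD[OF smooth_manifold_is_chart[OF A U(1)]]
  have H: "smooth_on (\<phi> ` U \<times> \<phi> ` U) H" unfolding H_def by (rule smooth_on_product_chart[OF A F U(1) U(1)])
  have d: "H differentiable (at z)" if "z \<in> \<phi> ` U \<times> \<phi> ` U" for z
    by (rule smooth_on_differentiable[OF H that])
  have d': "(\<lambda>z. frechet_derivative H (at z) v) differentiable (at (\<phi> q, \<phi> q))" for v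
    by (rule smooth_on_differentiable[OF smooth_on_frechet_derivative[OF H]]) (use U in auto)
  have q: "\<phi> q \<in> \<phi> ` U" "inv_into U \<phi> (\<phi> q) = q" using U c(6) by auto
  have sx: "smooth_fun A (\<lambda>y. chart_vector A (U, \<phi>) q a (\<lambda>x. F (x, y)))"
    by (rule smooth_fun_partial_chart_vector[OF A F U])
  have sy: "smooth_fun A (\<lambda>x. chart_vector A (U, \<phi>) q b (\<lambda>y. F (x, y)))"
    using smooth_fun_partial_chart_vector[OF A smooth_fun_slices(4)[OF A F] U, of b] by simp
  have "chart_vector A (U, \<phi>) q b (\<lambda>y. F (inv_into U \<phi> s, y)) = frechet_derivative H (at (s, \<phi> q)) (0, b)"
    if "s \<in> \<phi> ` U" for s
    using frechet_derivative_partial(2)[OF d, of s "\<phi> q" b] that q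
    by (simp add: chart_vector_def smooth_fun_slices[OF A F] H_def)
  from frechet_derivative_transform_within_open[OF smooth_on_differentiable[OF smooth_fun_on_chart[OF sy U(1)] q(1)]
      c(2) q(1) this]
  have "chart_vector A (U, \<phi>) q a (\<lambda>x. chart_vector A (U, \<phi>) q b (\<lambda>y. F (x, y))) =
    frechet_derivative (\<lambda>s. frechet_derivative H (at (s, \<phi> q)) (0, b)) (at (\<phi> q)) a"
    by (simp add: chart_vector_def[of _ _ _ a] sy)
  also have "\<dots> = frechet_derivative (\<lambda>z. frechet_derivative H (at z) (0, b)) (at (\<phi> q, \<phi> q)) (a, 0)"
    by (rule frechet_derivative_partial(1)[OF d'])
  also have "\<dots> = frechet_derivative (\<lambda>z. frechet_derivative H (at z) (a, 0)) (at (\<phi> q, \<phi> q)) (0, b)"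
    by (rule k_smooth_on_mixed_derivatives[of "\<phi> ` U \<times> \<phi> ` U"])
       (use H c(2) U in \<open>auto intro: open_Times simp: smooth_on_def\<close>)
  also have "\<dots> = frechet_derivative (\<lambda>t. frechet_derivative H (at (\<phi> q, t)) (a, 0)) (at (\<phi> q)) b"
    by (rule frechet_derivative_partial(2)[OF d', symmetric])
  also have "\<dots> = chart_vector A (U, \<phi>) q b (\<lambda>y. chart_vector A (U, \<phi>) q a (\<lambda>x. F (x, y)))"
  proof -
    have "chart_vector A (U, \<phi>) q a (\<lambda>x. F (x, inv_into U \<phi> t)) = frechet_derivative H (at (\<phi> q, t)) (a, 0)"
      if "t \<in> \<phi> ` U" for t
      using frechet_derivative_partial(1)[OF d, of "\<phi> q" t a] that q
      by (simp add: chart_vector_def smooth_fun_slices[OF A F] H_def)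
    from frechet_derivative_transform_within_open[OF smooth_on_differentiable[OF smooth_fun_on_chart[OF sx U(1)] q(1)]
        c(2) q(1) this]
    show ?thesis by (simp add: chart_vector_def[of _ _ _ b] sx)
  qed
  finally show ?thesis .
qed

section \<open>Vector fields, Lie brackets and affine connections\<close>

lemma sum_fun_apply: "(\<Sum>i\<in>I. F i) x = (\<Sum>i\<in>I. F i x)"
  by (induction I rule: infinite_finite_induct) (auto simp: plus_fun_def zero_fun_def)

lemma vector_fieldsD:
  assumes "X \<in> vector_fields A"
  shows "X p \<in> tangent_space A p" "smooth_fun A f \<Longrightarrow> smooth_fun A (\<lambda>p. X p f)"
  using assms by (auto simp: vector_fields_def vf_apply_def)

lemma vector_fieldsI:
  assumes "\<And>p. X p \<in> tangent_space A p" "\<And>f. smooth_fun A f \<Longrightarrow> smooth_fun A (\<lambda>p. X p f)"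
  shows "X \<in> vector_fields A"
  using assms by (auto simp: vector_fields_def vf_apply_def)

text \<open>On nonsmooth arguments both sides take the default value 0.\<close>

lemma vector_field_eqI:
  assumes "X \<in> vector_fields A" "Y \<in> vector_fields A"
    and "\<And>p f. smooth_fun A f \<Longrightarrow> X p f = Y p f"
  shows "X = Y"
proof (intro ext)
  fix p f show "X p f = Y p f"
    by (cases "smooth_fun A f") (simp_all add: assms(3) tangent_spaceD(4)[OF vector_fieldsD(1)[OF assms(1)]]
      tangent_spaceD(4)[OF vector_fieldsD(1)[OF assms(2)]])
qed

lemma fun_scale_in_vector_fields:
  assumes "smooth_manifold A" "X \<in> vector_fields A" "smooth_fun A h"
  shows "fun_scale h X \<in> vector_fields A"
proof (rule vector_fieldsI)
  show "fun_scale h X p \<in> tangent_space A p" for p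
    unfolding fun_scale_def by (rule subspace_scale[OF subspace_tangent_space vector_fieldsD(1)[OF assms(2)]])
  show "smooth_fun A (\<lambda>p. fun_scale h X p f)" if "smooth_fun A f" for f
    using smooth_fun_mult[OF assms(1,3) vector_fieldsD(2)[OF assms(2) that]]
    by (simp add: fun_scale_def scaleR_fun_def)
qed

lemma subspace_vector_fields:
  assumes "smooth_manifold A" shows "subspace (vector_fields A)"
proof (rule subspaceI)
  show "0 \<in> vector_fields A"
    by (rule vector_fieldsI)
       (auto simp: subspace_0[OF subspace_tangent_space] smooth_fun_const[OF assms])
  show "X + Y \<in> vector_fields A" if X: "X \<in> vector_fields A" and Y: "Y \<in> vector_fields A" for X Y
  proof (rule vector_fieldsI)
    show "(X + Y) p \<in> tangent_space A p" for p
      using subspace_add[OF subspace_tangent_space vector_fieldsD(1)[OF X] vector_fieldsD(1)[OF Y]] by simp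
    show "smooth_fun A (\<lambda>p. (X + Y) p f)" if "smooth_fun A f" for f
      using smooth_fun_add[OF assms vector_fieldsD(2)[OF X that] vector_fieldsD(2)[OF Y that]] by simp
  qed
  show "c *\<^sub>R X \<in> vector_fields A" if "X \<in> vector_fields A" for c X
    using fun_scale_in_vector_fields[OF assms that smooth_fun_const[OF assms, of c]]
    by (simp add: fun_scale_def scaleR_fun_def)
qed

lemma lie_bracket_apply: "lie_bracket X Y p f = X p (\<lambda>q. Y q f) - Y p (\<lambda>q. X q f)"
  by (simp add: lie_bracket_def vf_apply_def)

lemma lie_bracket_in_vector_fields:
  assumes A: "smooth_manifold A" and X: "X \<in> vector_fields A" and Y: "Y \<in> vector_fields A"
  shows "lie_bracket X Y \<in> vector_fields A"
proof (rule vector_fieldsI)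
  note tX = vector_fieldsD(1)[OF X] and tY = vector_fieldsD(1)[OF Y]
  note sX = vector_fieldsD(2)[OF X] and sY = vector_fieldsD(2)[OF Y]
  note dX = tangent_spaceD[OF tX] and dY = tangent_spaceD[OF tY]
  show "lie_bracket X Y p \<in> tangent_space A p" for p
  proof (rule tangent_spaceI)
    fix f h assume f: "smooth_fun A f" and h: "smooth_fun A h"
    show "lie_bracket X Y p (\<lambda>x. f x + h x) = lie_bracket X Y p f + lie_bracket X Y p h"
      by (simp add: lie_bracket_apply dX(1) dY(1) f h sX sY)
    show "lie_bracket X Y p (\<lambda>x. f x * h x) = f p * lie_bracket X Y p h + h p * lie_bracket X Y p f"
      by (simp add: lie_bracket_apply dX(1,2) dY(1,2) f h sX sY smooth_fun_mult[OF A] algebra_simps)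
  next
    fix c f assume f: "smooth_fun A f"
    show "lie_bracket X Y p (\<lambda>x. c * f x) = c * lie_bracket X Y p f"
      by (simp add: lie_bracket_apply dX(3) dY(3) f sX sY algebra_simps)
  next
    fix f assume "\<not> smooth_fun A f"
    \<comment> \<open>Here the inner functions are constantly 0, and tangent vectors annihilate
      constants.\<close>
    then show "lie_bracket X Y p f = 0"
      by (simp add: lie_bracket_apply dX(4) dY(4) tangent_vector_const[OF A tX] tangent_vector_const[OF A tY])
  qed
  show "smooth_fun A (\<lambda>p. lie_bracket X Y p f)" if f: "smooth_fun A f" for f
    unfolding lie_bracket_apply by (rule smooth_fun_diff[OF A sX[OF sY[OF f]] sY[OF sX[OF f]]])
qed

lemma lie_bracket_skew: "lie_bracket X Y = - lie_bracket Y X"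
  by (simp add: lie_bracket_def fun_eq_iff)

lemma lie_bracket_linear:
  assumes A: "smooth_manifold A" and X: "X \<in> vector_fields A" and Y: "Y \<in> vector_fields A" and Z: "Z \<in> vector_fields A"
  shows "lie_bracket (X + Y) Z = lie_bracket X Z + lie_bracket Y Z"
    "lie_bracket (c *\<^sub>R X) Z = c *\<^sub>R lie_bracket X Z"
proof -
  note sub = subspace_vector_fields[OF A]
  note dZ = tangent_spaceD[OF vector_fieldsD(1)[OF Z]]
  note s = vector_fieldsD(2)
  show "lie_bracket (X + Y) Z = lie_bracket X Z + lie_bracket Y Z"
  proof (rule vector_field_eqI)
    show "lie_bracket (X + Y) Z \<in> vector_fields A" "lie_bracket X Z + lie_bracket Y Z \<in> vector_fields A"
      by (intro lie_bracket_in_vector_fields[OF A] subspace_add[OF sub] X Y Z)+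
    show "lie_bracket (X + Y) Z p f = (lie_bracket X Z + lie_bracket Y Z) p f" if "smooth_fun A f" for p f
      by (simp add: lie_bracket_apply dZ(1) s[OF X that] s[OF Y that])
  qed
  show "lie_bracket (c *\<^sub>R X) Z = c *\<^sub>R lie_bracket X Z"
  proof (rule vector_field_eqI)
    show "lie_bracket (c *\<^sub>R X) Z \<in> vector_fields A" "c *\<^sub>R lie_bracket X Z \<in> vector_fields A"
      by (intro lie_bracket_in_vector_fields[OF A] subspace_scale[OF sub] X Z)+
    show "lie_bracket (c *\<^sub>R X) Z p f = (c *\<^sub>R lie_bracket X Z) p f" if "smooth_fun A f" for p f
      by (simp add: lie_bracket_apply dZ(3) s[OF X that] scaleR_fun_def algebra_simps)
  qed
qed

text \<open>Once the outer derivation is distributed over the inner difference, each of the six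
  threefold compositions occurs once with either sign.\<close>

lemma lie_bracket_jacobi:
  assumes A: "smooth_manifold A" and X: "X \<in> vector_fields A" and Y: "Y \<in> vector_fields A" and Z: "Z \<in> vector_fields A"
  shows "lie_bracket (lie_bracket X Y) Z + lie_bracket (lie_bracket Y Z) X + lie_bracket (lie_bracket Z X) Y = 0"
proof (rule vector_field_eqI)
  note sub = subspace_vector_fields[OF A]
  show "lie_bracket (lie_bracket X Y) Z + lie_bracket (lie_bracket Y Z) X + lie_bracket (lie_bracket Z X) Y
      \<in> vector_fields A"
    by (intro subspace_add[OF sub] lie_bracket_in_vector_fields[OF A] X Y Z)
  show "0 \<in> vector_fields A" by (rule subspace_0[OF sub])
  fix p f assume f: "smooth_fun A f"
  have d: "V p (\<lambda>q. W q (\<lambda>r. U r f) - U q (\<lambda>r. W r f)) = V p (\<lambda>q. W q (\<lambda>r. U r f)) - V p (\<lambda>q. U q (\<lambda>r. W r f))"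
    if "V \<in> vector_fields A" "W \<in> vector_fields A" "U \<in> vector_fields A" for V W U
    by (rule tangent_vector_diff[OF A vector_fieldsD(1)[OF that(1)]])
       (rule vector_fieldsD(2), fact, rule vector_fieldsD(2), fact, fact)+
  show "(lie_bracket (lie_bracket X Y) Z + lie_bracket (lie_bracket Y Z) X + lie_bracket (lie_bracket Z X) Y) p f = 0 p f"
    by (simp add: lie_bracket_apply d[OF X Y Z] d[OF Y Z X] d[OF Z X Y])
qed

lemma affine_connection_0:
  assumes A: "smooth_manifold A" and n: "affine_connection A nab" and X: "X \<in> vector_fields A"
  shows "nab X 0 = 0" "nab 0 X = 0"
proof -
  have z: "0 \<in> vector_fields A" by (rule subspace_0[OF subspace_vector_fields[OF A]])
  have "nab X (0 + 0) = nab X 0 + nab X 0" "nab (0 + 0) X = nab 0 X + nab 0 X"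
    using n X z unfolding affine_connection_def by blast+
  then show "nab X 0 = 0" "nab 0 X = 0" by (simp_all only: add_0_left) simp_all
qed

lemma sum_fun_scale_in_vector_fields:
  assumes "smooth_manifold A" "\<And>i. i \<in> I \<Longrightarrow> smooth_fun A (h i)" "\<And>i. i \<in> I \<Longrightarrow> Y i \<in> vector_fields A"
  shows "(\<Sum>i\<in>I. fun_scale (h i) (Y i)) \<in> vector_fields A"
  by (intro subspace_sum[OF subspace_vector_fields[OF assms(1)]] fun_scale_in_vector_fields assms)

lemma affine_connection_sum:
  assumes A: "smooth_manifold A" and n: "affine_connection A nab" and X: "X \<in> vector_fields A" and I: "finite I"
    and h: "\<And>i. i \<in> I \<Longrightarrow> smooth_fun A (h i)" and Y: "\<And>i. i \<in> I \<Longrightarrow> Y i \<in> vector_fields A"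
  shows "nab X (\<Sum>i\<in>I. fun_scale (h i) (Y i)) =
      (\<Sum>i\<in>I. fun_scale (vf_apply X (h i)) (Y i) + fun_scale (h i) (nab X (Y i)))"
    "nab (\<Sum>i\<in>I. fun_scale (h i) (Y i)) X = (\<Sum>i\<in>I. fun_scale (h i) (nab (Y i) X))"
proof -
  have c: "nab X (\<Sum>i\<in>I. fun_scale (h i) (Y i)) =
      (\<Sum>i\<in>I. fun_scale (vf_apply X (h i)) (Y i) + fun_scale (h i) (nab X (Y i))) \<and>
    nab (\<Sum>i\<in>I. fun_scale (h i) (Y i)) X = (\<Sum>i\<in>I. fun_scale (h i) (nab (Y i) X))"
    using I h Y
  proof (induction I rule: finite_induct)
    case empty
    then show ?case using affine_connection_0[OF A n X] by (simp only: sum.empty simp_thms)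
  next
    case (insert i I)
    have s: "(\<Sum>i\<in>I. fun_scale (h i) (Y i)) \<in> vector_fields A" "fun_scale (h i) (Y i) \<in> vector_fields A"
      using insert.prems by (auto intro: sum_fun_scale_in_vector_fields[OF A] fun_scale_in_vector_fields[OF A])
    have IH: "nab X (\<Sum>i\<in>I. fun_scale (h i) (Y i)) =
        (\<Sum>i\<in>I. fun_scale (vf_apply X (h i)) (Y i) + fun_scale (h i) (nab X (Y i))) \<and>
      nab (\<Sum>i\<in>I. fun_scale (h i) (Y i)) X = (\<Sum>i\<in>I. fun_scale (h i) (nab (Y i) X))"
      by (rule insert.IH) (use insert.prems in blast)+
    have e: "nab X (fun_scale (h i) (Y i) + (\<Sum>i\<in>I. fun_scale (h i) (Y i))) =
        nab X (fun_scale (h i) (Y i)) + nab X (\<Sum>i\<in>I. fun_scale (h i) (Y i))"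
      "nab (fun_scale (h i) (Y i) + (\<Sum>i\<in>I. fun_scale (h i) (Y i))) X =
        nab (fun_scale (h i) (Y i)) X + nab (\<Sum>i\<in>I. fun_scale (h i) (Y i)) X"
      "nab X (fun_scale (h i) (Y i)) = fun_scale (vf_apply X (h i)) (Y i) + fun_scale (h i) (nab X (Y i))"
      "nab (fun_scale (h i) (Y i)) X = fun_scale (h i) (nab (Y i) X)"
      using n X s insert.prems(1)[of i] insert.prems(2)[of i] unfolding affine_connection_def by auto
    show ?case unfolding sum.insert[OF insert.hyps] e conjunct1[OF IH] conjunct2[OF IH] by (simp only: simp_thms)
  qed
  show "nab X (\<Sum>i\<in>I. fun_scale (h i) (Y i)) =
      (\<Sum>i\<in>I. fun_scale (vf_apply X (h i)) (Y i) + fun_scale (h i) (nab X (Y i)))"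
    "nab (\<Sum>i\<in>I. fun_scale (h i) (Y i)) X = (\<Sum>i\<in>I. fun_scale (h i) (nab (Y i) X))" by (rule conjunct1[OF c] conjunct2[OF c])+
qed

section \<open>Left and right translations on a Lie group\<close>

lemma lie_groupD:
  assumes "lie_group A"
  shows "smooth_manifold A"
    and "smooth_manifold B \<Longrightarrow> smooth_map B A F \<Longrightarrow> smooth_map B A H \<Longrightarrow> smooth_map B A (\<lambda>x. F x + H x)"
    and "smooth_manifold B \<Longrightarrow> smooth_map B A F \<Longrightarrow> smooth_map B A (\<lambda>x. - F x)"
    and "smooth_manifold B \<Longrightarrow> smooth_map B A F \<Longrightarrow> smooth_map B A H \<Longrightarrow> smooth_map B A (\<lambda>x. F x - H x)"
proof -
  show A: "smooth_manifold A" using assms by (simp add: lie_group_def)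
  show add: "smooth_map B A (\<lambda>x. F x + H x)"
    if "smooth_manifold B" "smooth_map B A F" "smooth_map B A H" for F H
    using smooth_map_compose[OF that(1) smooth_manifold_product[OF A A] A smooth_map_Pair[OF that(1) A A that(2,3)]]
      assms by (fastforce simp: lie_group_def)
  show neg: "smooth_map B A (\<lambda>x. - F x)" if "smooth_manifold B" "smooth_map B A F" for F
    using smooth_map_compose[OF that(1) A A that(2)] assms by (fastforce simp: lie_group_def)
  show "smooth_map B A (\<lambda>x. F x - H x)"
    if "smooth_manifold B" "smooth_map B A F" "smooth_map B A H" for F H
    using add[OF that(1,2) neg[OF that(1,3)]] by simp
qed

text \<open>Translation preserves smoothness of functions. The inverse translation shows that it
  preserves nonsmoothness as well, as the default value 0 requires.\<close>

lemma left_push_in_tangent_space: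
  assumes A: "lie_group A" and v: "v \<in> tangent_space A p"
  shows "left_push a v \<in> tangent_space A (a + p)"
proof -
  note M = lie_groupD(1)[OF A]
  have s: "smooth_fun A (\<lambda>x. f (b + x))" if "smooth_fun A f" for f b
    by (intro smooth_fun_compose[OF M M that] lie_groupD(2)[OF A M] smooth_map_const smooth_map_ident M)
  have n: "\<not> smooth_fun A (\<lambda>x. f (a + x))" if "\<not> smooth_fun A f" for f
    using s[of "\<lambda>x. f (a + x)" "- a"] that by (auto simp: add.assoc[symmetric])
  show ?thesis
    by (rule tangent_spaceI) (auto simp: left_push_def s n tangent_spaceD[OF v])
qed

lemma left_push_zero: "left_push a 0 = 0"
  by (simp add: left_push_def fun_eq_iff)

lemma left_push_left_push: "left_push a (left_push b v) = left_push (a + b) v"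
  by (simp add: left_push_def add.assoc)

lemma left_invariant_field_lie_bracket:
  assumes "left_invariant_field X" "left_invariant_field Y"
  shows "left_invariant_field (lie_bracket X Y)"
proof -
  have X: "X (a + p) f = X p (\<lambda>x. f (a + x))" and Y: "Y (a + p) f = Y p (\<lambda>x. f (a + x))" for a p f
    using assms by (auto simp: left_invariant_field_def left_push_def)
  show ?thesis
    unfolding left_invariant_field_def left_push_def
    by (intro allI ext) (simp add: lie_bracket_apply X Y)
qed

text \<open>The right invariant field with value \<open>v\<close> at 0, that is, \<open>v\<close>
  pushed forward by the right translation by \<open>p\<close>.\<close>

definition right_field :: "'g::group_add tangent_vector \<Rightarrow> 'g vector_field"
  where "right_field v = (\<lambda>p f. v (\<lambda>x. f (x + p)))"

text \<open>The frame is a linear map \<open>E\<close> from the model space to left invariant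
  fields, bijective onto the tangent space at every point. In this form invariant tensors become
  operations on \<open>'e\<close>, without frame indices.\<close>

locale left_invariant_frame =
  fixes A :: "('g::{group_add,t2_space,second_countable_topology}, 'e::euclidean_space) atlas"
    and E :: "'e \<Rightarrow> 'g vector_field"
  assumes lie: "lie_group A" and conn: "connected (UNIV :: 'g set)"
    and E_linear: "linear E" and E_field: "E w \<in> vector_fields A" and E_left: "left_invariant_field (E w)"
    and E_onto: "v \<in> tangent_space A p \<Longrightarrow> \<exists>w. v = E w p" and E_nonzero: "E w p = 0 \<Longrightarrow> w = 0"
begin

lemmas manifold = lie_groupD(1)[OF lie]

lemma E_apply: "E w p f = E w 0 (\<lambda>x. f (p + x))"
  using E_left[of w] unfolding left_invariant_field_def left_push_def by (metis add.right_neutral)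

lemma E_in_tangent_space: "E w p \<in> tangent_space A p"
  by (rule vector_fieldsD(1)[OF E_field])

lemma linear_E_at: "linear (\<lambda>w. E w p)"
  by (rule linearI) (simp_all add: linear_add[OF E_linear] linear_scale[OF E_linear] scaleR_fun_def)

lemma E_inject: "E w p = E w' p \<Longrightarrow> w = w'"
  using E_nonzero[of "w - w'" p] linear_diff[OF linear_E_at, of w w' p] by simp

text \<open>The value at 0 determines a left invariant field. This later turns \<open>J\<close> and
  the bracket into operations on \<open>'e\<close>.\<close>

lemma left_invariant_field_is_E:
  assumes "left_invariant_field Z" "Z 0 \<in> tangent_space A 0"
  obtains w where "Z = E w"
proof -
  obtain w where w: "Z 0 = E w 0" using E_onto[OF assms(2)] by blast
  have "Z p = E w p" for p
    using assms(1) E_left[of w] w unfolding left_invariant_field_def by (metis add.right_neutral)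
  then show thesis using that by blast
qed

lemma tangent_vector_chart_vector:
  assumes "v \<in> tangent_space A p" "(U, \<phi>) \<in> A" "p \<in> U"
  obtains w where "v = chart_vector A (U, \<phi>) p w"
proof (rule tangent_vector_is_chart_vector[OF manifold assms(2,3) _ _ _ assms(1)])
  show "finite ((\<lambda>w. E w p) ` Basis)" "card ((\<lambda>w. E w p) ` Basis) \<le> DIM('e)"
    by (auto intro: card_image_le)
  have "span ((\<lambda>w. E w p) ` Basis) = range (\<lambda>w. E w p)"
    by (simp add: linear_span_image[OF linear_E_at])
  then show "tangent_space A p \<subseteq> span ((\<lambda>w. E w p) ` Basis)"
    using E_onto[of _ p] by (simp add: subset_iff image_iff)
qed (use that in blast)

text \<open>The three coordinate rules carried over to arbitrary derivations, each of which is a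
  coordinate vector in a chart around \<open>p\<close>.\<close>

lemma tangent_vector_partial:
  assumes F: "smooth_fun (product_atlas A A) F" and v: "v \<in> tangent_space A p"
  shows "smooth_fun A (\<lambda>y. v (\<lambda>x. F (x, y)))"
    and "v (\<lambda>x. F (x, x)) = v (\<lambda>x. F (x, p)) + v (\<lambda>x. F (p, x))"
    and "w \<in> tangent_space A p \<Longrightarrow> v (\<lambda>x. w (\<lambda>y. F (x, y))) = w (\<lambda>y. v (\<lambda>x. F (x, y)))"
proof -
  obtain U \<phi> where U: "(U, \<phi>) \<in> A" "p \<in> U" using smooth_manifold_chart[OF manifold] by metis
  obtain a where a: "v = chart_vector A (U, \<phi>) p a" using tangent_vector_chart_vector[OF v U] .
  show "smooth_fun A (\<lambda>y. v (\<lambda>x. F (x, y)))" unfolding a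
    by (rule smooth_fun_partial_chart_vector[OF manifold F U])
  show "v (\<lambda>x. F (x, x)) = v (\<lambda>x. F (x, p)) + v (\<lambda>x. F (p, x))" unfolding a
    by (rule chart_vector_diagonal[OF manifold F U])
  assume w: "w \<in> tangent_space A p"
  obtain b where b: "w = chart_vector A (U, \<phi>) p b" using tangent_vector_chart_vector[OF w U] .
  show "v (\<lambda>x. w (\<lambda>y. F (x, y))) = w (\<lambda>y. v (\<lambda>x. F (x, y)))" unfolding a b
    by (rule chart_vector_mixed[OF manifold F U])
qed

lemma smooth_fun_word2:
  assumes "smooth_fun A f" "smooth_map (product_atlas A A) A F"
  shows "smooth_fun (product_atlas A A) (\<lambda>z. f (F z))"
  by (rule smooth_fun_compose[OF smooth_manifold_product[OF manifold manifold] manifold assms])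

lemmas product_manifold = smooth_manifold_product[OF manifold manifold]

text \<open>Closure rules for words in two group variables: \<open>intro\<close> reduces the
  smoothness of a word to that of its letters.\<close>

lemmas smooth_map_word2 = lie_groupD(2-4)[OF lie product_manifold] smooth_map_const[OF product_manifold]
  smooth_map_fst[OF manifold manifold] smooth_map_snd[OF manifold manifold]

lemmas smooth_map_word = lie_groupD(2-4)[OF lie manifold] smooth_map_const[OF manifold] smooth_map_ident[OF manifold]

lemma smooth_fun_word:
  assumes "smooth_fun A f" "smooth_map A A F"
  shows "smooth_fun A (\<lambda>z. f (F z))"
  by (rule smooth_fun_compose[OF manifold manifold assms])

lemma right_field_in_vector_fields: "right_field (E w 0) \<in> vector_fields A"
proof (rule vector_fieldsI)
  note v = E_in_tangent_space[of w 0]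
  have s: "smooth_fun A (\<lambda>x. f (x + b))" if "smooth_fun A f" for f b
    by (intro smooth_fun_word[OF that] smooth_map_word)
  have n: "\<not> smooth_fun A (\<lambda>x. f (x + a))" if "\<not> smooth_fun A f" for f a
    using s[of "\<lambda>x. f (x + a)" "- a"] that by (auto simp: add.assoc)
  show "right_field (E w 0) p \<in> tangent_space A p" for p
    by (rule tangent_spaceI) (auto simp: right_field_def s n tangent_spaceD[OF v])
  show "smooth_fun A (\<lambda>p. right_field (E w 0) p f)" if "smooth_fun A f" for f
  proof -
    have "smooth_fun (product_atlas A A) (\<lambda>z. f (fst z + snd z))"
      by (intro smooth_fun_word2[OF that] smooth_map_word2)
    from tangent_vector_partial(1)[OF this v] show ?thesis by (simp add: right_field_def)
  qed
qed

text \<open>Left and right translations commute, so this is the symmetry of mixed derivatives.\<close>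

lemma lie_bracket_right_field: "lie_bracket (right_field (E v 0)) (E w) = 0"
proof (rule vector_field_eqI)
  show "lie_bracket (right_field (E v 0)) (E w) \<in> vector_fields A"
    by (intro lie_bracket_in_vector_fields[OF manifold] right_field_in_vector_fields E_field)
  show "0 \<in> vector_fields A" by (rule subspace_0[OF subspace_vector_fields[OF manifold]])
  fix p f assume f: "smooth_fun A f"
  have "smooth_fun (product_atlas A A) (\<lambda>z. f (fst z + (p + snd z)))"
    by (intro smooth_fun_word2[OF f] smooth_map_word2)
  from tangent_vector_partial(3)[OF this E_in_tangent_space[of v 0] E_in_tangent_space[of w 0]]
  have "E v 0 (\<lambda>x. E w 0 (\<lambda>y. f (x + (p + y)))) = E w 0 (\<lambda>y. E v 0 (\<lambda>x. f (x + (p + y))))" by simp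
  then have "E v 0 (\<lambda>x. E w (x + p) f) = E w p (\<lambda>q. E v 0 (\<lambda>x. f (x + q)))"
    unfolding E_apply[of w "_ + p"] E_apply[of w p] by (simp add: add.assoc)
  then show "lie_bracket (right_field (E v 0)) (E w) p f = 0 p f"
    by (simp add: lie_bracket_apply right_field_def)
qed

end


section \<open>The Lie algebra of a Gauduchon connection with left invariant parallel frame\<close>

lemma add_self_eq_0D: "x + x = 0 \<Longrightarrow> x = 0" for x :: "'a::real_vector"
  by (metis scaleR_2 scaleR_eq_0_iff zero_neq_numeral)

text \<open>\<open>C\<close> and \<open>B\<close> are the Chern and the Bismut connection on left invariant fields, evaluated at a point. With
  \<open>t = s / 2\<close>, the assumption \<open>split\<close> says that left invariant fields are parallel for the \<open>s\<close>-Gauduchon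
  connection.\<close>

locale gauduchon_parallel_algebra =
  fixes Q :: "'a::real_vector \<Rightarrow> 'a \<Rightarrow> real" and j :: "'a \<Rightarrow> 'a"
    and br C B :: "'a \<Rightarrow> 'a \<Rightarrow> 'a" and t :: real
  assumes Q_sym: "Q x y = Q y x"
    and Q_add: "Q (x + y) z = Q x z + Q y z"
    and Q_scale: "Q (c *\<^sub>R x) y = c * Q x y"
    and Q_pos: "x \<noteq> 0 \<Longrightarrow> Q x x > 0"
    and j_lin: "linear j" and j_j: "j (j x) = - x" and Q_j: "Q (j x) (j y) = Q x y"
    and br_add: "br (x + y) z = br x z + br y z"
    and br_scale: "br (c *\<^sub>R x) y = c *\<^sub>R br x y"
    and br_skew: "br x y = - br y x"
    and jacobi: "br (br x y) z + br (br y z) x + br (br z x) y = 0"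
    and nijenhuis0: "br (j x) (j y) - j (br (j x) y) - j (br x (j y)) - br x y = 0"
    and C_lin1: "linear (\<lambda>x. C x y)" and C_lin2: "linear (C x)"
    and C_j: "C x (j y) = j (C x y)" and C_Q: "Q (C x y) z + Q y (C x z) = 0"
    and C_chern: "C x (j y) - C (j y) x - br x (j y) = C (j x) y - C y (j x) - br (j x) y"
    and B_j: "B x (j y) = j (B x y)" and B_Q: "Q (B x y) z + Q y (B x z) = 0"
    and B_skew: "Q (B x y - B y x - br x y) z = - Q (B x z - B z x - br x z) y"
    and split: "(1 - t) *\<^sub>R C x y + t *\<^sub>R B x y = 0"
    and t0: "t \<noteq> 0" and t1: "t \<noteq> 1"
begin

lemma j_simps: "j (x + y) = j x + j y" "j (x - y) = j x - j y" "j (- x) = - j x"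
  "j (c *\<^sub>R x) = c *\<^sub>R j x" "j 0 = 0"
  using j_lin by (auto simp: linear_add linear_diff linear_neg linear_scale linear_0)

lemma Q_simps: "Q (x + y) z = Q x z + Q y z" "Q x (y + z) = Q x y + Q x z"
  "Q (c *\<^sub>R x) y = c * Q x y" "Q x (c *\<^sub>R y) = c * Q x y"
  "Q (- x) y = - Q x y" "Q x (- y) = - Q x y"
  "Q (x - y) z = Q x z - Q y z" "Q x (y - z) = Q x y - Q x z" "Q 0 x = 0" "Q x 0 = 0"
proof -
  show a: "Q (x + y) z = Q x z + Q y z" for x y z by (rule Q_add)
  show b: "Q x (y + z) = Q x y + Q x z" for x y z using Q_add Q_sym by metis
  show c: "Q (c *\<^sub>R x) y = c * Q x y" for c x y by (rule Q_scale)
  show d: "Q x (c *\<^sub>R y) = c * Q x y" for c x y using Q_scale Q_sym by metis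
  show e: "Q (- x) y = - Q x y" for x y using c[of "-1" x y] by simp
  show f: "Q x (- y) = - Q x y" for x y using d[of x "-1" y] by simp
  show "Q (x - y) z = Q x z - Q y z" using a[of x "- y" z] e by simp
  show "Q x (y - z) = Q x y - Q x z" using b[of x y "- z"] f by simp
  show "Q 0 x = 0" using c[of 0 0 x] by simp
  show "Q x 0 = 0" using d[of x 0 0] by simp
qed

lemma Q_0D: "Q x x = 0 \<Longrightarrow> x = 0"
  using Q_pos[of x] by auto

lemma Q_eqI: assumes "\<And>z. Q x z = Q y z" shows "x = y"
  using assms[of "x - y"] Q_pos[of "x - y"] Q_simps by (cases "x = y") auto

lemma Q_j_left: "Q (j x) y = - Q x (j y)"
  using Q_j[of x "j y"] by (simp add: j_j Q_simps)

lemmas C_simps = linear_add[OF C_lin1] linear_add[OF C_lin2] linear_diff[OF C_lin1] linear_diff[OF C_lin2]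
  linear_neg[OF C_lin1] linear_neg[OF C_lin2] linear_scale[OF C_lin1] linear_scale[OF C_lin2]
  linear_0[OF C_lin1] linear_0[OF C_lin2]

lemma br_simps: "br (x + y) z = br x z + br y z" "br x (y + z) = br x y + br x z"
  "br (c *\<^sub>R x) y = c *\<^sub>R br x y" "br x (c *\<^sub>R y) = c *\<^sub>R br x y"
  "br (- x) y = - br x y" "br x (- y) = - br x y"
  "br (x - y) z = br x z - br y z" "br x (y - z) = br x y - br x z" "br 0 x = 0" "br x 0 = 0"
proof -
  show a: "br (x + y) z = br x z + br y z" for x y z by (rule br_add)
  show b: "br x (y + z) = br x y + br x z" for x y z
    using br_skew[of x "y + z"] br_skew[of x y] br_skew[of x z] by (simp add: br_add)
  show c: "br (c *\<^sub>R x) y = c *\<^sub>R br x y" for c x y by (rule br_scale)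
  show d: "br x (c *\<^sub>R y) = c *\<^sub>R br x y" for c x y
    using br_skew[of x "c *\<^sub>R y"] br_skew[of x y] by (simp add: br_scale)
  show e: "br (- x) y = - br x y" for x y using c[of "-1" x y] by simp
  show f: "br x (- y) = - br x y" for x y using d[of x "-1" y] by simp
  show "br 0 x = 0" using c[of 0 0 x] by simp
  show "br x 0 = 0" using d[of x 0 0] by simp
  show "br (x - y) z = br x z - br y z" using a[of x "- y" z] e by simp
  show "br x (y - z) = br x y - br x z" using b[of x y "- z"] f by simp
qed

section \<open>The Chern torsion, its adjoint and the bracket\<close>

definition T where "T x y = C x y - C y x - br x y"

lemma T_skew: "T x y = - T y x"
  using br_skew[of x y] by (simp add: T_def)

lemma T_simps: "T (x + y) z = T x z + T y z" "T x (y + z) = T x y + T x z"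
  "T (c *\<^sub>R x) y = c *\<^sub>R T x y" "T x (c *\<^sub>R y) = c *\<^sub>R T x y"
  "T (- x) y = - T x y" "T x (- y) = - T x y"
  "T (x - y) z = T x z - T y z" "T x (y - z) = T x y - T x z" "T 0 x = 0" "T x 0 = 0"
  by (auto simp: T_def C_simps br_simps algebra_simps)

text \<open>The vanishing (1,1)-part says that \<open>j\<close> may pass from one argument to the
  other, whence T(jx,jy) = - T(x,y). Integrability, rewritten through \<open>T\<close>, then forces
  \<open>j\<close> out of the arguments.\<close>

lemma T_j: "T (j x) y = j (T x y)" "T x (j y) = j (T x y)"
proof -
  have sw: "T x (j y) = T (j x) y" for x y using C_chern by (simp add: T_def)
  \<comment> \<open>Since \<open>C x\<close> commutes with \<open>j\<close>, all terms in
    \<open>C\<close> cancel and the Nijenhuis expression of \<open>br\<close> becomes, up to sign,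
    that of \<open>T\<close>.\<close>
  have n: "T (j x) (j y) - j (T (j x) y) - j (T x (j y)) - T x y = 0"
    using nijenhuis0[of x y] by (simp add: T_def C_j j_simps j_j) (simp add: algebra_simps)
  have "T (j x) (j y) = - T x y" using sw[of "j x" y] by (simp add: j_j T_simps)
  then have "2 *\<^sub>R (T x y + j (T (j x) y)) = - (T (j x) (j y) - j (T (j x) y) - j (T x (j y)) - T x y)"
    using sw[of x y] by (simp add: scaleR_2 algebra_simps)
  then have "2 *\<^sub>R (T x y + j (T (j x) y)) = 0" by (simp add: n)
  then have "T x y = - j (T (j x) y)" by (simp add: eq_neg_iff_add_eq_0)
  then show "T (j x) y = j (T x y)" by (simp add: j_simps j_j)
  with sw show "T x (j y) = j (T x y)" by simp
qed

text \<open>The difference of the two connections is determined by the Chern torsion: the difference of two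
  solutions is totally skew, and moving \<open>j\<close> around its three arguments changes its sign.\<close>

lemma diff_formula: "Q (B x y - C x y) z = Q (T y x) z - Q (T z x) y"
proof -
  define F where "F x y z = Q (B x y - C x y) z - (Q (T y x) z - Q (T z x) y)" for x y z
  have F23: "F x y z = - F x z y" for x y z
    using B_Q[of x y z] C_Q[of x y z] Q_sym[of y] unfolding F_def Q_simps by simp
  have Fj: "F x (j y) z = - F x y (j z)" for x y z
    unfolding F_def Q_simps B_j C_j T_j by (simp add: Q_j_left Q_simps j_j T_j)
  have F12: "F y x z = - F x y z" for x y z
  proof -
    \<comment> \<open>This is the skewness of the Bismut torsion in its last two arguments, with
      \<open>B\<close> written as \<open>C\<close> plus the difference. The terms in
      \<open>B x\<close> and \<open>C x\<close> cancel because both connections are metric.\<close>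
    have a: "F y x z + F z x y = 0" for x y z
    proof -
      have "Q (B x y) z + Q (B x z) y = 0" "Q (C x y) z + Q (C x z) y = 0"
        using B_Q[of x y z] C_Q[of x y z] by (simp_all add: Q_sym[of y])
      moreover have "Q (T z y) x = - Q (T y z) x" by (simp add: T_skew[of z y] Q_simps)
      ultimately show ?thesis
        using B_skew[of x y z] unfolding F_def by (simp add: Q_simps T_def[of x])
    qed
    show ?thesis using a[of x y z] F23[of z x y] a[of y z x] F23[of x z y] F23[of y z x] by simp
  qed
  have "F x y z = 0" for x y z
  proof -
    have a: "F (j x) y z = F x (j y) z" for x y z
      using F12[of "j x" y z] Fj[of y x z] F12[of x y "j z"] Fj[of x y z] by simp
    \<comment> \<open>With \<open>z\<close> moved to the front, \<open>Fj\<close> carries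
      \<open>j\<close> from the last slot to the middle one, now occupied by \<open>y\<close>. This
      route ends with the sign opposite to \<open>a\<close>.\<close>
    have b: "F (j x) y z = - F x (j y) z" for x y z
      using F12[of "j x" y z] F23[of y "j x" z] F12[of y z "j x"] Fj[of z y x] F12[of z "j y" x]
        F23[of "j y" z x] F12[of "j y" x z] by simp
    have "F (j x) y z = 0" for x y z using a[of x y z] b[of x y z] by simp
    from this[of "- j x" y z] show ?thesis by (simp add: j_simps j_j)
  qed
  then show ?thesis unfolding F_def by simp
qed

text \<open>Solving for \<open>C\<close> gives \<open>C = t (T - P)\<close>. By
  \<open>diff_formula\<close> this choice makes \<open>P x\<close> the \<open>Q\<close>-adjoint of
  \<open>T x\<close>.\<close>

definition P where "P x y = T x y - (1 / t) *\<^sub>R C x y"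

lemma C_eq: "C x y = - t *\<^sub>R (B x y - C x y)"
  using split[of x y] by (simp add: algebra_simps eq_neg_iff_add_eq_0)

lemma P_adjoint: "Q (P x y) z = Q y (T x z)"
proof -
  have "Q (C x y) z = - t * (Q (T y x) z - Q (T z x) y)"
    using diff_formula C_eq Q_simps(3) by metis
  then show ?thesis using t0 Q_sym[of y]
    by (simp add: P_def Q_simps T_skew[of y x] T_skew[of z x])
qed

lemma P_simps: "P (x + y) z = P x z + P y z" "P x (y + z) = P x y + P x z"
  "P (c *\<^sub>R x) y = c *\<^sub>R P x y" "P x (c *\<^sub>R y) = c *\<^sub>R P x y"
  "P (- x) y = - P x y" "P x (- y) = - P x y"
  "P (x - y) z = P x z - P y z" "P x (y - z) = P x y - P x z" "P 0 x = 0" "P x 0 = 0"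
  by (auto simp: P_def C_simps T_simps algebra_simps)

text \<open>\<open>j\<close> is skew for \<open>Q\<close>. In the first argument it crosses
  \<open>Q\<close> once on its way out of the adjoint, which costs a sign; in the second it crosses
  twice.\<close>

lemma P_j: "P (j x) y = - j (P x y)" "P x (j y) = j (P x y)"
  by (rule Q_eqI, simp add: P_adjoint T_j Q_simps Q_j_left)+

lemma br_eq: "br x y = (2 * t - 1) *\<^sub>R T x y - t *\<^sub>R P x y + t *\<^sub>R P y x"
proof -
  have C: "C x y = t *\<^sub>R T x y - t *\<^sub>R P x y" for x y using t0 by (simp add: P_def algebra_simps)
  have two: "(2 * t - 1) *\<^sub>R v = t *\<^sub>R v + t *\<^sub>R v - v" for v :: 'a
    by (metis mult_2 scaleR_left_diff_distrib scaleR_left_distrib scaleR_one)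
  have "br x y = C x y - C y x - T x y" by (simp add: T_def)
  also have "\<dots> = (2 * t - 1) *\<^sub>R T x y - t *\<^sub>R P x y + t *\<^sub>R P y x"
    using C[of x y] C[of y x] T_skew[of y x] two[of "T x y"] by simp
  finally show ?thesis .
qed

section \<open>Vanishing of the Chern torsion\<close>

text \<open>\<open>T\<close> is complex linear in both arguments, \<open>P\<close> is antilinear in the first one. So the Jacobi identity splits
  according to the type, linear (L) or antilinear (A), in each of the three arguments.\<close>

lemma jacobi_types:
  shows jacobi_LLL: "(2 * t - 1)^2 *\<^sub>R (T (T x y) z + T (T y z) x + T (T z x) y) = 0" (is ?L)
    and jacobi_AAL: "(2 * t - 1) *\<^sub>R P (T x y) z + t *\<^sub>R (P x (P y z) - P y (P x z)) = 0" (is ?A)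
    and jacobi_LLA: "(2 * t - 1) *\<^sub>R (P z (T x y) + T (P z y) x - T (P z x) y)
      + t *\<^sub>R (P (P y z) x - P (P x z) y) = 0" (is ?B)
proof -
  \<comment> \<open>The homogeneous pieces of the Jacobi sum: \<open>l\<close> is linear in all
    arguments, \<open>a\<close> antilinear in the first two and linear in the third,
    \<open>b\<close> the other way round. The cyclic sums of \<open>a\<close> and \<open>b\<close>
    supply the remaining mixed types.\<close>
  define l where "l x y z = (2 * t - 1)^2 *\<^sub>R (T (T x y) z + T (T y z) x + T (T z x) y)" for x y z
  define a where "a x y z = - t *\<^sub>R ((2 * t - 1) *\<^sub>R P (T x y) z + t *\<^sub>R (P x (P y z) - P y (P x z)))" for x y z
  define b where "b x y z = t *\<^sub>R ((2 * t - 1) *\<^sub>R (P z (T x y) + T (P z y) x - T (P z x) y)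
      + t *\<^sub>R (P (P y z) x - P (P x z) y))" for x y z
  define r where "r = 2 * t - 1"
  have br_r: "br x y = r *\<^sub>R T x y - t *\<^sub>R P x y + t *\<^sub>R P y x" for x y
    unfolding r_def by (rule br_eq)
  have br_br: "br (br x y) z = (r * r) *\<^sub>R T (T x y) z - (r * t) *\<^sub>R T (P x y) z + (r * t) *\<^sub>R T (P y x) z
    - (r * t) *\<^sub>R P (T x y) z + (t * t) *\<^sub>R P (P x y) z - (t * t) *\<^sub>R P (P y x) z
    + (r * t) *\<^sub>R P z (T x y) - (t * t) *\<^sub>R P z (P x y) + (t * t) *\<^sub>R P z (P y x)" for x y z
    unfolding br_r[of "br x y" z] unfolding br_r[of x y]
    by (simp add: T_simps P_simps scaleR_right_distrib scaleR_right_diff_distrib mult.commute)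
  have S: "l x y z + (a x y z + a y z x + a z x y) + (b x y z + b y z x + b z x y) = 0" for x y z
  proof -
    have "l x y z + (a x y z + a y z x + a z x y) + (b x y z + b y z x + b z x y)
      = br (br x y) z + br (br y z) x + br (br z x) y"
      unfolding br_br l_def a_def b_def r_def[symmetric]
      by (simp add: algebra_simps power2_eq_square)
    then show ?thesis using jacobi by simp
  qed
  have lj: "l (j x) y z = j (l x y z)" "l x (j y) z = j (l x y z)" "l x y (j z) = j (l x y z)" for x y z
    unfolding l_def by (simp_all add: T_j j_simps)
  have aj: "a (j x) y z = - j (a x y z)" "a x (j y) z = - j (a x y z)" "a x y (j z) = j (a x y z)" for x y z
    unfolding a_def by (simp_all add: T_j P_j j_simps P_simps algebra_simps)
  have bj: "b (j x) y z = j (b x y z)" "b x (j y) z = j (b x y z)" "b x y (j z) = - j (b x y z)" for x y z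
    unfolding b_def by (simp_all add: T_j P_j j_simps P_simps T_simps algebra_simps)
  note js = lj aj bj j_simps j_j
  have l0: "l x y z = 0" for x y z
  proof -
    have S12: "- l x y z + (- a x y z + a y z x + a z x y) + (- b x y z + b y z x + b z x y) = 0"
      using S[of "j x" "j y" z] unfolding js minus_minus by simp
    have S23: "- l x y z + (a x y z - a y z x + a z x y) + (b x y z - b y z x + b z x y) = 0"
      using S[of x "j y" "j z"] unfolding js minus_minus by simp
    have S13: "- l x y z + (a x y z + a y z x - a z x y) + (b x y z + b y z x - b z x y) = 0"
      using S[of "j x" y "j z"] unfolding js minus_minus by simp
    \<comment> \<open>A pair of \<open>j\<close> in the arguments acts by -1 where the types agree
      and by +1 where they differ. In this combination all mixed types cancel and four copies of
      \<open>l\<close> remain.\<close>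
    have "(l x y z + l x y z) + (l x y z + l x y z) =
      (l x y z + (a x y z + a y z x + a z x y) + (b x y z + b y z x + b z x y))
      - (- l x y z + (- a x y z + a y z x + a z x y) + (- b x y z + b y z x + b z x y))
      - (- l x y z + (a x y z - a y z x + a z x y) + (b x y z - b y z x + b z x y))
      - (- l x y z + (a x y z + a y z x - a z x y) + (b x y z + b y z x - b z x y))"
      by (simp add: algebra_simps)
    then have "(l x y z + l x y z) + (l x y z + l x y z) = 0" unfolding S S12 S23 S13 by simp
    then show ?thesis by (rule add_self_eq_0D[OF add_self_eq_0D])
  qed
  have ab: "a x y z + b x y z = 0" for x y z
  proof -
    have S12: "(- a x y z + a y z x + a z x y) + (- b x y z + b y z x + b z x y) = 0"
      using S[of "j x" "j y" z] unfolding js minus_minus l0 by simp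
    have S': "0 + (a x y z + a y z x + a z x y) + (b x y z + b y z x + b z x y) = 0"
      using S[of x y z] unfolding l0 .
    \<comment> \<open>A pair of \<open>j\<close> in the first two arguments changes the sign of
      \<open>a x y z\<close> and \<open>b x y z\<close> only, whose types agree there.\<close>
    have e: "(a x y z + b x y z) + (a x y z + b x y z) =
      (0 + (a x y z + a y z x + a z x y) + (b x y z + b y z x + b z x y))
      - ((- a x y z + a y z x + a z x y) + (- b x y z + b y z x + b z x y))"
      by (simp add: algebra_simps)
    have "(a x y z + b x y z) + (a x y z + b x y z) = 0"
      unfolding e S12 S' by simp
    then show ?thesis by (rule add_self_eq_0D)
  qed
  have a0: "a x y z = 0" for x y z
  proof -
    \<comment> \<open>A single \<open>j\<close> in the first argument tells antilinear from
      linear.\<close>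
    have "j (j (a x y z)) = j (j (b x y z))" using ab[of "j x" y z] by (simp add: aj bj)
    then have "a x y z = b x y z" by (simp add: j_j)
    then show ?thesis using ab[of x y z] add_self_eq_0D by auto
  qed
  then have b0: "b x y z = 0" for x y z using ab by (metis add_0)
  show ?L using l0 by (simp add: l_def)
  show ?A using a0 t0 by (simp add: a_def)
  show ?B using b0 t0 by (simp add: b_def)
qed

text \<open>The adjoint of \<open>jacobi_AAL\<close> is (2 t - 1) T(T(x,y),z) = t [T x, T y] z. If 2
  t - 1 is nonzero, \<open>jacobi_LLL\<close> identifies the commutator with T(T(x,y),z), so (t - 1)
  T(T(x,y),z) = 0. At t = 1/2 the component \<open>jacobi_LLL\<close> carries no information, but
  there the operators \<open>T x\<close> and \<open>T y\<close> commute.\<close>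

lemma T_T: "T (T x y) z = 0"
proof -
  have A: "(2 * t - 1) *\<^sub>R T (T x y) z = t *\<^sub>R (T x (T y z) - T y (T x z))" for x y z
  proof (rule Q_eqI)
    fix w
    have "Q ((2 * t - 1) *\<^sub>R P (T x y) w + t *\<^sub>R (P x (P y w) - P y (P x w))) z = 0"
      by (simp add: jacobi_AAL Q_simps)
    then show "Q ((2 * t - 1) *\<^sub>R T (T x y) z) w = Q (t *\<^sub>R (T x (T y z) - T y (T x z))) w"
      using Q_sym[of _ w] by (simp add: Q_simps P_adjoint algebra_simps)
  qed
  show ?thesis
  proof (cases "2 * t - 1 = 0")
    case True
    have e: "T x (T y z) = T y (T x z)" for x y z
      using A[of x y z] t0 unfolding True by simp
    \<comment> \<open>Alternating \<open>e\<close> with the skewness of \<open>T\<close> leads back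
      to the same term with the opposite sign.\<close>
    have "T z (T x y) = T x (T z y)" by (rule e)
    also have "\<dots> = - T x (T y z)" by (simp add: T_skew[of z y] T_simps)
    also have "\<dots> = - T y (T x z)" by (simp only: e[of x y z])
    also have "\<dots> = T y (T z x)" by (simp add: T_skew[of x z] T_simps)
    also have "\<dots> = T z (T y x)" by (rule e)
    also have "\<dots> = - T z (T x y)" by (simp add: T_skew[of y x] T_simps)
    finally have "T z (T x y) + T z (T x y) = 0" by (simp only: add_eq_0_iff minus_minus)
    then have "T z (T x y) = 0" by (rule add_self_eq_0D)
    then show ?thesis by (simp add: T_skew[of _ z])
  next
    case False
    then have c: "T (T x y) z + T (T y z) x + T (T z x) y = 0"
      using jacobi_LLL[of x y z] by simp
    have "T x (T y z) - T y (T x z) = - T (T y z) x - T (T z x) y"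
      unfolding T_skew[of x "T y z"] T_skew[of x z] T_simps T_skew[of y "T z x"] by simp
    also have "\<dots> = T (T x y) z - (T (T x y) z + T (T y z) x + T (T z x) y)" by simp
    also have "\<dots> = T (T x y) z" unfolding c by simp
    finally have "(2 * t - 1) *\<^sub>R T (T x y) z = t *\<^sub>R T (T x y) z" using A[of x y z] by simp
    then have "(2 * t - 1 - t) *\<^sub>R T (T x y) z = 0" by (simp only: scaleR_left_diff_distrib) simp
    then show ?thesis using t1 by simp
  qed
qed

text \<open>Take \<open>z\<close> in the image of \<open>T\<close>, hence central, and apply \<open>jacobi_LLA\<close> to \<open>(z, y, z)\<close>.\<close>

lemma T_zero: "T y w = 0"
proof -
  define z where "z = T y w"
  have Tz: "T z u = 0" for u by (simp add: z_def T_T)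
  have Tz': "T u z = 0" for u using T_skew[of u z] Tz by simp
  have Pz: "P z u = 0" for u by (rule Q_eqI) (simp add: P_adjoint Tz Q_simps)
  \<comment> \<open>Every other term of this instance contains \<open>T\<close> with an argument
    \<open>z\<close>, or \<open>P z\<close>, and so vanishes.\<close>
  have "t *\<^sub>R P (P y z) z = 0"
    using jacobi_LLA[of z y z] by (simp add: Tz Tz' Pz T_simps P_simps)
  \<comment> \<open>Pairing with \<open>y\<close> and moving \<open>P\<close> across
    \<open>Q\<close> twice yields, up to sign, the square of \<open>P y z\<close>.\<close>
  then have "Q z (T (P y z) y) = 0" using P_adjoint[of "P y z" z y] t0 by (simp add: Q_simps)
  then have "Q z (T y (P y z)) = 0"
    unfolding T_skew[of "P y z" y] Q_simps by simp
  then have "Q (P y z) (P y z) = 0" unfolding P_adjoint .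
  then have "P y z = 0" by (rule Q_0D)
  then have "Q z (T y w) = 0" using P_adjoint[of y z w] by (simp add: Q_simps)
  then have "Q z z = 0" unfolding z_def .
  then have "z = 0" by (rule Q_0D)
  then show ?thesis unfolding z_def .
qed

lemma P_zero: "P x y = 0"
  by (rule Q_eqI) (simp add: P_adjoint T_zero Q_simps)

lemma br_zero: "br x y = 0"
  by (simp add: br_eq T_zero P_zero)

lemma C_zero: "C x y = 0"
  using P_zero[of x y] t0 by (simp add: P_def T_zero)

end


section \<open>Left invariant metrics\<close>

lemma riemannian_metricD:
  assumes "riemannian_metric A g" "u \<in> tangent_space A p" "v \<in> tangent_space A p"
  shows "g p u v = g p v u" "w \<in> tangent_space A p \<Longrightarrow> g p (u + w) v = g p u v + g p w v"
    "g p (c *\<^sub>R u) v = c * g p u v" "u \<noteq> 0 \<Longrightarrow> g p u u > 0"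
proof -
  have *: "g p u v = g p v u \<and> (\<forall>w\<in>tangent_space A p. g p (u + v) w = g p u w + g p v w) \<and>
       (\<forall>c. g p (c *\<^sub>R u) v = c * g p u v) \<and> (u \<noteq> 0 \<longrightarrow> g p u u > 0)"
    if "u \<in> tangent_space A p" "v \<in> tangent_space A p" for u v
    using assms(1) that unfolding riemannian_metric_def by blast
  show "g p u v = g p v u" "g p (c *\<^sub>R u) v = c * g p u v" "u \<noteq> 0 \<Longrightarrow> g p u u > 0"
    using *[OF assms(2,3)] by auto
  show "g p (u + w) v = g p u v + g p w v" if "w \<in> tangent_space A p"
    using *[OF assms(2) that] assms(3) by blast
qed

lemma riemannian_metric_minus:
  assumes "riemannian_metric A g" "u \<in> tangent_space A p" "v \<in> tangent_space A p" "w \<in> tangent_space A p"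
  shows "g p (- u) v = - g p u v" "g p v (- u) = - g p v u"
    "g p v (u + w) = g p v u + g p v w" "g p (u - w) v = g p u v - g p w v"
proof -
  note sub = subspace_tangent_space[of A p]
  have mw: "- w \<in> tangent_space A p" "- u \<in> tangent_space A p" "u + w \<in> tangent_space A p"
    using assms by (auto intro: subspace_neg[OF sub] subspace_add[OF sub])
  have neg: "g p (- u) v = - g p u v" if "u \<in> tangent_space A p" for u
    using riemannian_metricD(3)[OF assms(1) that assms(3), of "-1"] by simp
  show 1: "g p (- u) v = - g p u v" using neg assms(2) .
  show "g p v (- u) = - g p v u"
    using 1 riemannian_metricD(1)[OF assms(1) mw(2) assms(3)] riemannian_metricD(1)[OF assms(1-3)] by simp
  show "g p v (u + w) = g p v u + g p v w"
    using riemannian_metricD(1)[OF assms(1) mw(3) assms(3)] riemannian_metricD(1)[OF assms(1-3)]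
      riemannian_metricD(1)[OF assms(1,4,3)] riemannian_metricD(2)[OF assms(1-4)] by simp
  have "g p (u + - w) v = g p u v - g p w v"
    using riemannian_metricD(2)[OF assms(1-3) mw(1)] neg[OF assms(4)] by simp
  then show "g p (u - w) v = g p u v - g p w v" by (simp only: diff_conv_add_uminus)
qed

text \<open>The form \<open>w\<close> is parallel because both \<open>J\<close> and \<open>g\<close>
  are. Without torsion, brackets are differences of covariant derivatives; so the derivative terms
  and the bracket terms of the Cartan formula, six of each kind, cancel by the skewness of
  \<open>w\<close>.\<close>

lemma kaehler_if_torsion_free_hermitian:
  assumes g: "riemannian_metric A g" and J: "almost_complex_structure A J" and c: "compatible A J g"
    and h: "hermitian_connection A J g nab"
    and t: "\<And>X Y. X \<in> vector_fields A \<Longrightarrow> Y \<in> vector_fields A \<Longrightarrow> torsion nab X Y = 0"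
  shows "kaehler A J g"
  unfolding kaehler_def
proof (intro ballI ext)
  fix X Y Z p assume X: "X \<in> vector_fields A" and Y: "Y \<in> vector_fields A" and Z: "Z \<in> vector_fields A"
  define w where "w u v = g p (J p u) v" for u v
  have JT: "J p u \<in> tangent_space A p" "J p (J p u) = - u" if "u \<in> tangent_space A p" for u
    using J that unfolding almost_complex_structure_def by blast+
  have JV: "endo_vf J V \<in> vector_fields A" if "V \<in> vector_fields A" for V
    using J that unfolding almost_complex_structure_def by blast
  have nV: "nab V W \<in> vector_fields A" if "V \<in> vector_fields A" "W \<in> vector_fields A" for V W
    using h that unfolding hermitian_connection_def affine_connection_def by blast
  have skew: "w v u = - w u v" if "u \<in> tangent_space A p" "v \<in> tangent_space A p" for u v
  proof -
    have "w v u = g p u (J p v)" unfolding w_def by (rule riemannian_metricD(1)[OF g JT(1)[OF that(2)] that(1)])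
    also have "\<dots> = g p (J p u) (J p (J p v))"
      using c JT(1)[OF that(2)] that(1) unfolding compatible_def by metis
    also have "\<dots> = - w u v"
      unfolding w_def JT(2)[OF that(2)] by (rule riemannian_metric_minus(2)[OF g that(2) JT(1)[OF that(1)] that(1)])
    finally show ?thesis .
  qed
  have J_diff: "J p (u - v) = J p u - J p v" if u: "u \<in> tangent_space A p" and v: "v \<in> tangent_space A p" for u v
  proof -
    have "J p (u + (-1) *\<^sub>R v) = J p u + J p ((-1) *\<^sub>R v)"
      using J u subspace_scale[OF subspace_tangent_space v] unfolding almost_complex_structure_def by blast
    also have "J p ((-1) *\<^sub>R v) = (-1) *\<^sub>R J p v" using J v unfolding almost_complex_structure_def by blast
    finally show ?thesis by (simp only: scaleR_minus1_left diff_conv_add_uminus)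
  qed
  have D: "vf_apply V (kaehler_form J g W U) p = w (nab V W p) (U p) + w (W p) (nab V U p)"
    if "V \<in> vector_fields A" "W \<in> vector_fields A" "U \<in> vector_fields A" for V W U
  proof -
    have "vf_apply V (metric_vf g (endo_vf J W) U) =
        metric_vf g (nab V (endo_vf J W)) U + metric_vf g (endo_vf J W) (nab V U)"
      "nab V (endo_vf J W) = endo_vf J (nab V W)"
      using h that JV unfolding hermitian_connection_def by blast+
    then show ?thesis
      by (simp add: kaehler_form_def metric_vf_def endo_vf_def w_def)
  qed
  have L: "kaehler_form J g (lie_bracket V W) U p = w (nab V W p) (U p) - w (nab W V p) (U p)"
    if "V \<in> vector_fields A" "W \<in> vector_fields A" "U \<in> vector_fields A" for V W U
  proof -
    have "lie_bracket V W = nab V W - nab W V" using t[OF that(1,2)] unfolding torsion_def by (simp only: right_minus_eq)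
    then have e: "lie_bracket V W p = nab V W p - nab W V p" by simp
    note m = vector_fieldsD(1)[OF nV[OF that(1,2)], of p] vector_fieldsD(1)[OF nV[OF that(2,1)], of p]
    show ?thesis
      unfolding kaehler_form_def metric_vf_def endo_vf_def w_def e J_diff[OF m]
      by (rule riemannian_metric_minus(4)[OF g JT(1)[OF m(1)] vector_fieldsD(1)[OF that(3)] JT(1)[OF m(2)]])
  qed
  note T = vector_fieldsD(1)
  show "exterior_derivative2 (kaehler_form J g) X Y Z p = 0 p"
    unfolding exterior_derivative2_def
    using skew[OF T[OF nV[OF X Y]] T[OF Z]] skew[OF T[OF nV[OF X Z]] T[OF Y]] skew[OF T[OF nV[OF Y X]] T[OF Z]]
      skew[OF T[OF nV[OF Y Z]] T[OF X]] skew[OF T[OF nV[OF Z X]] T[OF Y]] skew[OF T[OF nV[OF Z Y]] T[OF X]]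
    by (simp add: D L X Y Z)
qed

section \<open>Frames with constant inner products\<close>

locale left_invariant_metric_frame = left_invariant_frame A E
  for A :: "('g::{group_add,t2_space,second_countable_topology}, 'e::euclidean_space) atlas"
    and E :: "'e \<Rightarrow> 'g vector_field" +
  fixes g :: "'g \<Rightarrow> 'g tangent_vector \<Rightarrow> 'g tangent_vector \<Rightarrow> real"
  assumes g: "riemannian_metric A g" and g_left: "left_invariant_metric A g"
begin

definition Q where "Q x y = g 0 (E x 0) (E y 0)"

lemma E_translate: "E w p = left_push p (E w 0)"
  using E_left[of w] unfolding left_invariant_field_def by (metis add.right_neutral)

lemma metric_E: "g p (E x p) (E y p) = Q x y"
  using g_left E_in_tangent_space[of x 0] E_in_tangent_space[of y 0]
  unfolding left_invariant_metric_def Q_def E_translate[of x p] E_translate[of y p]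
  by (metis add.right_neutral)

lemma E_at_simps: "E (x + y) p = E x p + E y p" "E (c *\<^sub>R x) p = c *\<^sub>R E x p" "E (- x) p = - E x p"
  "E (x - y) p = E x p - E y p" "E 0 p = 0"
  using linear_add[OF linear_E_at] linear_scale[OF linear_E_at] linear_neg[OF linear_E_at]
    linear_diff[OF linear_E_at] linear_0[OF linear_E_at] by auto

lemma Q_sym: "Q x y = Q y x"
  unfolding Q_def by (rule riemannian_metricD(1)[OF g E_in_tangent_space E_in_tangent_space])

lemma Q_add: "Q (x + y) z = Q x z + Q y z"
  unfolding Q_def E_at_simps
  by (rule riemannian_metricD(2)[OF g E_in_tangent_space E_in_tangent_space E_in_tangent_space])

lemma Q_scale: "Q (c *\<^sub>R x) y = c * Q x y"
  unfolding Q_def E_at_simps by (rule riemannian_metricD(3)[OF g E_in_tangent_space E_in_tangent_space])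

lemma Q_pos: "x \<noteq> 0 \<Longrightarrow> Q x x > 0"
  unfolding Q_def
  by (rule riemannian_metricD(4)[OF g E_in_tangent_space E_in_tangent_space]) (use E_nonzero in blast)

lemma linear_Q: "linear (Q x)"
  by (rule linearI) (simp_all add: Q_sym[of x] Q_add Q_scale)

text \<open>The linear map \<open>D\<close> represents \<open>Q\<close> in the standard basis;
  positivity makes it injective, hence surjective in finite dimension. So coordinates can be read
  off with the metric.\<close>

lemma dual_vector_exists: "\<exists>d. \<forall>y. Q y d = y \<bullet> u"
proof -
  define D where "D x = (\<Sum>b\<in>Basis. Q x b *\<^sub>R b)" for x
  have QD: "Q x y = y \<bullet> D x" for x y
  proof -
    have "Q x y = Q x (\<Sum>b\<in>Basis. (y \<bullet> b) *\<^sub>R b)" by (simp add: euclidean_representation)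
    also have "\<dots> = y \<bullet> D x"
      by (simp add: linear_sum[OF linear_Q] linear_scale[OF linear_Q] D_def inner_sum_right mult.commute)
    finally show ?thesis .
  qed
  have lin: "linear D"
    by (rule linearI) (simp_all add: D_def Q_add Q_scale scaleR_left_distrib sum.distrib scaleR_right.sum)
  have "x = 0" if "D x = 0" for x
    using QD[of x x] Q_pos[of x] that by auto
  then have "inj D" using linear_injective_0[OF lin] by blast
  then have "surj D" using linear_injective_imp_surjective[OF lin] by simp
  then obtain d where "D d = u" by (metis surjD)
  then have "Q y d = y \<bullet> u" for y using QD[of d y] Q_sym[of y d] by simp
  then show ?thesis by blast
qed

lemma frame_sum_at: "(\<Sum>b\<in>Basis. fun_scale (h b) (E b)) p = E (\<Sum>b\<in>Basis. h b p *\<^sub>R b) p"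
  by (simp add: sum_fun_apply fun_scale_def linear_sum[OF linear_E_at] linear_scale[OF linear_E_at])

lemma frame_sum_apply: "(\<Sum>b\<in>Basis. fun_scale (h b) (E b)) p f = (\<Sum>b\<in>Basis. h b p * E b p f)"
  by (simp add: sum_fun_apply fun_scale_def scaleR_fun_def)

text \<open>Pointwise coefficients exist by \<open>E_onto\<close>. They are smooth because each is
  the inner product of \<open>X\<close> with the invariant field of a dual vector.\<close>

lemma frame_expansion:
  assumes X: "X \<in> vector_fields A"
  obtains h where "\<And>b. smooth_fun A (h b)" "X = (\<Sum>b\<in>Basis. fun_scale (h b) (E b))"
proof -
  obtain \<xi> where \<xi>: "X p = E (\<xi> p) p" for p
    using E_onto[OF vector_fieldsD(1)[OF X]] by metis
  obtain d where d: "Q y (d b) = y \<bullet> b" for y b using dual_vector_exists by metis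
  show thesis
  proof
    fix b
    have "smooth_fun A (\<lambda>p. g p (X p) (E (d b) p))"
      using g X E_field unfolding riemannian_metric_def by blast
    then show "smooth_fun A (\<lambda>p. \<xi> p \<bullet> b)" by (simp add: \<xi> metric_E d)
  next
    show "X = (\<Sum>b\<in>Basis. fun_scale (\<lambda>p. \<xi> p \<bullet> b) (E b))"
      by (rule ext) (simp only: frame_sum_at \<xi> euclidean_representation)
  qed
qed

lemma E_expansion: "E w = (\<Sum>b\<in>Basis. fun_scale (\<lambda>p. w \<bullet> b) (E b))"
  by (rule ext) (simp only: frame_sum_at euclidean_representation)

end

section \<open>Commuting frames and commutativity of the group\<close>

locale abelian_frame = left_invariant_metric_frame +
  assumes abelian: "lie_bracket (E x) (E y) = 0"
begin

text \<open>A commuting frame behaves like coordinate fields: only derivatives of coefficients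
  survive in the bracket.\<close>

lemma lie_bracket_expansion:
  assumes h: "\<And>b. smooth_fun A (h b)" and k: "\<And>b. smooth_fun A (k b)"
    and X: "X = (\<Sum>b\<in>Basis. fun_scale (h b) (E b))" and Y: "Y = (\<Sum>b\<in>Basis. fun_scale (k b) (E b))"
  shows "lie_bracket X Y = (\<Sum>b\<in>Basis. fun_scale (vf_apply X (k b)) (E b)) - (\<Sum>b\<in>Basis. fun_scale (vf_apply Y (h b)) (E b))"
proof (rule vector_field_eqI)
  note sum_in = sum_fun_scale_in_vector_fields[OF manifold _ E_field]
  have Xv: "X \<in> vector_fields A" and Yv: "Y \<in> vector_fields A" unfolding X Y by (intro sum_in h k)+
  have sm: "smooth_fun A (vf_apply X (k b))" "smooth_fun A (vf_apply Y (h b))" for b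
    unfolding vf_apply_def by (rule vector_fieldsD(2)[OF Xv k] vector_fieldsD(2)[OF Yv h])+
  show "lie_bracket X Y \<in> vector_fields A" by (rule lie_bracket_in_vector_fields[OF manifold Xv Yv])
  show "(\<Sum>b\<in>Basis. fun_scale (vf_apply X (k b)) (E b)) - (\<Sum>b\<in>Basis. fun_scale (vf_apply Y (h b)) (E b)) \<in> vector_fields A"
    by (intro subspace_diff[OF subspace_vector_fields[OF manifold]] sum_in sm)
  fix p f assume f: "smooth_fun A f"
  have sE: "smooth_fun A (\<lambda>q. E b q f)" for b by (rule vector_fieldsD(2)[OF E_field f])
  have D: "V p (\<lambda>q. W q f) = (\<Sum>b\<in>Basis. l b p * V p (\<lambda>q. E b q f) + E b p f * V p (l b))"
    if V: "V \<in> vector_fields A" and W: "W = (\<Sum>b\<in>Basis. fun_scale (l b) (E b))" and l: "\<And>b. smooth_fun A (l b)" for V W l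
  proof -
    have "V p (\<lambda>q. W q f) = V p (\<lambda>q. \<Sum>b\<in>Basis. l b q * E b q f)" unfolding W frame_sum_apply ..
    also have "\<dots> = (\<Sum>b\<in>Basis. V p (\<lambda>q. l b q * E b q f))"
      by (rule tangent_vector_sum[OF manifold vector_fieldsD(1)[OF V] finite_Basis smooth_fun_mult[OF manifold l sE]])
    also have "\<dots> = (\<Sum>b\<in>Basis. l b p * V p (\<lambda>q. E b q f) + E b p f * V p (l b))"
      by (intro sum.cong refl tangent_spaceD(2)[OF vector_fieldsD(1)[OF V] l sE])
    finally show ?thesis .
  qed
  have comm: "E a p (\<lambda>q. E b q f) = E b p (\<lambda>q. E a q f)" for a b
    using fun_cong[OF fun_cong[OF abelian[of a b]], of p f] by (simp add: lie_bracket_apply)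
  \<comment> \<open>The second order part is a double sum, and commutativity of the frame makes it
    the same for \<open>X\<close> after \<open>Y\<close> and \<open>Y\<close> after
    \<open>X\<close>.\<close>
  have "(\<Sum>b\<in>Basis. k b p * X p (\<lambda>q. E b q f)) = (\<Sum>b\<in>Basis. \<Sum>a\<in>Basis. k b p * (h a p * E a p (\<lambda>q. E b q f)))"
    unfolding X frame_sum_apply sum_distrib_left ..
  also have "\<dots> = (\<Sum>a\<in>Basis. \<Sum>b\<in>Basis. h a p * (k b p * E b p (\<lambda>q. E a q f)))"
    by (subst sum.swap) (intro sum.cong refl, simp add: comm mult.left_commute)
  also have "\<dots> = (\<Sum>b\<in>Basis. h b p * Y p (\<lambda>q. E b q f))"
    unfolding Y frame_sum_apply sum_distrib_left ..
  finally show "lie_bracket X Y p f = ((\<Sum>b\<in>Basis. fun_scale (vf_apply X (k b)) (E b)) -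
      (\<Sum>b\<in>Basis. fun_scale (vf_apply Y (h b)) (E b))) p f"
    unfolding lie_bracket_apply D[OF Xv Y k] D[OF Yv X h]
    by (simp add: frame_sum_apply vf_apply_def sum.distrib mult.commute)
qed

lemma right_field_eq_E: "right_field (E v 0) = E v"
proof -
  let ?R = "right_field (E v 0)"
  obtain h where h: "\<And>b. smooth_fun A (h b)" "?R = (\<Sum>b\<in>Basis. fun_scale (h b) (E b))"
    using frame_expansion[OF right_field_in_vector_fields] by metis
  have Rc: "vf_apply ?R (\<lambda>p. c) = (\<lambda>p. 0)" for c
    unfolding vf_apply_def
    by (rule ext) (rule tangent_vector_const[OF manifold vector_fieldsD(1)[OF right_field_in_vector_fields]])
  have zero: "E w p (h b) = 0" if b: "b \<in> Basis" for w p b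
  proof -
    \<comment> \<open>\<open>E w\<close> has constant coefficients, so its bracket with
      \<open>?R\<close> only has the coefficients \<open>- E w p (h b)\<close>; and this bracket
      vanishes.\<close>
    have "E (\<Sum>b\<in>Basis. E w p (h b) *\<^sub>R b) p = (\<Sum>b\<in>Basis. fun_scale (vf_apply (E w) (h b)) (E b)) p"
      unfolding frame_sum_at vf_apply_def ..
    also have "\<dots> = (\<Sum>b\<in>Basis. fun_scale (vf_apply ?R (\<lambda>p. w \<bullet> b)) (E b)) p - lie_bracket ?R (E w) p"
      unfolding lie_bracket_expansion[OF h(1) smooth_fun_const[OF manifold] h(2) E_expansion] by simp
    also have "\<dots> = 0"
      unfolding lie_bracket_right_field frame_sum_at Rc by (simp add: E_at_simps)
    finally have "(\<Sum>b\<in>Basis. E w p (h b) *\<^sub>R b) = 0" by (rule E_nonzero)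
    then have "(\<Sum>b\<in>Basis. E w p (h b) *\<^sub>R b) \<bullet> b = 0" by simp
    then show ?thesis using b by (simp add: inner_sum_left_Basis)
  qed
  have const: "h b p = h b 0" if "b \<in> Basis" for b p
    by (rule smooth_fun_constant[OF manifold conn h(1)]) (use zero[OF that] E_onto in metis)
  have "(\<Sum>b\<in>Basis. h b p *\<^sub>R b) = (\<Sum>b\<in>Basis. h b 0 *\<^sub>R b)" for p
    by (rule sum.cong[OF refl]) (rule arg_cong2[OF const refl])
  then have R: "?R p = E (\<Sum>b\<in>Basis. h b 0 *\<^sub>R b) p" for p
    unfolding h(2) frame_sum_at by (rule arg_cong)
  have "?R 0 = E v 0" by (simp add: right_field_def)
  then have "(\<Sum>b\<in>Basis. h b 0 *\<^sub>R b) = v" using R[of 0] E_inject by metis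
  then show ?thesis using R by (intro ext) simp
qed

text \<open>Under a derivation at 0 a constant may be moved past the variable: the infinitesimal
  form of commutativity.\<close>

lemma E_right: "E v 0 (\<lambda>x. f (x + p)) = E v 0 (\<lambda>x. f (p + x))"
  using fun_cong[OF fun_cong[OF right_field_eq_E[of v]], of p f] E_apply[of v p f]
  by (simp add: right_field_def)

text \<open>On the diagonal the function f(x - y) is constant, so its two partial derivatives at 0
  are opposite.\<close>

lemma E_inverse:
  assumes f: "smooth_fun A f" shows "E v 0 (\<lambda>x. f (- x)) = - E v 0 f"
proof -
  have "smooth_fun (product_atlas A A) (\<lambda>z. f (fst z - snd z))"
    by (intro smooth_fun_word2[OF f] smooth_map_word2)
  from tangent_vector_partial(2)[OF this E_in_tangent_space[of v 0]]
  show ?thesis using tangent_vector_const[OF manifold E_in_tangent_space[of v 0], of "f 0"] by simp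
qed

text \<open>The two occurrences of \<open>y\<close> are differentiated separately.
  \<open>E_right\<close> moves the variable to the end of the word, \<open>E_inverse\<close> gives
  the inverted occurrence its minus sign, and both then differentiate the same function.\<close>

lemma smooth_fun_commutator:
  assumes f: "smooth_fun A f" shows "f (a + y - a - y) = f 0"
proof -
  have "smooth_fun A (\<lambda>y. f (a + y - a - y))"
    by (intro smooth_fun_word[OF f] smooth_map_word)
  then have "f (a + y - a - y) = f (a + 0 - a - 0)"
  proof (rule smooth_fun_constant[OF manifold conn, where u = "\<lambda>y. f (a + y - a - y)" and p = y and q = 0])
    fix p v assume "v \<in> tangent_space A p"
    then obtain w where v: "v = E w p" using E_onto by blast
    \<comment> \<open>Writing \<open>y = p + x\<close> moves the differentiation from
      \<open>p\<close> to 0, where \<open>E_right\<close> and \<open>E_inverse\<close>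
      apply.\<close>
    have "smooth_fun (product_atlas A A) (\<lambda>z. f (a + (p + fst z) - a - (p + snd z)))"
      by (intro smooth_fun_word2[OF f] smooth_map_word2)
    from tangent_vector_partial(2)[OF this E_in_tangent_space[of w 0]]
    have "v (\<lambda>y. f (a + y - a - y)) = E w 0 (\<lambda>x. f (a + (p + x) - a - p)) + E w 0 (\<lambda>x. f (a + p - a - (p + x)))"
      unfolding v E_apply[of w p] by simp
    also have "E w 0 (\<lambda>x. f (a + (p + x) - a - p)) = E w 0 (\<lambda>x. f (a + p + (x + (- a - p))))"
      by (simp only: diff_conv_add_uminus add.assoc)
    also have "\<dots> = E w 0 (\<lambda>x. f (a + p + ((- a - p) + x)))"
      by (rule E_right)
    also have "E w 0 (\<lambda>x. f (a + p - a - (p + x))) = E w 0 (\<lambda>x. f (a + p - a + (- x + - p)))"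
      by (simp only: diff_conv_add_uminus add.assoc minus_add)
    also have "\<dots> = - E w 0 (\<lambda>x. f (a + p - a + (x + - p)))"
      by (rule E_inverse[where f = "\<lambda>x. f (a + p - a + (x + - p))"])
         (intro smooth_fun_word[OF f] smooth_map_word)
    also have "E w 0 (\<lambda>x. f (a + p - a + (x + - p))) = E w 0 (\<lambda>x. f (a + p - a + (- p + x)))"
      by (rule E_right)
    also have "\<dots> = E w 0 (\<lambda>x. f (a + p + ((- a - p) + x)))"
      by (simp only: diff_conv_add_uminus add.assoc)
    finally show "v (\<lambda>y. f (a + y - a - y)) = 0" by simp
  qed
  then show ?thesis by simp
qed

text \<open>A nonzero commutator would be told from 0 by a bump function supported off it, against
  \<open>smooth_fun_commutator\<close>.\<close>

lemma add_commutes: "x + y = y + (x :: 'a)"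
proof (rule ccontr)
  assume "x + y \<noteq> y + x"
  then have c: "x + y - x - y \<noteq> 0" by (simp add: diff_eq_eq)
  obtain U \<phi> where U: "(U, \<phi>) \<in> A" "0 \<in> U" using smooth_manifold_chart[OF manifold] by metis
  obtain f where "smooth_fun A f" "f 0 \<noteq> 0" "\<And>q. q \<notin> - {x + y - x - y} \<Longrightarrow> f q = 0"
    using chart_bump_function_exists[OF manifold U, of "- {x + y - x - y}"] c by (metis ComplI open_Compl closed_singleton singletonD)
  then show False using smooth_fun_commutator[of f x y] by simp
qed

text \<open>If \<open>nab\<close> vanishes on pairs of frame fields, it merely differentiates the
  coefficients of its second argument; \<open>lie_bracket_expansion\<close> is the difference of two
  such terms.\<close>

lemma torsion_zero:
  assumes n: "affine_connection A nab" and par: "\<And>x y. nab (E x) (E y) = 0"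
    and X: "X \<in> vector_fields A" and Y: "Y \<in> vector_fields A"
  shows "torsion nab X Y = 0"
proof -
  obtain h where h: "\<And>b. smooth_fun A (h b)" "X = (\<Sum>b\<in>Basis. fun_scale (h b) (E b))"
    using frame_expansion[OF X] by metis
  obtain k where k: "\<And>b. smooth_fun A (k b)" "Y = (\<Sum>b\<in>Basis. fun_scale (k b) (E b))"
    using frame_expansion[OF Y] by metis
  have z: "fun_scale l 0 = 0" for l :: "'a \<Rightarrow> real"
    by (rule ext) (simp add: fun_scale_def)
  have E0: "nab V (E b) = 0" if "V = (\<Sum>b\<in>Basis. fun_scale (l b) (E b))" "\<And>b. smooth_fun A (l b)" for V b l
  proof -
    have "nab V (E b) = (\<Sum>i\<in>Basis. fun_scale (l i) (nab (E i) (E b)))"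
      unfolding that(1) by (rule affine_connection_sum(2)[OF manifold n E_field finite_Basis that(2) E_field])
    also have "\<dots> = 0" unfolding par z by (rule sum.neutral_const)
    finally show ?thesis .
  qed
  have D: "nab V W = (\<Sum>b\<in>Basis. fun_scale (vf_apply V (k b)) (E b))"
    if V: "V \<in> vector_fields A" "V = (\<Sum>b\<in>Basis. fun_scale (l b) (E b))" "\<And>b. smooth_fun A (l b)"
      and W: "W = (\<Sum>b\<in>Basis. fun_scale (k b) (E b))" "\<And>b. smooth_fun A (k b)" for V W l k
  proof -
    have "nab V W = (\<Sum>b\<in>Basis. fun_scale (vf_apply V (k b)) (E b) + fun_scale (k b) (nab V (E b)))"
      unfolding W(1) by (rule affine_connection_sum(1)[OF manifold n V(1) finite_Basis W(2) E_field])
    then show ?thesis unfolding E0[OF V(2,3)] z add_0_right .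
  qed
  show ?thesis
    unfolding torsion_def D[OF X h(2,1) k(2,1)] D[OF Y k(2,1) h(2,1)] lie_bracket_expansion[OF h(1) k(1) h(2) k(2)]
    by (rule diff_self)
qed

end

section \<open>From the connections to the algebra\<close>

lemma scaleR_fun_apply: "(c *\<^sub>R F) x = c *\<^sub>R F x"
  by (simp add: scaleR_fun_def)

lemma hermitian_connection_affine: "hermitian_connection A J g nab \<Longrightarrow> affine_connection A nab"
  by (simp add: hermitian_connection_def)

text \<open>A real scalar acts as a constant function, whose Leibniz term drops out because tangent
  vectors annihilate constants.\<close>

lemma affine_connectionD:
  assumes A: "smooth_manifold A" and n: "affine_connection A nab"
    and X: "X \<in> vector_fields A" and Y: "Y \<in> vector_fields A"
  shows "nab X Y \<in> vector_fields A"
    "Z \<in> vector_fields A \<Longrightarrow> nab (X + Y) Z = nab X Z + nab Y Z"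
    "Z \<in> vector_fields A \<Longrightarrow> nab X (Y + Z) = nab X Y + nab X Z"
    "nab (c *\<^sub>R X) Y = c *\<^sub>R nab X Y" "nab X (c *\<^sub>R Y) = c *\<^sub>R nab X Y"
proof -
  have c: "fun_scale (\<lambda>p. c) V = c *\<^sub>R V" for V :: "'a vector_field"
    by (rule ext) (simp add: fun_scale_def scaleR_fun_def)
  have d: "vf_apply X (\<lambda>p. c) = (\<lambda>p. 0)"
    unfolding vf_apply_def by (rule ext) (rule tangent_vector_const[OF A vector_fieldsD(1)[OF X]])
  have z: "fun_scale (\<lambda>p. 0) V = 0" for V :: "'a vector_field"
    by (rule ext) (simp add: fun_scale_def)
  show "nab X Y \<in> vector_fields A" using n X Y unfolding affine_connection_def by blast
  show "nab (X + Y) Z = nab X Z + nab Y Z" "nab X (Y + Z) = nab X Y + nab X Z" if "Z \<in> vector_fields A"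
    using n X Y that unfolding affine_connection_def by blast+
  have "nab (fun_scale (\<lambda>p. c) X) Y = fun_scale (\<lambda>p. c) (nab X Y)"
    "nab X (fun_scale (\<lambda>p. c) Y) = fun_scale (vf_apply X (\<lambda>p. c)) Y + fun_scale (\<lambda>p. c) (nab X Y)"
    using n X Y smooth_fun_const[OF A, of c] unfolding affine_connection_def by blast+
  then show "nab (c *\<^sub>R X) Y = c *\<^sub>R nab X Y" "nab X (c *\<^sub>R Y) = c *\<^sub>R nab X Y"
    unfolding c d z add_0_left .
qed

context left_invariant_metric_frame
begin

text \<open>The algebraic locale is interpreted at each point \<open>p\<close>, with
  \<open>C\<close> and \<open>B\<close> depending on \<open>p\<close>. \<open>E_inject\<close> and
  \<open>E_nonzero\<close> at \<open>p\<close> turn identities of vector fields into identities on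
  \<open>'e\<close>.\<close>

lemma gauduchon_parallel_frame_abelian:
  assumes J: "complex_structure A J" and Jl: "left_invariant_endo A J" and comp: "compatible A J g"
    and s: "s \<noteq> 0" "s \<noteq> 2"
    and chern: "chern_connection A J g nabc" and bismut: "bismut_connection A J g nabb"
    and par: "\<And>x y. (1 - s / 2) *\<^sub>R nabc (E x) (E y) + (s / 2) *\<^sub>R nabb (E x) (E y) = 0"
  shows "lie_bracket (E x) (E y) = 0" and "nabc (E x) (E y) = 0"
proof -
  have Jac: "almost_complex_structure A J" using J by (simp add: complex_structure_def)
  have JT: "J p u \<in> tangent_space A p" "J p (J p u) = - u" "J p (c *\<^sub>R u) = c *\<^sub>R J p u"
    if "u \<in> tangent_space A p" for p u c
    using Jac that unfolding almost_complex_structure_def by blast+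
  have J_add: "J p (u + v) = J p u + J p v" if "u \<in> tangent_space A p" "v \<in> tangent_space A p" for p u v
    using Jac that unfolding almost_complex_structure_def by blast
  have hc: "hermitian_connection A J g nabc" and hb: "hermitian_connection A J g nabb"
    using chern bismut by (auto simp: chern_connection_def bismut_connection_def)
  note ac = hermitian_connection_affine[OF hc] and ab = hermitian_connection_affine[OF hb]
  have "\<exists>w. endo_vf J (E x) = E w" for x
  proof -
    have "left_invariant_field (endo_vf J (E x))"
      using Jl E_in_tangent_space E_left[of x]
      unfolding left_invariant_field_def left_invariant_endo_def endo_vf_def by metis
    from left_invariant_field_is_E[OF this] show ?thesis
      using JT(1)[OF E_in_tangent_space[of x 0]] unfolding endo_vf_def by metis
  qed
  then obtain j where j: "endo_vf J (E x) = E (j x)" for x by metis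
  have jp: "J p (E x p) = E (j x) p" for x p using fun_cong[OF j[of x], of p] by (simp add: endo_vf_def)
  have "\<exists>w. lie_bracket (E x) (E y) = E w" for x y
    using left_invariant_field_is_E[OF left_invariant_field_lie_bracket[OF E_left E_left]
        vector_fieldsD(1)[OF lie_bracket_in_vector_fields[OF manifold E_field E_field]]] by metis
  then obtain br where br: "lie_bracket (E x) (E y) = E (br x y)" for x y by metis
  have main: "br x y = 0 \<and> nabc (E x) (E y) p = 0" for x y p
  proof -
    have "\<exists>w. nabc (E x) (E y) p = E w p" "\<exists>w. nabb (E x) (E y) p = E w p" for x y
      by (rule E_onto[OF vector_fieldsD(1)[OF affine_connectionD(1)[OF manifold ac E_field E_field]]]
          E_onto[OF vector_fieldsD(1)[OF affine_connectionD(1)[OF manifold ab E_field E_field]]])+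
    then obtain C B where C: "nabc (E x) (E y) p = E (C x y) p" and B: "nabb (E x) (E y) p = E (B x y) p" for x y
      by metis
    have tor: "torsion nabc (E x) (E y) p = E (C x y - C y x - br x y) p"
      "torsion nabb (E x) (E y) p = E (B x y - B y x - br x y) p" for x y
      unfolding torsion_def br by (simp_all add: C B E_at_simps)
    have El: "E (x + y) = E x + E y" "E (c *\<^sub>R x) = c *\<^sub>R E x" "E (- x) = - E x" for x y c
      using linear_add[OF E_linear] linear_scale[OF E_linear] linear_neg[OF E_linear] by auto
    have metric: "Q (D x y) z + Q y (D x z) = 0"
      if h: "hermitian_connection A J g nab" and D: "\<And>x y. nab (E x) (E y) p = E (D x y) p" for nab D x y z
    proof -
      have "vf_apply (E x) (metric_vf g (E y) (E z)) =
          metric_vf g (nab (E x) (E y)) (E z) + metric_vf g (E y) (nab (E x) (E z))"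
        using h E_field unfolding hermitian_connection_def by blast
      \<comment> \<open>Inner products of invariant fields are constant, so metric compatibility
        becomes skewness of \<open>D x\<close>.\<close>
      moreover have "vf_apply (E x) (metric_vf g (E y) (E z)) p = 0"
        unfolding metric_vf_def metric_E vf_apply_def by (rule tangent_vector_const[OF manifold E_in_tangent_space])
      ultimately have "metric_vf g (nab (E x) (E y)) (E z) p + metric_vf g (E y) (nab (E x) (E z)) p = 0"
        by (simp add: fun_eq_iff)
      then show ?thesis by (simp add: metric_vf_def D metric_E)
    qed
    have complex: "D x (j y) = j (D x y)"
      if h: "hermitian_connection A J g nab" and D: "\<And>x y. nab (E x) (E y) p = E (D x y) p" for nab D x y
    proof -
      have "nab (E x) (endo_vf J (E y)) = endo_vf J (nab (E x) (E y))"
        using h E_field unfolding hermitian_connection_def by blast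
      then have "nab (E x) (E (j y)) p = J p (nab (E x) (E y) p)" unfolding j by (simp add: endo_vf_def)
      then show ?thesis unfolding D jp by (rule E_inject)
    qed
    have j_lin: "linear j"
    proof (rule linearI)
      show "j (x + y) = j x + j y" for x y
        by (rule E_inject[of _ p])
           (simp add: jp[symmetric] E_at_simps J_add[OF E_in_tangent_space E_in_tangent_space])
      show "j (c *\<^sub>R x) = c *\<^sub>R j x" for c x
        by (rule E_inject[of _ p]) (simp add: jp[symmetric] E_at_simps JT(3)[OF E_in_tangent_space])
    qed
    have j_j: "j (j x) = - x" for x
      by (rule E_inject[of _ p]) (simp add: jp[symmetric] E_at_simps JT(2)[OF E_in_tangent_space])
    have br_scale: "br (c *\<^sub>R x) y = c *\<^sub>R br x y" for c x y
    proof (rule E_inject[of _ p])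
      show "E (br (c *\<^sub>R x) y) p = E (c *\<^sub>R br x y) p"
        unfolding E_at_simps br[symmetric] El
        unfolding lie_bracket_linear(2)[OF manifold E_field E_field E_field] by (simp add: scaleR_fun_def)
    qed
    have br_skew: "br x y = - br y x" for x y
    proof (rule E_inject[of _ p])
      show "E (br x y) p = E (- br y x) p"
        unfolding E_at_simps br[symmetric] using fun_cong[OF lie_bracket_skew[of "E x" "E y"], of p] by simp
    qed
    have C_lin1: "linear (\<lambda>x. C x y)" for y
      by (rule linearI; rule E_inject[of _ p])
         (simp_all only: E_at_simps C[symmetric] El scaleR_fun_apply plus_fun_apply
           affine_connectionD(2,4)[OF manifold ac E_field E_field] E_field)
    have C_lin2: "linear (C x)" for x
      by (rule linearI; rule E_inject[of _ p])
         (simp_all only: E_at_simps C[symmetric] El scaleR_fun_apply plus_fun_apply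
           affine_connectionD(3,5)[OF manifold ac E_field E_field] E_field)
    interpret gauduchon_parallel_algebra Q j br C B "s / 2"
    proof (rule gauduchon_parallel_algebra.intro)
      show "Q x y = Q y x" for x y by (rule Q_sym)
      show "Q (x + y) z = Q x z + Q y z" for x y z by (rule Q_add)
      show "Q (c *\<^sub>R x) y = c * Q x y" for c x y by (rule Q_scale)
      show "Q x x > 0" if "x \<noteq> 0" for x using that by (rule Q_pos)
      show "linear j" by (rule j_lin)
      show "j (j x) = - x" for x by (rule j_j)
      show "Q (j x) (j y) = Q x y" for x y
        using comp E_in_tangent_space unfolding compatible_def metric_E[of p, symmetric] jp[symmetric] by blast
      show "br (x + y) z = br x z + br y z" for x y z
      proof (rule E_inject[of _ p])
        show "E (br (x + y) z) p = E (br x z + br y z) p"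
          unfolding E_at_simps br[symmetric] El
          unfolding lie_bracket_linear(1)[OF manifold E_field E_field E_field] by simp
      qed
      show "br (c *\<^sub>R x) y = c *\<^sub>R br x y" for c x y by (rule br_scale)
      show "br x y = - br y x" for x y by (rule br_skew)
      show "br (br x y) z + br (br y z) x + br (br z x) y = 0" for x y z
      proof (rule E_nonzero[of _ p])
        show "E (br (br x y) z + br (br y z) x + br (br z x) y) p = 0"
          unfolding E_at_simps br[symmetric]
          using fun_cong[OF lie_bracket_jacobi[OF manifold E_field E_field E_field, of x y z], of p] by simp
      qed
      show "br (j x) (j y) - j (br (j x) y) - j (br x (j y)) - br x y = 0" for x y
      proof (rule E_nonzero[of _ p])
        have "nijenhuis J (E x) (E y) p = 0 p"
          using J E_field unfolding complex_structure_def by metis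
        then show "E (br (j x) (j y) - j (br (j x) y) - j (br x (j y)) - br x y) p = 0"
          by (simp add: nijenhuis_def j br E_at_simps)
      qed
      show "linear (\<lambda>x. C x y)" for y by (rule C_lin1)
      show "linear (C x)" for x by (rule C_lin2)
      show "C x (j y) = j (C x y)" for x y by (rule complex[OF hc C])
      show "Q (C x y) z + Q y (C x z) = 0" for x y z by (rule metric[OF hc C])
      show "B x (j y) = j (B x y)" for x y by (rule complex[OF hb B])
      show "Q (B x y) z + Q y (B x z) = 0" for x y z by (rule metric[OF hb B])
      show "C x (j y) - C (j y) x - br x (j y) = C (j x) y - C y (j x) - br (j x) y" for x y
      proof -
        \<comment> \<open>The complex vector jx + i x is i (x - i jx), hence of type (1,0).\<close>
        have ty: "(E (j x), E x) \<in> type10_fields A J" for x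
          by (simp add: type10_fields_def E_field j j_j El)
        have "complex_bilinear_ext (torsion nabc) (E (j x), E x) (cnj_field (E (j y), E y)) = 0"
          using chern ty unfolding chern_connection_def by blast
        \<comment> \<open>This is the imaginary part of the complex equation; it says T(x,jy) =
          T(jx,y).\<close>
        then have "torsion nabc (E (j x)) (E (- y)) + torsion nabc (E x) (E (j y)) = 0"
          by (simp add: complex_bilinear_ext_def cnj_field_def El zero_prod_def)
        from fun_cong[OF this, of p]
        have "E ((C (j x) (- y) - C (- y) (j x) - br (j x) (- y)) + (C x (j y) - C (j y) x - br x (j y))) p = 0"
          by (simp only: plus_fun_apply tor E_at_simps(1) zero_fun_apply)
        note zero = E_nonzero[OF this]
        have "br (j x) (- y) = - br (j x) y"
          unfolding br_skew[of "j x" "- y"] br_skew[of "j x" y] using br_scale[of "-1" y "j x"] by simp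
        with zero show ?thesis
          by (simp add: linear_neg[OF C_lin1] linear_neg[OF C_lin2] algebra_simps eq_neg_iff_add_eq_0)
      qed
      show "Q (B x y - B y x - br x y) z = - Q (B x z - B z x - br x z) y" for x y z
      proof -
        have "metric_vf g (torsion nabb (E x) (E z)) (E y) = - metric_vf g (torsion nabb (E x) (E y)) (E z)"
          using bismut E_field unfolding bismut_connection_def three_form_def by blast
        from fun_cong[OF this, of p] show ?thesis
          unfolding metric_vf_def by (simp add: tor metric_E)
      qed
      show "(1 - s / 2) *\<^sub>R C x y + (s / 2) *\<^sub>R B x y = 0" for x y
      proof (rule E_nonzero[of _ p])
        show "E ((1 - s / 2) *\<^sub>R C x y + (s / 2) *\<^sub>R B x y) p = 0"
          using fun_cong[OF par[of x y], of p] by (simp add: E_at_simps C B scaleR_fun_def)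
      qed
      show "s / 2 \<noteq> 0" "s / 2 \<noteq> 1" using s by auto
    qed
    show ?thesis using br_zero C_zero C by (simp add: E_at_simps)
  qed
  show "lie_bracket (E x) (E y) = 0" using main unfolding br by (simp add: linear_0[OF E_linear])
  show "nabc (E x) (E y) = 0" using main by (intro ext) simp
qed

end

section \<open>Construction of the frame and conclusion\<close>

lemma left_push_field_linear:
  "(\<lambda>p. left_push p 0) = 0"
  "(\<lambda>p. left_push p (u + v)) = (\<lambda>p. left_push p u) + (\<lambda>p. left_push p v)"
  "(\<lambda>p. left_push p (c *\<^sub>R u)) = c *\<^sub>R (\<lambda>p. left_push p u)"
  by (simp_all add: left_push_def scaleR_fun_def fun_eq_iff)

text \<open>\<open>E w\<close> is the left translate of the coordinate vector \<open>w\<close> at 0.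
  The predicate \<open>P\<close> carries linear properties of the given frame over to
  \<open>E\<close>, by induction over the span at 0; it will be instantiated with
  parallelism.\<close>

lemma left_invariant_frame_exists:
  fixes A :: "('g::{group_add,t2_space,second_countable_topology}, 'e::euclidean_space) atlas"
  assumes lie: "lie_group A" and conn: "connected (UNIV :: 'g set)" and m: "m = DIM('e)"
    and frame: "tangent_frame A m e" and e: "\<And>i. i < m \<Longrightarrow> left_invariant_field (e i)"
    and P: "subspace {v. P (\<lambda>p. left_push p v)}" "\<And>i. i < m \<Longrightarrow> P (e i)"
  obtains E :: "'e \<Rightarrow> 'g vector_field" where "left_invariant_frame A E" "\<And>w. P (E w)"
proof -
  note M = lie_groupD(1)[OF lie]
  let ?B = "(\<lambda>i. e i 0) ` {..<m}"
  have span: "span ?B = tangent_space A 0" using frame by (auto simp: tangent_frame_def)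
  have ev: "e i \<in> vector_fields A" if "i < m" for i using frame that by (auto simp: tangent_frame_def)
  obtain U \<phi> where U: "(U, \<phi>) \<in> A" "0 \<in> U" using smooth_manifold_chart[OF M] by metis
  let ?c = "chart_vector A (U, \<phi>) 0"
  have card: "card ?B \<le> DIM('e)" using card_image_le[of "{..<m}" "\<lambda>i. e i 0"] m by simp
  define E where "E w = (\<lambda>p. left_push p (?c w))" for w
  have ep: "(\<lambda>p. left_push p (e i 0)) = e i" if "i < m" for i
  proof
    fix p
    have "e i (p + 0) = left_push p (e i 0)" using e[OF that] unfolding left_invariant_field_def by blast
    then show "left_push p (e i 0) = e i p" by simp
  qed
  have lin: "left_push p (u + v) = left_push p u + left_push p v" "left_push p (r *\<^sub>R u) = r *\<^sub>R left_push p u"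
    for p u v and r :: real
    by (auto simp: left_push_def scaleR_fun_def fun_eq_iff)
  have sub: "subspace {v. (\<lambda>p. left_push p v) \<in> vector_fields A}"
    using subspace_vector_fields[OF M] unfolding subspace_def mem_Collect_eq left_push_field_linear by blast
  have inT: "?c w \<in> span ?B" for w unfolding span by (rule chart_vector_in_tangent_space[OF M U])
  have PE: "P (E w)" and vE: "E w \<in> vector_fields A" for w
    unfolding E_def
    by (rule span_induct[OF inT, of "\<lambda>v. P (\<lambda>p. left_push p v)"]; use P ep in auto)
       (rule span_induct[OF inT, of "\<lambda>v. (\<lambda>p. left_push p v) \<in> vector_fields A"]; use sub ep ev in auto)
  have "left_invariant_frame A E"
  proof (rule left_invariant_frame.intro)
    show "lie_group A" "connected (UNIV :: 'g set)" by fact+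
    show "linear E"
      by (rule linearI; rule ext)
         (simp_all only: E_def linear_add[OF linear_chart_vector[OF M U]] linear_scale[OF linear_chart_vector[OF M U]]
           lin scaleR_fun_apply plus_fun_apply)
    show "E w \<in> vector_fields A" for w by (rule vE)
    show "left_invariant_field (E w)" for w
      by (simp add: left_invariant_field_def E_def left_push_left_push)
    show "\<exists>w. v = E w p" if v: "v \<in> tangent_space A p" for v p
    proof -
      \<comment> \<open>Translated back to 0, \<open>v\<close> becomes a coordinate vector by the
        dimension count.\<close>
      have "left_push (- p) v \<in> tangent_space A 0"
        using left_push_in_tangent_space[OF lie v, of "- p"] by simp
      then obtain w where "left_push (- p) v = ?c w"
        using tangent_vector_is_chart_vector[OF M U _ card] span by auto
      then have "left_push p (left_push (- p) v) = E w p" by (simp add: E_def)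
      then show ?thesis unfolding left_push_left_push by (auto simp: left_push_def)
    qed
    show "w = 0" if "E w p = 0" for w p
    proof -
      have "left_push (- p) (left_push p (?c w)) = 0" using that by (simp add: E_def left_push_zero)
      then have "?c w = 0" unfolding left_push_left_push by (simp add: left_push_def)
      then show ?thesis using chart_vector_nonzero[OF M U] by blast
    qed
  qed
  then show thesis using that PE by blast
qed

theorem theorem1p3:
  fixes A :: "('g::{group_add,t2_space,second_countable_topology}, 'e::euclidean_space) atlas"
    and g :: "'g \<Rightarrow> 'g tangent_vector \<Rightarrow> 'g tangent_vector \<Rightarrow> real"
    and J :: "'g \<Rightarrow> 'g tangent_vector \<Rightarrow> 'g tangent_vector"
    and nab :: "'g connection"
    and n :: nat and s :: real
  assumes "lie_group A"
    and "connected (UNIV :: 'g set)"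
    and "DIM('e) = 2 * n"
    and "riemannian_metric A g"
    and "left_invariant_metric A g"
    and "complex_structure A J"
    and "left_invariant_endo A J"
    and "compatible A J g"
    and "s \<noteq> 0" and "s \<noteq> 2"
    and "gauduchon_connection A J g s nab"
    and "flat_connection A nab"
    and "\<exists>e. tangent_frame A (2 * n) e \<and>
           (\<forall>i<2 * n. left_invariant_field (e i) \<and> parallel_field A nab (e i))"
  shows "kaehler A J g \<and> (\<forall>x y :: 'g. x + y = y + x)"
proof -
  note M = lie_groupD(1)[OF assms(1)]
  obtain nabc nabb where chern: "chern_connection A J g nabc" and bismut: "bismut_connection A J g nabb"
    and nab: "\<And>X Y. X \<in> vector_fields A \<Longrightarrow> Y \<in> vector_fields A \<Longrightarrow>
      nab X Y = (1 - s / 2) *\<^sub>R nabc X Y + (s / 2) *\<^sub>R nabb X Y"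
    using assms(11) unfolding gauduchon_connection_def by blast
  have hc: "hermitian_connection A J g nabc" and hb: "hermitian_connection A J g nabb"
    using chern bismut by (auto simp: chern_connection_def bismut_connection_def)
  note ac = hermitian_connection_affine[OF hc] and ab = hermitian_connection_affine[OF hb]
  obtain e where e: "tangent_frame A (2 * n) e" "\<And>i. i < 2 * n \<Longrightarrow> left_invariant_field (e i)"
    "\<And>i. i < 2 * n \<Longrightarrow> parallel_field A nab (e i)"
    using assms(13) by blast
  have ev: "e i \<in> vector_fields A" if "i < 2 * n" for i using e(1) that by (auto simp: tangent_frame_def)
  \<comment> \<open>Smoothness is included because \<open>nab\<close> is controlled on smooth fields
    only; linearity of \<open>par\<close> needs both parts together.\<close>
  define par where "par Y \<longleftrightarrow> Y \<in> vector_fields A \<and> parallel_field A nab Y" for Y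
  note sv = subspace_vector_fields[OF M]
  have add: "nab X (Y + Z) = nab X Y + nab X Z" "nab X (c *\<^sub>R Y) = c *\<^sub>R nab X Y"
    if "X \<in> vector_fields A" "Y \<in> vector_fields A" "Z \<in> vector_fields A" for X Y Z c
    unfolding nab[OF that(1,2)] nab[OF that(1,3)] nab[OF that(1) subspace_add[OF sv that(2,3)]]
      nab[OF that(1) subspace_scale[OF sv that(2)]]
      affine_connectionD(3)[OF M ac that] affine_connectionD(3)[OF M ab that]
      affine_connectionD(5)[OF M ac that(1,2)] affine_connectionD(5)[OF M ab that(1,2)]
    by (simp_all only: scaleR_right_distrib scaleR_left_commute add_ac)
  have par_add: "par (Y + Z)" if "par Y" "par Z" for Y Z
    using that subspace_add[OF sv] add(1) unfolding par_def parallel_field_def by (metis add_0_left)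
  have par_scale: "par (c *\<^sub>R Y)" if "par Y" for c Y
    using that subspace_scale[OF sv] add(2) unfolding par_def parallel_field_def by (metis scaleR_zero_right)
  have "par 0" if "par Y" for Y using par_scale[OF that, of 0] by (simp only: scaleR_zero_left)
  \<comment> \<open>A Euclidean space has positive dimension, so the frame has a member, and scaling
    it by 0 gives \<open>par 0\<close>.\<close>
  moreover have n: "0 < 2 * n" unfolding assms(3)[symmetric] by simp
  moreover have pe: "par (e i)" if "i < 2 * n" for i using ev e(3) that by (simp add: par_def)
  ultimately have par_0: "par 0" by blast
  have sub: "subspace {v. par (\<lambda>p. left_push p v)}"
    using par_0 par_add par_scale unfolding subspace_def mem_Collect_eq left_push_field_linear by blast
  obtain E :: "'e \<Rightarrow> 'g vector_field" where E: "left_invariant_frame A E" and parE: "\<And>w. par (E w)"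
    using left_invariant_frame_exists[where P = par, OF assms(1,2) assms(3)[symmetric] e(1,2) sub pe] by metis
  interpret left_invariant_metric_frame A E g
    using E assms(4,5) by (simp add: left_invariant_metric_frame_def left_invariant_metric_frame_axioms_def)
  \<comment> \<open>The combination is \<open>nab (E x) (E y)\<close>, which vanishes because
    \<open>E y\<close> is parallel.\<close>
  have split: "(1 - s / 2) *\<^sub>R nabc (E x) (E y) + (s / 2) *\<^sub>R nabb (E x) (E y) = 0" for x y
    unfolding nab[OF E_field E_field, symmetric] using parE E_field by (simp only: par_def parallel_field_def)
  note zero = gauduchon_parallel_frame_abelian[OF assms(6-10) chern bismut split]
  interpret abelian_frame A E g by unfold_locales (rule zero(1))
  have "kaehler A J g"
    by (rule kaehler_if_torsion_free_hermitian[OF assms(4) _ assms(8) hc torsion_zero[OF ac zero(2)]])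
       (use assms(6) in \<open>simp add: complex_structure_def\<close>)
  then show ?thesis using add_commutes by blast
qed

end
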